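(* Let $n\ge1$, let $\mathbf{A}$ be an additive track category with strict coproducts endowed with a weak $\mathsf{nil}_n$ ringoid structure, and let $X,Y$ be two objects of $\mathbf{A}$, with weak $\mathsf{nil}_n$ cogroup structures $F_X$ and $F_Y$. Then any map $f:X\to Y$ in $\mathbf{A}$ extends uniquely to a map $\Gamma^f:F_X\to F_Y$ in the category $\mathbf{Pseudo}^{\amalg}(\mathsf{nil}_n,\mathbf{A})$; that is, there is a unique coproduct preserving pseudo natural transformation $\Gamma^f:F_X\to F_Y$ whose component at $\mathbb{Z}$ is $f$.
   Context: **Track categories.** A track category $\mathbf{A}$ is a category enriched in groupoids (a 2-category in which all 2-morphisms are invertible). Its 2-morphisms $\eta:f\Rightarrow g$ are called tracks and form the set $\mathrm{Track}(f,g)$; vertical composition is $\varphi\,\square\,\eta$ ($\eta$ first), the identity track is $0^{\square}$; whiskering is $g_*\eta$ (postcomposition) and $h^*\eta$ (precomposition). $\mathrm{ho}(\mathbf{A})$ is obtained from the underlying category by identifying maps related by a track. A strict zero object is an object $*$ such that the hom-groupoids $[[X,*]]$ and $[[*,X]]$ have one object and one morphism for all $X$. Strict coproducts: for all $X,Y$ there are $X\vee Y$ and maps $X\to X\vee Y\leftarrow Y$ inducing an isomorphism of groupoids $[[X\vee Y,Z]]\to[[X,Z]]\times[[Y,Z]]$ for all $Z$. We write $(a,b)$ for the map or track out of $X\vee Y$ with components $a,b$, and $a\vee b$ for the sum $X\vee Y\to X'\vee Y'$. **Additive track category:** a track category $\mathbf{A}$ with a strict zero object such that $\mathrm{ho}(\mathbf{A})$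 is additive, together with a biadditive bifunctor $D:\mathrm{ho}(\mathbf{A})^{op}\times\mathrm{ho}(\mathbf{A})\to\mathrm{Ab}$ and, for each $f:X\to Y$, a group isomorphism $\sigma_f:D(X,Y)\to\mathrm{Track}(f,f)$ with $\sigma_g(a)\,\square\,H=H\,\square\,\sigma_f(a)$ for $H:f\Rightarrow g$, and $h^*\sigma_f(a)=\sigma_{fh}(h^*a)$, $g_*\sigma_f(a)=\sigma_{gf}(g_*a)$. **The theories $\mathsf{nil}_n$.** For a group $G$, $\Gamma_0G=G$, $\Gamma_{k+1}G=[G,\Gamma_kG]$. For $n\ge1$, $\mathsf{nil}_n$ is the full subcategory of groups on $\mathbf{F}_p^{\mathsf{nil}_n}=\mathbf{F}_p/\Gamma_n\mathbf{F}_p$, $p\ge 0$, where $\mathbf{F}_p$ is free on $\{1,\dots,p\}$; the category $\mathsf{gr}$ of the free groups $\mathbf{F}_p$ is regarded as $\mathsf{nil}_n$ with $n=+\infty$. $\mathbf{F}_p^{\mathsf{nil}_n}$ is the $p$-fold coproduct of $\mathbb{Z}$ in $\mathsf{nil}_n$. $\mathsf{nil}_n$ is regarded as a track category with only identity tracks. **Coproduct preserving pseudofunctors.** A pseudofunctor $\varphi:\mathsf{nil}_n\rightsquigarrow\mathbf{A}$ assigns objects and maps, together with tracks $\varphi_{f,g}:\varphi(f)\varphi(g)\Rightarrow\varphi(fg)$ and $\varphi_X:\varphi(1_X)\Rightarrow 1_{\varphi(X)}$, such that $\varphi_{f,gh}\square\varphi(f)_*\varphi_{g,h}=\varphi_{fg,h}\square\varphi(h)^*\varphi_{f,g}$,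 $\varphi_{f,1_X}=\varphi(f)_*\varphi_X$, $\varphi_{1_Y,f}=\varphi(f)^*\varphi_Y$. It is coproduct preserving if: $\varphi(1_X)=1_{\varphi(X)}$ with $\varphi_X$ the identity track; $\varphi( * )=*$, $\varphi$ sends zero maps to zero maps, and $\varphi_{f,*},\varphi_{*,f}$ are identity tracks of zero maps; the map $\iota_{X,Y}:\varphi(X)\vee\varphi(Y)\to\varphi(X\vee Y)$ with components $\varphi$ of the two inclusions is an isomorphism for all $X,Y$; $(\iota_{X,Y})^*\varphi_{g,(h,k)}=(\varphi_{g,h},\varphi_{g,k})$ for $h:X\to Z$, $k:Y\to Z$, $g:Z\to T$; and $\varphi_{X\vee X}$ corresponds to $(\varphi_X,\varphi_X)$ under $\iota$. A pseudo natural transformation $\alpha:\varphi\to\psi$ consists of maps $\alpha_X:\varphi(X)\to\psi(X)$ and tracks $\alpha_f:\alpha_Y\varphi(f)\Rightarrow\psi(f)\alpha_X$ for $f:X\to Y$ in $\mathsf{nil}_n$, with $\alpha_{gf}\square(\alpha_Z)_*\varphi_{g,f}=(\alpha_X)^*\psi_{g,f}\square\psi(g)_*\alpha_f\square\varphi(f)^*\alpha_g$ for $X\xrightarrow{f}Y\xrightarrow{g}Z$ and $(\alpha_X)^*\psi_X\square\alpha_{1_X}=(\alpha_X)_*\varphi_X$. It is coproduct preserving if $\alpha_{X\vee Y}\iota_{X,Y}=\iota_{X,Y}(\alpha_X\vee\alpha_Y)$ and $(\iota_{X,Y})^*\alpha_{(f,g)}=(\alpha_f,\alpha_g)$ for $f:X\to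 Z$, $g:Y\to Z$. $\mathbf{Pseudo}^{\amalg}(\mathsf{nil}_n,\mathbf{A})$ has coproduct preserving pseudofunctors as objects and coproduct preserving pseudo natural transformations as maps. **Weak structures.** A weak $\mathsf{nil}_n$ cogroup structure on $X$ is an object $F_X$ of $\mathbf{Pseudo}^{\amalg}(\mathsf{nil}_n,\mathbf{A})$ with $F_X(\mathbb{Z})=X$. A weak $\mathsf{nil}_n$ ringoid structure on $\mathbf{A}$ is a choice of weak $\mathsf{nil}_n$ cogroup structure for every object. *)

theory Defs
  imports "HOL-Algebra.Generated_Groups" "HOL-Library.Extended_Nat"
begin

section \<open>Categories\<close>

record ('o, 'a) cat =
  Obj :: "'o set"
  Arr :: "'a set"
  Dom :: "'a \<Rightarrow> 'o"
  Cod :: "'a \<Rightarrow> 'o"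
  Ident :: "'o \<Rightarrow> 'a"
  Comp :: "'a \<Rightarrow> 'a \<Rightarrow> 'a"  (infixl "\<cdot>\<index>" 70)

definition Hom :: "('o, 'a, 'm) cat_scheme \<Rightarrow> 'o \<Rightarrow> 'o \<Rightarrow> 'a set" where
  "Hom C X Y = {f \<in> Arr C. Dom C f = X \<and> Cod C f = Y}"

locale category =
  fixes C :: "('o, 'a, 'm) cat_scheme" (structure)
  assumes Dom_Obj: "f \<in> Arr C \<Longrightarrow> Dom C f \<in> Obj C"
    and Cod_Obj: "f \<in> Arr C \<Longrightarrow> Cod C f \<in> Obj C"
    and Ident_Hom: "X \<in> Obj C \<Longrightarrow> Ident C X \<in> Hom C X X"
    and Comp_Hom: "\<lbrakk>f \<in> Hom C X Y; g \<in> Hom C Y Z\<rbrakk> \<Longrightarrow> g \<cdot> f \<in> Hom C X Z"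
    and Ident_left: "f \<in> Hom C X Y \<Longrightarrow> Ident C Y \<cdot> f = f"
    and Ident_right: "f \<in> Hom C X Y \<Longrightarrow> f \<cdot> Ident C X = f"
    and Comp_assoc: "\<lbrakk>f \<in> Hom C W X; g \<in> Hom C X Y; h \<in> Hom C Y Z\<rbrakk>
      \<Longrightarrow> (h \<cdot> g) \<cdot> f = h \<cdot> (g \<cdot> f)"

definition iso_arrow :: "('o, 'a, 'm) cat_scheme \<Rightarrow> 'a \<Rightarrow> bool" where
  "iso_arrow C m \<longleftrightarrow> m \<in> Arr C \<and>
     (\<exists>w \<in> Hom C (Cod C m) (Dom C m).
        w \<cdot>\<^bsub>C\<^esub> m = Ident C (Dom C m) \<and> m \<cdot>\<^bsub>C\<^esub> w = Ident C (Cod C m))"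

definition zero_object :: "('o, 'a, 'm) cat_scheme \<Rightarrow> 'o \<Rightarrow> bool" where
  "zero_object C Z \<longleftrightarrow> Z \<in> Obj C \<and>
     (\<forall>X \<in> Obj C. (\<exists>!f. f \<in> Hom C X Z) \<and> (\<exists>!f. f \<in> Hom C Z X))"

definition biproduct ::
  "('o, 'a, 'm) cat_scheme \<Rightarrow> ('o \<Rightarrow> 'o \<Rightarrow> 'a monoid) \<Rightarrow> 'o \<Rightarrow> 'o \<Rightarrow> 'o \<Rightarrow> bool" where
  "biproduct C H X Y S \<longleftrightarrow> S \<in> Obj C \<and>
     (\<exists>i \<in> Hom C X S. \<exists>j \<in> Hom C Y S. \<exists>p \<in> Hom C S X. \<exists>q \<in> Hom C S Y.
        p \<cdot>\<^bsub>C\<^esub> i = Ident C X \<and> q \<cdot>\<^bsub>C\<^esub> j = Ident C Y \<and>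
        p \<cdot>\<^bsub>C\<^esub> j = \<one>\<^bsub>H Y X\<^esub> \<and> q \<cdot>\<^bsub>C\<^esub> i = \<one>\<^bsub>H X Y\<^esub> \<and>
        (i \<cdot>\<^bsub>C\<^esub> p) \<otimes>\<^bsub>H S S\<^esub> (j \<cdot>\<^bsub>C\<^esub> q) = Ident C S)"

text \<open>The group \<open>H X Y\<close> is the abelian group of morphisms from \<open>X\<close> to \<open>Y\<close>. As
  everywhere below, abelian groups are commutative groups in the multiplicative notation of
  \<open>HOL-Algebra\<close>: the group operation, written as a product, is addition of morphisms and the
  unit is the zero morphism.\<close>

locale additive_category = category C
  for C :: "('o, 'a, 'm) cat_scheme" (structure) +
  fixes H :: "'o \<Rightarrow> 'o \<Rightarrow> 'a monoid"
  assumes hom_group: "\<lbrakk>X \<in> Obj C; Y \<in> Obj C\<rbrakk> \<Longrightarrow> comm_group (H X Y)"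
    and hom_carrier: "\<lbrakk>X \<in> Obj C; Y \<in> Obj C\<rbrakk> \<Longrightarrow> carrier (H X Y) = Hom C X Y"
    and Comp_add_left: "\<lbrakk>f \<in> Hom C X Y; g \<in> Hom C Y Z; g' \<in> Hom C Y Z\<rbrakk>
      \<Longrightarrow> (g \<otimes>\<^bsub>H Y Z\<^esub> g') \<cdot> f = (g \<cdot> f) \<otimes>\<^bsub>H X Z\<^esub> (g' \<cdot> f)"
    and Comp_add_right: "\<lbrakk>f \<in> Hom C X Y; f' \<in> Hom C X Y; g \<in> Hom C Y Z\<rbrakk>
      \<Longrightarrow> g \<cdot> (f \<otimes>\<^bsub>H X Y\<^esub> f') = (g \<cdot> f) \<otimes>\<^bsub>H X Z\<^esub> (g \<cdot> f')"
    and has_zero_object: "\<exists>Z. zero_object C Z"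
    and has_biproducts: "\<lbrakk>X \<in> Obj C; Y \<in> Obj C\<rbrakk> \<Longrightarrow> \<exists>S. biproduct C H X Y S"

text \<open>A category together with a chosen object and chosen binary cocones, the candidates for
  the zero object and the coproducts; that they have the required universal properties is
  always stated separately.\<close>

record ('o, 'a) pcat = "('o, 'a) cat" +
  Zero :: 'o
  Cop :: "'o \<Rightarrow> 'o \<Rightarrow> 'o"
  In1 :: "'o \<Rightarrow> 'o \<Rightarrow> 'a"
  In2 :: "'o \<Rightarrow> 'o \<Rightarrow> 'a"

definition zero_map :: "('o, 'a, 'm) pcat_scheme \<Rightarrow> 'o \<Rightarrow> 'o \<Rightarrow> 'a" where
  "zero_map C X Y =
     (THE v. v \<in> Hom C (Zero C) Y) \<cdot>\<^bsub>C\<^esub> (THE u. u \<in> Hom C X (Zero C))"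

definition copair :: "('o, 'a, 'm) pcat_scheme \<Rightarrow> 'a \<Rightarrow> 'a \<Rightarrow> 'a" where
  "copair C a b =
     (THE m. m \<in> Hom C (Cop C (Dom C a) (Dom C b)) (Cod C a) \<and>
        m \<cdot>\<^bsub>C\<^esub> In1 C (Dom C a) (Dom C b) = a \<and>
        m \<cdot>\<^bsub>C\<^esub> In2 C (Dom C a) (Dom C b) = b)"

definition cosum :: "('o, 'a, 'm) pcat_scheme \<Rightarrow> 'a \<Rightarrow> 'a \<Rightarrow> 'a" where
  "cosum C a b =
     copair C (In1 C (Cod C a) (Cod C b) \<cdot>\<^bsub>C\<^esub> a) (In2 C (Cod C a) (Cod C b) \<cdot>\<^bsub>C\<^esub> b)"


section \<open>Track categories\<close>

text \<open>\<open>HComp\<close> is the effect on tracks of the composition functor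
  \<open>[[Y,Z]] \<times> [[X,Y]] \<rightarrow> [[X,Z]]\<close>; on objects it is \<open>Comp\<close>.\<close>

record ('o, 'a, 't) trackcat = "('o, 'a) pcat" +
  Trk :: "'t set"
  Src :: "'t \<Rightarrow> 'a"
  Tgt :: "'t \<Rightarrow> 'a"
  VId :: "'a \<Rightarrow> 't"
  VComp :: "'t \<Rightarrow> 't \<Rightarrow> 't"  (infixl "\<box>\<index>" 65)
  HComp :: "'t \<Rightarrow> 't \<Rightarrow> 't"

definition Track :: "('o, 'a, 't, 'm) trackcat_scheme \<Rightarrow> 'a \<Rightarrow> 'a \<Rightarrow> 't set" where
  "Track A f g = {\<eta> \<in> Trk A. Src A \<eta> = f \<and> Tgt A \<eta> = g}"

definition HTrack :: "('o, 'a, 't, 'm) trackcat_scheme \<Rightarrow> 'o \<Rightarrow> 'o \<Rightarrow> 't set" where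
  "HTrack A X Y = {\<eta> \<in> Trk A. Src A \<eta> \<in> Hom A X Y}"

locale track_category = category A
  for A :: "('o, 'a, 't, 'm) trackcat_scheme" (structure) +
  assumes Src_Tgt_Hom: "\<eta> \<in> HTrack A X Y \<Longrightarrow> Tgt A \<eta> \<in> Hom A X Y"
    and Src_Arr: "\<eta> \<in> Trk A \<Longrightarrow> Src A \<eta> \<in> Arr A"
    and VId_Track: "f \<in> Arr A \<Longrightarrow> VId A f \<in> Track A f f"
    and VComp_Track: "\<lbrakk>\<eta> \<in> Track A f g; \<phi> \<in> Track A g h\<rbrakk> \<Longrightarrow> \<phi> \<box> \<eta> \<in> Track A f h"
    and VId_left: "\<eta> \<in> Track A f g \<Longrightarrow> VId A g \<box> \<eta> = \<eta>"
    and VId_right: "\<eta> \<in> Track A f g \<Longrightarrow> \<eta> \<box> VId A f = \<eta>"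
    and VComp_assoc: "\<lbrakk>\<eta> \<in> Track A f g; \<phi> \<in> Track A g h; \<psi> \<in> Track A h k\<rbrakk>
      \<Longrightarrow> (\<psi> \<box> \<phi>) \<box> \<eta> = \<psi> \<box> (\<phi> \<box> \<eta>)"
    and VComp_inverse: "\<eta> \<in> Track A f g
      \<Longrightarrow> \<exists>\<phi> \<in> Track A g f. \<phi> \<box> \<eta> = VId A f \<and> \<eta> \<box> \<phi> = VId A g"
    and HComp_Track: "\<lbrakk>f \<in> Hom A X Y; g \<in> Hom A Y Z; \<eta> \<in> Track A f f'; \<theta> \<in> Track A g g'\<rbrakk>
      \<Longrightarrow> HComp A \<theta> \<eta> \<in> Track A (g \<cdot> f) (g' \<cdot> f')"
    and HComp_VId: "\<lbrakk>f \<in> Hom A X Y; g \<in> Hom A Y Z\<rbrakk>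
      \<Longrightarrow> HComp A (VId A g) (VId A f) = VId A (g \<cdot> f)"
    and HComp_VComp: "\<lbrakk>f \<in> Hom A X Y; g \<in> Hom A Y Z;
        \<eta> \<in> Track A f f'; \<eta>' \<in> Track A f' f''; \<theta> \<in> Track A g g'; \<theta>' \<in> Track A g' g''\<rbrakk>
      \<Longrightarrow> HComp A (\<theta>' \<box> \<theta>) (\<eta>' \<box> \<eta>) = HComp A \<theta>' \<eta>' \<box> HComp A \<theta> \<eta>"
    and HComp_assoc: "\<lbrakk>\<eta> \<in> HTrack A W X; \<theta> \<in> HTrack A X Y; \<zeta> \<in> HTrack A Y Z\<rbrakk>
      \<Longrightarrow> HComp A (HComp A \<zeta> \<theta>) \<eta> = HComp A \<zeta> (HComp A \<theta> \<eta>)"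
    and HComp_Ident_left: "\<eta> \<in> HTrack A X Y \<Longrightarrow> HComp A (VId A (Ident A Y)) \<eta> = \<eta>"
    and HComp_Ident_right: "\<eta> \<in> HTrack A X Y \<Longrightarrow> HComp A \<eta> (VId A (Ident A X)) = \<eta>"

text \<open>The whiskerings \<open>g\<^sub>*\<eta>\<close> and \<open>h\<^sup>*\<eta>\<close>.\<close>

definition post :: "('o, 'a, 't, 'm) trackcat_scheme \<Rightarrow> 'a \<Rightarrow> 't \<Rightarrow> 't" where
  "post A g \<eta> = HComp A (VId A g) \<eta>"

definition pre :: "('o, 'a, 't, 'm) trackcat_scheme \<Rightarrow> 'a \<Rightarrow> 't \<Rightarrow> 't" where
  "pre A h \<eta> = HComp A \<eta> (VId A h)"

text \<open>The copair \<open>(s,t)\<close> and the sum \<open>s \<or> t\<close> of two tracks.\<close>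

definition tcopair :: "('o, 'a, 't, 'm) trackcat_scheme \<Rightarrow> 't \<Rightarrow> 't \<Rightarrow> 't" where
  "tcopair A s t =
     (let X = Dom A (Src A s); Y = Dom A (Src A t)
      in THE \<eta>. \<eta> \<in> HTrack A (Cop A X Y) (Cod A (Src A s)) \<and>
           pre A (In1 A X Y) \<eta> = s \<and> pre A (In2 A X Y) \<eta> = t)"

definition tcosum :: "('o, 'a, 't, 'm) trackcat_scheme \<Rightarrow> 't \<Rightarrow> 't \<Rightarrow> 't" where
  "tcosum A s t =
     (let X' = Cod A (Src A s); Y' = Cod A (Src A t)
      in tcopair A (post A (In1 A X' Y') s) (post A (In2 A X' Y') t))"

definition strict_zero :: "('o, 'a, 't, 'm) trackcat_scheme \<Rightarrow> bool" where
  "strict_zero A \<longleftrightarrow> Zero A \<in> Obj A \<and>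
     (\<forall>X \<in> Obj A.
        (\<exists>!f. f \<in> Hom A X (Zero A)) \<and> (\<exists>!\<eta>. \<eta> \<in> HTrack A X (Zero A)) \<and>
        (\<exists>!f. f \<in> Hom A (Zero A) X) \<and> (\<exists>!\<eta>. \<eta> \<in> HTrack A (Zero A) X))"

text \<open>Restriction along the two coproduct inclusions is automatically a functor of hom-groupoids,
  so it is an isomorphism iff it is bijective on maps and on tracks.\<close>

definition strict_coproducts :: "('o, 'a, 't, 'm) trackcat_scheme \<Rightarrow> bool" where
  "strict_coproducts A \<longleftrightarrow>
     (\<forall>X \<in> Obj A. \<forall>Y \<in> Obj A. Cop A X Y \<in> Obj A \<and>
        In1 A X Y \<in> Hom A X (Cop A X Y) \<and> In2 A X Y \<in> Hom A Y (Cop A X Y) \<and>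
        (\<forall>Z \<in> Obj A.
           bij_betw (\<lambda>m. (m \<cdot>\<^bsub>A\<^esub> In1 A X Y, m \<cdot>\<^bsub>A\<^esub> In2 A X Y))
             (Hom A (Cop A X Y) Z) (Hom A X Z \<times> Hom A Y Z) \<and>
           bij_betw (\<lambda>\<eta>. (pre A (In1 A X Y) \<eta>, pre A (In2 A X Y) \<eta>))
             (HTrack A (Cop A X Y) Z) (HTrack A X Z \<times> HTrack A Y Z)))"

definition ho_class :: "('o, 'a, 't, 'm) trackcat_scheme \<Rightarrow> 'a \<Rightarrow> 'a set" where
  "ho_class A f = {g \<in> Arr A. Track A f g \<noteq> {}}"

definition ho :: "('o, 'a, 't, 'm) trackcat_scheme \<Rightarrow> ('o, 'a set) cat" where
  "ho A = \<lparr>Obj = Obj A, Arr = ho_class A ` Arr A,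
     Dom = (\<lambda>c. the_elem (Dom A ` c)), Cod = (\<lambda>c. the_elem (Cod A ` c)),
     Ident = (\<lambda>X. ho_class A (Ident A X)),
     Comp = (\<lambda>d c. \<Union>g \<in> d. \<Union>f \<in> c. ho_class A (g \<cdot>\<^bsub>A\<^esub> f))\<rparr>"

definition track_group :: "('o, 'a, 't, 'm) trackcat_scheme \<Rightarrow> 'a \<Rightarrow> 't monoid" where
  "track_group A f = \<lparr>carrier = Track A f f, mult = VComp A, one = VId A f\<rparr>"

text \<open>The bifunctor \<open>D\<close> has values \<open>D X Y\<close> on objects and \<open>Dm u v\<close> on maps, so that
  \<open>u\<^sup>*a = Dm u 1 a\<close> and \<open>v\<^sub>*a = Dm 1 v a\<close>; \<open>H\<close> is the additive structure of \<open>ho(A)\<close>.\<close>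

locale additive_track_category = track_category A
  for A :: "('o, 'a, 't, 'm) trackcat_scheme" (structure) +
  fixes H :: "'o \<Rightarrow> 'o \<Rightarrow> 'a set monoid"
    and D :: "'o \<Rightarrow> 'o \<Rightarrow> 'd monoid"
    and Dm :: "'a set \<Rightarrow> 'a set \<Rightarrow> 'd \<Rightarrow> 'd"
    and \<sigma> :: "'a \<Rightarrow> 'd \<Rightarrow> 't"
  assumes strict_zero: "strict_zero A"
    and ho_additive: "additive_category (ho A) H"
    and D_group: "\<lbrakk>X \<in> Obj A; Y \<in> Obj A\<rbrakk> \<Longrightarrow> comm_group (D X Y)"
    and Dm_hom: "\<lbrakk>u \<in> Hom (ho A) X' X; v \<in> Hom (ho A) Y Y'\<rbrakk>
      \<Longrightarrow> Dm u v \<in> hom (D X Y) (D X' Y')"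
    and Dm_Ident: "\<lbrakk>X \<in> Obj A; Y \<in> Obj A; a \<in> carrier (D X Y)\<rbrakk>
      \<Longrightarrow> Dm (Ident (ho A) X) (Ident (ho A) Y) a = a"
    and Dm_Comp: "\<lbrakk>u \<in> Hom (ho A) X' X; u' \<in> Hom (ho A) X'' X';
        v \<in> Hom (ho A) Y Y'; v' \<in> Hom (ho A) Y' Y''; a \<in> carrier (D X Y)\<rbrakk>
      \<Longrightarrow> Dm (u \<cdot>\<^bsub>ho A\<^esub> u') (v' \<cdot>\<^bsub>ho A\<^esub> v) a = Dm u' v' (Dm u v a)"
    and Dm_add_left: "\<lbrakk>u \<in> Hom (ho A) X' X; u' \<in> Hom (ho A) X' X; Y \<in> Obj A;
        a \<in> carrier (D X Y)\<rbrakk>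
      \<Longrightarrow> Dm (u \<otimes>\<^bsub>H X' X\<^esub> u') (Ident (ho A) Y) a =
          Dm u (Ident (ho A) Y) a \<otimes>\<^bsub>D X' Y\<^esub> Dm u' (Ident (ho A) Y) a"
    and Dm_add_right: "\<lbrakk>X \<in> Obj A; v \<in> Hom (ho A) Y Y'; v' \<in> Hom (ho A) Y Y';
        a \<in> carrier (D X Y)\<rbrakk>
      \<Longrightarrow> Dm (Ident (ho A) X) (v \<otimes>\<^bsub>H Y Y'\<^esub> v') a =
          Dm (Ident (ho A) X) v a \<otimes>\<^bsub>D X Y'\<^esub> Dm (Ident (ho A) X) v' a"
    and \<sigma>_iso: "f \<in> Hom A X Y \<Longrightarrow> \<sigma> f \<in> iso (D X Y) (track_group A f)"
    and \<sigma>_natural: "\<lbrakk>f \<in> Hom A X Y; K \<in> Track A f g; a \<in> carrier (D X Y)\<rbrakk>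
      \<Longrightarrow> \<sigma> g a \<box> K = K \<box> \<sigma> f a"
    and \<sigma>_pre: "\<lbrakk>h \<in> Hom A X' X; f \<in> Hom A X Y; a \<in> carrier (D X Y)\<rbrakk>
      \<Longrightarrow> pre A h (\<sigma> f a) = \<sigma> (f \<cdot> h) (Dm (ho_class A h) (Ident (ho A) Y) a)"
    and \<sigma>_post: "\<lbrakk>f \<in> Hom A X Y; g \<in> Hom A Y Y'; a \<in> carrier (D X Y)\<rbrakk>
      \<Longrightarrow> post A g (\<sigma> f a) = \<sigma> (g \<cdot> f) (Dm (Ident (ho A) X) (ho_class A g) a)"


section \<open>The theories of free nilpotent groups\<close>

text \<open>The free group on \<open>{1..p}\<close> as reduced words; the letter \<open>(i, True)\<close> is the generator
  \<open>i\<close> and \<open>(i, False)\<close> its inverse.\<close>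

definition cancels :: "nat \<times> bool \<Rightarrow> nat \<times> bool \<Rightarrow> bool" where
  "cancels x y \<longleftrightarrow> fst x = fst y \<and> snd x \<noteq> snd y"

fun push :: "nat \<times> bool \<Rightarrow> (nat \<times> bool) list \<Rightarrow> (nat \<times> bool) list" where
  "push x [] = [x]"
| "push x (y # w) = (if cancels x y then w else x # y # w)"

definition reduce :: "(nat \<times> bool) list \<Rightarrow> (nat \<times> bool) list" where
  "reduce w = foldr push w []"

definition free_group :: "nat \<Rightarrow> (nat \<times> bool) list monoid" where
  "free_group p =
     \<lparr>carrier = {w. fst ` set w \<subseteq> {1..p} \<and> successively (\<lambda>x y. \<not> cancels x y) w},
      mult = (\<lambda>u v. reduce (u @ v)), one = []\<rparr>"

fun lcs :: "('g, 'm) monoid_scheme \<Rightarrow> nat \<Rightarrow> 'g set" where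
  "lcs G 0 = carrier G"
| "lcs G (Suc k) = generate G
     {x \<otimes>\<^bsub>G\<^esub> y \<otimes>\<^bsub>G\<^esub> inv\<^bsub>G\<^esub> x \<otimes>\<^bsub>G\<^esub> inv\<^bsub>G\<^esub> y | x y. x \<in> carrier G \<and> y \<in> lcs G k}"

text \<open>For \<open>n = \<infinity>\<close> one divides by the trivial subgroup, so that \<open>nil_group \<infinity> p\<close> is the free
  group with its elements \<open>w\<close> replaced by the singletons \<open>{w}\<close>.\<close>

definition nil_kernel :: "enat \<Rightarrow> nat \<Rightarrow> (nat \<times> bool) list set" where
  "nil_kernel n p =
     (case n of enat k \<Rightarrow> lcs (free_group p) k | \<infinity> \<Rightarrow> {\<one>\<^bsub>free_group p\<^esub>})"

definition nil_group :: "enat \<Rightarrow> nat \<Rightarrow> (nat \<times> bool) list set monoid" where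
  "nil_group n p = free_group p Mod nil_kernel n p"

text \<open>Arrows are homomorphisms tagged with (the indices of) their domain and codomain, as one
  set-theoretic function may have several codomains. They are undefined outside the carrier
  so that they are determined by their values on it.\<close>

type_synonym nil_arrow =
  "nat \<times> nat \<times> ((nat \<times> bool) list set \<Rightarrow> (nat \<times> bool) list set)"

text \<open>The homomorphism induced by the map \<open>i \<mapsto> i + s\<close> on generators. The cosets in the union
  all coincide.\<close>

definition nil_shift :: "enat \<Rightarrow> nat \<Rightarrow> nat \<Rightarrow> nat \<Rightarrow> nil_arrow" where
  "nil_shift n s p q = (p, q, \<lambda>c \<in> carrier (nil_group n p).
     \<Union>w \<in> c. nil_kernel n q #>\<^bsub>free_group q\<^esub> map (\<lambda>(i, b). (i + s, b)) w)"

text \<open>The object \<open>p\<close> stands for \<open>nil_group n p\<close>; in particular \<open>1\<close> stands for \<open>\<int>\<close>.\<close>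

definition nil_cat :: "enat \<Rightarrow> (nat, nil_arrow) pcat" where
  "nil_cat n =
     \<lparr>Obj = UNIV,
      Arr = {(p, q, f). f \<in> hom (nil_group n p) (nil_group n q) \<and>
                        f \<in> extensional (carrier (nil_group n p))},
      Dom = (\<lambda>(p, q, f). p),
      Cod = (\<lambda>(p, q, f). q),
      Ident = (\<lambda>p. (p, p, \<lambda>c \<in> carrier (nil_group n p). c)),
      Comp = (\<lambda>(q', r, g) (p, q, f). (p, r, compose (carrier (nil_group n p)) g f)),
      Zero = 0,
      Cop = (\<lambda>p q. p + q),
      In1 = (\<lambda>p q. nil_shift n 0 p (p + q)),
      In2 = (\<lambda>p q. nil_shift n p q (p + q))\<rparr>"


section \<open>Coproduct preserving pseudofunctors\<close>

text \<open>\<open>PComp \<phi> f g\<close> is the track \<open>\<phi>\<^bsub>f,g\<^esub> : \<phi>(f)\<phi>(g) \<Rightarrow> \<phi>(fg)\<close>, and \<open>PUnit \<phi> X\<close> is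
  \<open>\<phi>\<^sub>X : \<phi>(1\<^sub>X) \<Rightarrow> 1\<close>. The source category has only identity tracks, so
  there is no further datum.\<close>

record ('o, 'a, 'p, 'b, 't) psfunctor =
  PObj :: "'o \<Rightarrow> 'p"
  PArr :: "'a \<Rightarrow> 'b"
  PComp :: "'a \<Rightarrow> 'a \<Rightarrow> 't"
  PUnit :: "'o \<Rightarrow> 't"

locale pseudofunctor = C: category C + A: track_category A
  for C :: "('o, 'a, 'm) pcat_scheme"
    and A :: "('p, 'b, 't, 'n) trackcat_scheme" (structure)
    and \<phi> :: "('o, 'a, 'p, 'b, 't) psfunctor" +
  assumes PObj_Obj: "X \<in> Obj C \<Longrightarrow> PObj \<phi> X \<in> Obj A"
    and PArr_Hom: "f \<in> Hom C X Y \<Longrightarrow> PArr \<phi> f \<in> Hom A (PObj \<phi> X) (PObj \<phi> Y)"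
    and PComp_Track: "\<lbrakk>g \<in> Hom C X Y; f \<in> Hom C Y Z\<rbrakk>
      \<Longrightarrow> PComp \<phi> f g \<in> Track A (PArr \<phi> f \<cdot> PArr \<phi> g) (PArr \<phi> (f \<cdot>\<^bsub>C\<^esub> g))"
    and PUnit_Track: "X \<in> Obj C
      \<Longrightarrow> PUnit \<phi> X \<in> Track A (PArr \<phi> (Ident C X)) (Ident A (PObj \<phi> X))"
    and PComp_assoc: "\<lbrakk>h \<in> Hom C W X; g \<in> Hom C X Y; f \<in> Hom C Y Z\<rbrakk>
      \<Longrightarrow> PComp \<phi> f (g \<cdot>\<^bsub>C\<^esub> h) \<box> post A (PArr \<phi> f) (PComp \<phi> g h) =
          PComp \<phi> (f \<cdot>\<^bsub>C\<^esub> g) h \<box> pre A (PArr \<phi> h) (PComp \<phi> f g)"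
    and PComp_Ident_right: "f \<in> Hom C X Y
      \<Longrightarrow> PComp \<phi> f (Ident C X) = post A (PArr \<phi> f) (PUnit \<phi> X)"
    and PComp_Ident_left: "f \<in> Hom C X Y
      \<Longrightarrow> PComp \<phi> (Ident C Y) f = pre A (PArr \<phi> f) (PUnit \<phi> Y)"

definition cop_comparison ::
  "('o, 'a, 'm) pcat_scheme \<Rightarrow> ('p, 'b, 't, 'n) trackcat_scheme \<Rightarrow>
   ('o, 'a, 'p, 'b, 't) psfunctor \<Rightarrow> 'o \<Rightarrow> 'o \<Rightarrow> 'b" where
  "cop_comparison C A \<phi> X Y = copair A (PArr \<phi> (In1 C X Y)) (PArr \<phi> (In2 C X Y))"

locale cop_pseudofunctor = pseudofunctor C A \<phi>
  for C :: "('o, 'a, 'm) pcat_scheme"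
    and A :: "('p, 'b, 't, 'n) trackcat_scheme" (structure)
    and \<phi> :: "('o, 'a, 'p, 'b, 't) psfunctor" +
  assumes PArr_Ident: "X \<in> Obj C \<Longrightarrow> PArr \<phi> (Ident C X) = Ident A (PObj \<phi> X)"
    and PUnit_trivial: "X \<in> Obj C \<Longrightarrow> PUnit \<phi> X = VId A (Ident A (PObj \<phi> X))"
    and PObj_Zero: "PObj \<phi> (Zero C) = Zero A"
    and PArr_zero: "\<lbrakk>X \<in> Obj C; Y \<in> Obj C\<rbrakk>
      \<Longrightarrow> PArr \<phi> (zero_map C X Y) = zero_map A (PObj \<phi> X) (PObj \<phi> Y)"
    and PComp_zero_right: "\<lbrakk>W \<in> Obj C; f \<in> Hom C X Y\<rbrakk>
      \<Longrightarrow> PComp \<phi> f (zero_map C W X) = VId A (zero_map A (PObj \<phi> W) (PObj \<phi> Y))"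
    and PComp_zero_left: "\<lbrakk>f \<in> Hom C X Y; Z \<in> Obj C\<rbrakk>
      \<Longrightarrow> PComp \<phi> (zero_map C Y Z) f = VId A (zero_map A (PObj \<phi> X) (PObj \<phi> Z))"
    and cop_comparison_iso: "\<lbrakk>X \<in> Obj C; Y \<in> Obj C\<rbrakk>
      \<Longrightarrow> iso_arrow A (cop_comparison C A \<phi> X Y)"
    and PComp_copair: "\<lbrakk>h \<in> Hom C X Z; k \<in> Hom C Y Z; g \<in> Hom C Z T\<rbrakk>
      \<Longrightarrow> pre A (cop_comparison C A \<phi> X Y) (PComp \<phi> g (copair C h k)) =
          tcopair A (PComp \<phi> g h) (PComp \<phi> g k)"
    and PUnit_Cop: "X \<in> Obj C
      \<Longrightarrow> pre A (cop_comparison C A \<phi> X X) (PUnit \<phi> (Cop C X X)) =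
          post A (cop_comparison C A \<phi> X X) (tcosum A (PUnit \<phi> X) (PUnit \<phi> X))"

text \<open>\<open>TObj \<alpha> X\<close> is the map \<open>\<alpha>\<^sub>X\<close> and \<open>TArr \<alpha> f\<close> is the track
  \<open>\<alpha>\<^sub>f : \<alpha>\<^sub>Y\<phi>(f) \<Rightarrow> \<psi>(f)\<alpha>\<^sub>X\<close>.\<close>

record ('o, 'a, 'b, 't) pstrans =
  TObj :: "'o \<Rightarrow> 'b"
  TArr :: "'a \<Rightarrow> 't"

text \<open>Both components are undefined outside the objects and arrows of \<open>C\<close>, so that equality of
  records is equality of transformations.\<close>

locale pseudo_transformation =
  \<phi>: pseudofunctor C A \<phi> + \<psi>: pseudofunctor C A \<psi>
  for C :: "('o, 'a, 'm) pcat_scheme"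
    and A :: "('p, 'b, 't, 'n) trackcat_scheme" (structure)
    and \<phi> :: "('o, 'a, 'p, 'b, 't) psfunctor"
    and \<psi> :: "('o, 'a, 'p, 'b, 't) psfunctor"
    and \<alpha> :: "('o, 'a, 'b, 't) pstrans" +
  assumes TObj_extensional: "TObj \<alpha> \<in> extensional (Obj C)"
    and TArr_extensional: "TArr \<alpha> \<in> extensional (Arr C)"
    and TObj_Hom: "X \<in> Obj C \<Longrightarrow> TObj \<alpha> X \<in> Hom A (PObj \<phi> X) (PObj \<psi> X)"
    and TArr_Track: "f \<in> Hom C X Y
      \<Longrightarrow> TArr \<alpha> f \<in> Track A (TObj \<alpha> Y \<cdot> PArr \<phi> f) (PArr \<psi> f \<cdot> TObj \<alpha> X)"
    and TArr_Comp: "\<lbrakk>f \<in> Hom C X Y; g \<in> Hom C Y Z\<rbrakk>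
      \<Longrightarrow> TArr \<alpha> (g \<cdot>\<^bsub>C\<^esub> f) \<box> post A (TObj \<alpha> Z) (PComp \<phi> g f) =
          pre A (TObj \<alpha> X) (PComp \<psi> g f) \<box> post A (PArr \<psi> g) (TArr \<alpha> f)
            \<box> pre A (PArr \<phi> f) (TArr \<alpha> g)"
    and TArr_Ident: "X \<in> Obj C
      \<Longrightarrow> pre A (TObj \<alpha> X) (PUnit \<psi> X) \<box> TArr \<alpha> (Ident C X) =
          post A (TObj \<alpha> X) (PUnit \<phi> X)"

locale cop_pseudo_transformation = pseudo_transformation C A \<phi> \<psi> \<alpha>
  for C :: "('o, 'a, 'm) pcat_scheme"
    and A :: "('p, 'b, 't, 'n) trackcat_scheme" (structure)
    and \<phi> :: "('o, 'a, 'p, 'b, 't) psfunctor"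
    and \<psi> :: "('o, 'a, 'p, 'b, 't) psfunctor"
    and \<alpha> :: "('o, 'a, 'b, 't) pstrans" +
  assumes TObj_Cop: "\<lbrakk>X \<in> Obj C; Y \<in> Obj C\<rbrakk>
      \<Longrightarrow> TObj \<alpha> (Cop C X Y) \<cdot> cop_comparison C A \<phi> X Y =
          cop_comparison C A \<psi> X Y \<cdot> cosum A (TObj \<alpha> X) (TObj \<alpha> Y)"
    and TArr_copair: "\<lbrakk>f \<in> Hom C X Z; g \<in> Hom C Y Z\<rbrakk>
      \<Longrightarrow> pre A (cop_comparison C A \<phi> X Y) (TArr \<alpha> (copair C f g)) =
          tcopair A (TArr \<alpha> f) (TArr \<alpha> g)"

definition Pseudo_Obj ::
  "('o, 'a, 'm) pcat_scheme \<Rightarrow> ('p, 'b, 't, 'n) trackcat_scheme \<Rightarrow>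
   ('o, 'a, 'p, 'b, 't) psfunctor set" where
  "Pseudo_Obj C A = {\<phi>. cop_pseudofunctor C A \<phi>}"

definition Pseudo_Hom ::
  "('o, 'a, 'm) pcat_scheme \<Rightarrow> ('p, 'b, 't, 'n) trackcat_scheme \<Rightarrow>
   ('o, 'a, 'p, 'b, 't) psfunctor \<Rightarrow> ('o, 'a, 'p, 'b, 't) psfunctor \<Rightarrow>
   ('o, 'a, 'b, 't) pstrans set" where
  "Pseudo_Hom C A \<phi> \<psi> = {\<alpha>. \<phi> \<in> Pseudo_Obj C A \<and> \<psi> \<in> Pseudo_Obj C A \<and>
     cop_pseudo_transformation C A \<phi> \<psi> \<alpha>}"


section \<open>Weak structures\<close>

definition weak_nil_cogroup ::
  "enat \<Rightarrow> ('o, 'a, 't, 'm) trackcat_scheme \<Rightarrow> 'o \<Rightarrow>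
   (nat, nil_arrow, 'o, 'a, 't) psfunctor \<Rightarrow> bool" where
  "weak_nil_cogroup n A X F \<longleftrightarrow> F \<in> Pseudo_Obj (nil_cat n) A \<and> PObj F 1 = X"

definition weak_nil_ringoid ::
  "enat \<Rightarrow> ('o, 'a, 't, 'm) trackcat_scheme \<Rightarrow>
   ('o \<Rightarrow> (nat, nil_arrow, 'o, 'a, 't) psfunctor) \<Rightarrow> bool" where
  "weak_nil_ringoid n A R \<longleftrightarrow> (\<forall>X \<in> Obj A. weak_nil_cogroup n A X (R X))"

end

theory Submission
  imports Defs "HOL-Algebra.FiniteProduct"
begin

text \<open>Call a lift of an arrow \<open>g : p \<rightarrow> q\<close> of the theory a track
  \<open>\<alpha>\<^sub>q \<phi>(g) \<Rightarrow> \<psi>(g) \<alpha>\<^sub>p\<close>, where \<open>\<alpha>\<^sub>p\<close> is the map determined by \<open>f\<close> on each of the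
  \<open>p\<close> summands. Lifts form a category \<open>E\<close> over the theory in which \<open>p\<close> is still a \<open>p\<close>-fold
  coproduct, and extensions of \<open>f\<close> are the sections of \<open>E\<close> that are trivial on the coproduct
  inclusions. Since \<open>D\<close> is biadditive and the lifts of a fixed arrow are a torsor under \<open>D\<close>, a lift
  of \<open>1 \<rightarrow> q\<close> is determined by the arrow and the \<open>q\<close> projections to \<open>E(1,1)\<close>, and these
  may be prescribed. Hence the comultiplication has a unique counital lift; it is automatically
  coassociative, so that \<open>E(1,q)\<close> is a group naturally in \<open>q\<close>. The surjection of \<open>E(1,1)\<close> onto
  the integers splits, this splitting induces homomorphic splittings of \<open>E(1,q)\<close> over the free
  nilpotent groups, and functoriality and uniqueness hold because two homomorphisms that agree on
  generators are equal.\<close>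

text \<open>The obstacle is that \<open>E(1,q)\<close> is not known to be nilpotent of class
  \<open>n\<close>, so in general the universal property of \<open>nil_group n q\<close> gives no
  homomorphism into it. The case \<open>q = 1\<close> is different: for \<open>n \<ge> 1\<close> the
  group is that of the integers, which is free. The splitting for other \<open>q\<close> is
  therefore not defined on generators: it takes \<open>g\<close> to the lift over \<open>g\<close>
  whose \<open>j\<close>-th projection is the split value of the \<open>j\<close>-th projection of
  \<open>g\<close>. Uniqueness of lifts with prescribed projections makes it a homomorphism, without
  any relation being checked in \<open>E(1,q)\<close>. Prescribing projections rests on additivity.
  In the homotopy category the identity of \<psi>(q) is the sum of the composites of projections and
  inclusions, and biadditivity of \<open>D\<close> makes D(\<phi>(1), \<psi>(q)) the product of
  \<open>q\<close> copies of D(\<phi>(1), \<psi>(1)). The same identity shows that both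
  pseudofunctors turn multiplication in \<open>nil_group n q\<close> into addition of homotopy
  classes. This is why lifts exist at all: the two sides of the naturality square become
  homomorphisms that agree on generators.\<close>

declare One_nat_def [simp del]

section \<open>Free groups and free nilpotent groups\<close>

definition flip :: "nat \<times> bool \<Rightarrow> nat \<times> bool" where
  "flip x = (fst x, \<not> snd x)"

abbreviation reduced :: "(nat \<times> bool) list \<Rightarrow> bool" where
  "reduced \<equiv> successively (\<lambda>x y. \<not> cancels x y)"

lemma cancels_iff_flip: "cancels x y \<longleftrightarrow> y = flip x"
  by (cases x; cases y) (auto simp: cancels_def flip_def)

lemma flip_flip [simp]: "flip (flip x) = x"
  by (simp add: flip_def)

lemma fst_flip [simp]: "fst (flip x) = fst x"
  by (simp add: flip_def)

lemma reduced_push: "reduced w \<Longrightarrow> reduced (push x w)"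
  by (cases w) (auto simp: successively_Cons)

lemma set_push: "set (push x w) \<subseteq> insert x (set w)"
  by (cases w) auto

text \<open>Van der Waerden's trick: letters act on reduced words by permutations, and opposite
  letters by inverse permutations. Reducedness excludes a second cancellation after the first.
  Associativity will come from composing these actions.\<close>

lemma push_flip_push: "reduced w \<Longrightarrow> push (flip x) (push x w) = w"
proof (cases w)
  case (Cons y v)
  assume "reduced w"
  with Cons show ?thesis
    by (cases v) (auto simp: cancels_iff_flip)
qed (auto simp: cancels_iff_flip)

lemma reduced_foldr_push: "reduced w \<Longrightarrow> reduced (foldr push u w)"
  by (induction u) (auto intro: reduced_push)

lemma reduced_reduce: "reduced (reduce u)"
  unfolding reduce_def by (rule reduced_foldr_push) simp

lemma set_foldr_push: "set (foldr push u w) \<subseteq> set u \<union> set w"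
proof (induction u)
  case (Cons x u)
  then show ?case using set_push[of x "foldr push u w"] by auto
qed simp

lemma push_reduced: "reduced (x # w) \<Longrightarrow> push x w = x # w"
  by (cases w) auto

lemma reduce_reduced: "reduced w \<Longrightarrow> reduce w = w"
proof (induction w)
  case (Cons x w)
  then have "reduced w" by (cases w) (auto simp: successively_Cons)
  with Cons show ?case using push_reduced[of x w] by (simp add: reduce_def)
qed (simp add: reduce_def)

text \<open>If \<open>x\<close> cancels the head of \<open>u\<close>, the right side pushes a letter
  and then its opposite, which \<open>push_flip_push\<close> undoes; otherwise \<open>push\<close>
  merely prepends \<open>x\<close> to \<open>u\<close>.\<close>

lemma foldr_push_push:
  assumes "reduced w" "reduced u"
  shows "foldr push (push x u) w = push x (foldr push u w)"
proof (cases u)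
  case (Cons y v)
  show ?thesis
  proof (cases "cancels x y")
    case True
    then have "y = flip x" by (simp add: cancels_iff_flip)
    moreover have "push (flip y) (push y (foldr push v w)) = foldr push v w"
      using assms by (intro push_flip_push reduced_foldr_push)
    ultimately show ?thesis using True Cons by simp
  qed (use Cons in simp)
qed simp

text \<open>By \<open>foldr_push_push\<close>, applied letter by letter, a word acts through its
  reduction. A left factor may thus be reduced before multiplying, which is the essential half of
  associativity.\<close>

lemma foldr_push_reduce: "reduced w \<Longrightarrow> foldr push (reduce u) w = foldr push u w"
proof (induction u)
  case (Cons x u)
  have "foldr push (push x (reduce u)) w = push x (foldr push (reduce u) w)"
    using Cons.prems reduced_reduce by (rule foldr_push_push)
  with Cons show ?case by (simp add: reduce_def)
qed (simp add: reduce_def)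

lemma reduce_append: "reduce (u @ v) = foldr push u (reduce v)"
  by (simp add: reduce_def)

lemma reduce_append_reduce:
  "reduce (reduce u @ v) = reduce (u @ v)" "reduce (u @ reduce v) = reduce (u @ v)"
  by (simp_all add: reduce_append foldr_push_reduce reduced_reduce reduce_reduced)

lemma reduce_inverse: "reduce (rev (map flip w) @ w) = []"
proof -
  have "foldr push (rev (map flip w)) (foldr push w []) = []"
  proof (induction w)
    case (Cons x w)
    have "push (flip x) (push x (foldr push w [])) = foldr push w []"
      by (rule push_flip_push) (simp add: reduced_foldr_push)
    with Cons show ?case by simp
  qed simp
  then show ?thesis by (simp add: reduce_def)
qed

lemma free_group_simps:
  "w \<in> carrier (free_group p) \<longleftrightarrow> fst ` set w \<subseteq> {1..p} \<and> reduced w"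
  "u \<otimes>\<^bsub>free_group p\<^esub> v = reduce (u @ v)" "\<one>\<^bsub>free_group p\<^esub> = []"
  by (auto simp: free_group_def)

lemma fst_set_reduce: "fst ` set (reduce w) \<subseteq> fst ` set w"
  using set_foldr_push[of w "[]"] by (auto simp: reduce_def)

lemma group_free_group: "group (free_group p)"
proof (rule groupI)
  fix x assume x: "x \<in> carrier (free_group p)"
  \<comment> \<open>The reversed word of opposite letters is already reduced; writing
    \<open>reduce\<close> in front makes its membership in the carrier immediate.\<close>
  let ?y = "reduce (rev (map flip x))"
  have "fst ` set ?y \<subseteq> fst ` set (rev (map flip x))" by (rule fst_set_reduce)
  also have "\<dots> = fst ` set x" by force
  finally have "?y \<in> carrier (free_group p)"
    using x by (auto simp: free_group_simps reduced_reduce)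
  moreover have "?y \<otimes>\<^bsub>free_group p\<^esub> x = \<one>\<^bsub>free_group p\<^esub>"
    by (simp add: free_group_simps reduce_append_reduce reduce_inverse)
  ultimately show "\<exists>y\<in>carrier (free_group p). y \<otimes>\<^bsub>free_group p\<^esub> x = \<one>\<^bsub>free_group p\<^esub>" by blast
next
  fix x y assume "x \<in> carrier (free_group p)" "y \<in> carrier (free_group p)"
  then have "fst ` set (x @ y) \<subseteq> {1..p}" by (auto simp: free_group_simps)
  with fst_set_reduce[of "x @ y"] show "x \<otimes>\<^bsub>free_group p\<^esub> y \<in> carrier (free_group p)"
    unfolding free_group_simps using reduced_reduce by blast
qed (auto simp: free_group_simps reduce_append_reduce reduce_reduced)

section \<open>Evaluation of words and maps out of the free group\<close>

definition letter :: "('k, 'm) monoid_scheme \<Rightarrow> (nat \<Rightarrow> 'k) \<Rightarrow> nat \<times> bool \<Rightarrow> 'k" where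
  "letter K y x = (if snd x then y (fst x) else inv\<^bsub>K\<^esub> y (fst x))"

text \<open>The homomorphism from the free group with value \<open>y i\<close> at the generator
  \<open>i\<close>. It is defined on all lists, so that a reduction can be followed one letter at a
  time.\<close>

definition word_eval :: "('k, 'm) monoid_scheme \<Rightarrow> (nat \<Rightarrow> 'k) \<Rightarrow> (nat \<times> bool) list \<Rightarrow> 'k" where
  "word_eval K y w = foldr (\<lambda>x k. letter K y x \<otimes>\<^bsub>K\<^esub> k) w \<one>\<^bsub>K\<^esub>"

context group
begin

lemma letter_closed: "y (fst x) \<in> carrier G \<Longrightarrow> letter G y x \<in> carrier G"
  by (simp add: letter_def)

lemma word_eval_closed:
  "(\<And>x. x \<in> set w \<Longrightarrow> y (fst x) \<in> carrier G) \<Longrightarrow> word_eval G y w \<in> carrier G"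
  by (induction w) (auto simp: word_eval_def letter_closed)

lemma word_eval_push:
  assumes "\<And>z. z \<in> insert x (set w) \<Longrightarrow> y (fst z) \<in> carrier G"
  shows "word_eval G y (push x w) = letter G y x \<otimes> word_eval G y w"
proof (cases w)
  case (Cons z v)
  show ?thesis
  proof (cases "cancels x z")
    case True
    have v: "word_eval G y v \<in> carrier G" using assms Cons by (intro word_eval_closed) auto
    have x: "y (fst x) \<in> carrier G" using assms by auto
    have "letter G y x \<otimes> letter G y z = \<one>"
      using True x by (auto simp: cancels_def letter_def)
    then have "letter G y x \<otimes> (letter G y z \<otimes> word_eval G y v) = word_eval G y v"
      using x v True letter_closed[of y x] letter_closed[of y z] 
      by (simp add: cancels_def flip: m_assoc)
    with True Cons show ?thesis by (simp add: word_eval_def)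
  qed (simp add: Cons word_eval_def)
qed (simp add: word_eval_def)

lemma word_eval_foldr_push:
  assumes "\<And>z. z \<in> set u \<union> set w \<Longrightarrow> y (fst z) \<in> carrier G"
  shows "word_eval G y (foldr push u w) = word_eval G y u \<otimes> word_eval G y w"
  using assms
proof (induction u)
  case Nil
  then have "word_eval G y w \<in> carrier G" by (intro word_eval_closed) auto
  then show ?case by (simp add: word_eval_def)
next
  case (Cons x u)
  have "word_eval G y u \<in> carrier G" "word_eval G y w \<in> carrier G"
    using Cons.prems by (auto intro!: word_eval_closed)
  moreover have x: "letter G y x \<in> carrier G"
    using Cons.prems[of x] by (simp add: letter_closed)
  ultimately have c: "word_eval G y u \<in> carrier G" "word_eval G y w \<in> carrier G"
    "letter G y x \<in> carrier G" by auto
  have "word_eval G y (push x (foldr push u w)) = letter G y x \<otimes> word_eval G y (foldr push u w)"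
    using Cons.prems set_foldr_push[of u w] by (intro word_eval_push) auto
  also have "\<dots> = letter G y x \<otimes> (word_eval G y u \<otimes> word_eval G y w)"
    using Cons by simp
  also have "\<dots> = word_eval G y (x # u) \<otimes> word_eval G y w"
    using c by (simp add: word_eval_def m_assoc)
  finally show ?case by simp
qed

lemma word_eval_hom:
  assumes y: "\<And>i. i \<in> {1..p} \<Longrightarrow> y i \<in> carrier G"
  shows "word_eval G y \<in> hom (free_group p) G"
proof (rule homI)
  fix u v assume uv: "u \<in> carrier (free_group p)" "v \<in> carrier (free_group p)"
  then have "\<And>z. z \<in> set u \<union> set v \<Longrightarrow> y (fst z) \<in> carrier G"
    by (intro y) (auto simp: free_group_simps)
  then show "word_eval G y (u \<otimes>\<^bsub>free_group p\<^esub> v) = word_eval G y u \<otimes> word_eval G y v"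
    using word_eval_foldr_push[of u v] uv
    by (simp add: free_group_simps reduce_append reduce_reduced)
qed (auto intro!: word_eval_closed y simp: free_group_simps)

lemma word_eval_singleton [simp]: "y i \<in> carrier G \<Longrightarrow> word_eval G y [(i, True)] = y i"
  by (simp add: word_eval_def letter_def)

text \<open>The letter \<open>(i, False)\<close> is the group inverse of the generator
  \<open>i\<close>, so the two maps agree on all letters; a reduced word \<open>x # w\<close> is the
  product of \<open>[x]\<close> and \<open>w\<close>, since nothing cancels, and induction
  applies.\<close>

lemma hom_free_group_eqI:
  assumes h: "h \<in> hom (free_group p) G" and h': "h' \<in> hom (free_group p) G"
    and gens: "\<And>i. i \<in> {1..p} \<Longrightarrow> h [(i, True)] = h' [(i, True)]"
    and w: "w \<in> carrier (free_group p)"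
  shows "h w = h' w"
proof -
  interpret F: group "free_group p" by (rule group_free_group)
  interpret h: group_hom "free_group p" G h by unfold_locales (rule h)
  interpret h': group_hom "free_group p" G h' by unfold_locales (rule h')
  have letter: "h [x] = h' [x]" if "fst x \<in> {1..p}" for x
  proof (cases "snd x")
    case True then show ?thesis using gens[OF that] by (cases x) simp
  next
    case False
    have c: "[(fst x, True)] \<in> carrier (free_group p)" "[x] \<in> carrier (free_group p)"
      using that by (auto simp: free_group_simps)
    have "[x] \<otimes>\<^bsub>free_group p\<^esub> [(fst x, True)] = \<one>\<^bsub>free_group p\<^esub>"
      using False by (cases x) (simp add: free_group_simps reduce_def cancels_def)
    then have "[x] = inv\<^bsub>free_group p\<^esub> [(fst x, True)]"
      using c by (simp add: F.inv_equality)
    then show ?thesis using c gens[OF that] by simp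
  qed
  from w show ?thesis
  proof (induction w)
    case Nil
    then show ?case using h.hom_one h'.hom_one by (simp add: free_group_simps)
  next
    case (Cons x w)
    have c: "w \<in> carrier (free_group p)" "[x] \<in> carrier (free_group p)"
      using Cons.prems by (auto simp: free_group_simps successively_Cons)
    have red: "reduced (x # w)" using Cons.prems unfolding free_group_simps by blast
    have "x # w = [x] \<otimes>\<^bsub>free_group p\<^esub> w"
      using reduce_reduced[OF red] by (simp add: free_group_simps)
    moreover have "h [x] = h' [x]" using c by (intro letter) (auto simp: free_group_simps)
    ultimately show ?case using c Cons.IH by simp
  qed
qed

text \<open>Conjugation takes the commutator of \<open>x\<close> and \<open>y\<close> to the
  commutator of their conjugates, so normality of one term makes the generating set of the next one
  invariant.\<close>

lemma lcs_normal: "lcs G k \<lhd> G"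
proof (induction k)
  case 0
  show ?case by (simp add: normal_self)
next
  case (Suc k)
  have sub: "lcs G k \<subseteq> carrier G"
    using Suc normal_imp_subgroup subgroup.subset by blast
  show ?case unfolding lcs.simps
  proof (rule normal_generateI)
    show "{x \<otimes> y \<otimes> inv x \<otimes> inv y | x y. x \<in> carrier G \<and> y \<in> lcs G k} \<subseteq> carrier G"
      using sub by auto
    fix h g assume "h \<in> {x \<otimes> y \<otimes> inv x \<otimes> inv y | x y. x \<in> carrier G \<and> y \<in> lcs G k}"
      and g: "g \<in> carrier G"
    then obtain x y where xy: "x \<in> carrier G" "y \<in> lcs G k" "h = x \<otimes> y \<otimes> inv x \<otimes> inv y"
      by blast
    have y: "y \<in> carrier G" using xy sub by blast
    have "g \<otimes> h \<otimes> inv g = (g \<otimes> x \<otimes> inv g) \<otimes> (g \<otimes> y \<otimes> inv g) \<otimes>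
        inv (g \<otimes> x \<otimes> inv g) \<otimes> inv (g \<otimes> y \<otimes> inv g)"
    proof -
      have "inv g \<otimes> (g \<otimes> z) = z" if "z \<in> carrier G" for z
        using g that by (simp flip: m_assoc)
      then show ?thesis using g xy(1) y by (simp add: xy(3) inv_mult_group m_assoc)
    qed
    moreover have "g \<otimes> y \<otimes> inv g \<in> lcs G k"
      using Suc g xy(2) by (simp add: normal_inv_iff)
    ultimately show "g \<otimes> h \<otimes> inv g \<in> {x \<otimes> y \<otimes> inv x \<otimes> inv y | x y. x \<in> carrier G \<and> y \<in> lcs G k}"
      using g xy(1) by blast
  qed
qed

end

text \<open>Homomorphisms map commutators to commutators. Hence every homomorphism of free groups
  respects the kernels \<open>nil_kernel\<close> and descends to the nilpotent quotients.\<close>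

lemma (in group_hom) lcs_image: "h ` lcs G k \<subseteq> lcs H k"
proof (induction k)
  case (Suc k)
  let ?S = "{x \<otimes> y \<otimes> inv x \<otimes> inv y | x y. x \<in> carrier G \<and> y \<in> lcs G k}"
  let ?T = "{x \<otimes>\<^bsub>H\<^esub> y \<otimes>\<^bsub>H\<^esub> inv\<^bsub>H\<^esub> x \<otimes>\<^bsub>H\<^esub> inv\<^bsub>H\<^esub> y | x y. x \<in> carrier H \<and> y \<in> lcs H k}"
  have sub: "lcs G k \<subseteq> carrier G"
    using G.lcs_normal normal_imp_subgroup subgroup.subset by blast
  have "h ` ?S \<subseteq> ?T"
  proof
    fix z assume "z \<in> h ` ?S"
    then obtain x y where "x \<in> carrier G" "y \<in> lcs G k" "z = h (x \<otimes> y \<otimes> inv x \<otimes> inv y)"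
      by blast
    moreover from this have "y \<in> carrier G" "h y \<in> lcs H k" using sub Suc by auto
    moreover from calculation have "z = h x \<otimes>\<^bsub>H\<^esub> h y \<otimes>\<^bsub>H\<^esub> inv\<^bsub>H\<^esub> h x \<otimes>\<^bsub>H\<^esub> inv\<^bsub>H\<^esub> h y" by simp
    ultimately show "z \<in> ?T" using hom_closed by blast
  qed
  moreover have "h ` generate G ?S = generate H (h ` ?S)"
    using sub by (intro generate_img[symmetric]) auto
  ultimately show ?case by (simp add: H.mono_generate)
qed auto

lemma nil_kernel_normal: "nil_kernel n p \<lhd> free_group p"
proof -
  interpret group "free_group p" by (rule group_free_group)
  show ?thesis
    by (cases n) (simp_all add: nil_kernel_def lcs_normal one_is_normal)
qed

lemma hom_nil_kernel:
  assumes "h \<in> hom (free_group p) (free_group q)"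
  shows "h ` nil_kernel n p \<subseteq> nil_kernel n q"
proof -
  interpret group_hom "free_group p" "free_group q" h
    using assms by (simp add: group_hom_def group_hom_axioms_def group_free_group)
  show ?thesis
    using lcs_image hom_one by (cases n) (simp_all add: nil_kernel_def)
qed

lemma group_nil_group: "group (nil_group n p)"
  unfolding nil_group_def by (rule normal.factorgroup_is_group[OF nil_kernel_normal])

section \<open>Nilpotent quotients and homomorphisms out of them\<close>

definition nil_class :: "enat \<Rightarrow> nat \<Rightarrow> (nat \<times> bool) list \<Rightarrow> (nat \<times> bool) list set" where
  "nil_class n p w = nil_kernel n p #>\<^bsub>free_group p\<^esub> w"

definition nil_gen :: "enat \<Rightarrow> nat \<Rightarrow> nat \<Rightarrow> (nat \<times> bool) list set" where
  "nil_gen n p i = nil_class n p [(i, True)]"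

lemma nil_class_hom: "nil_class n p \<in> hom (free_group p) (nil_group n p)"
  unfolding nil_class_def nil_group_def
  by (rule normal.r_coset_hom_Mod[OF nil_kernel_normal])

lemma carrier_nil_group: "carrier (nil_group n p) = nil_class n p ` carrier (free_group p)"
  by (simp add: nil_group_def carrier_FactGroup nil_class_def)

lemma generator_carrier: "i \<in> {1..p} \<Longrightarrow> [(i, True)] \<in> carrier (free_group p)"
  by (simp add: free_group_simps)

lemma nil_gen_carrier: "i \<in> {1..p} \<Longrightarrow> nil_gen n p i \<in> carrier (nil_group n p)"
  unfolding nil_gen_def by (simp add: carrier_nil_group generator_carrier)

lemma hom_nil_group_eqI:
  assumes "group K" "h \<in> hom (nil_group n p) K" "h' \<in> hom (nil_group n p) K"
    and gens: "\<And>i. i \<in> {1..p} \<Longrightarrow> h (nil_gen n p i) = h' (nil_gen n p i)"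
    and "c \<in> carrier (nil_group n p)"
  shows "h c = h' c"
proof -
  interpret group K by fact
  obtain w where w: "w \<in> carrier (free_group p)" "c = nil_class n p w"
    using assms(5) by (auto simp: carrier_nil_group)
  have "(h \<circ> nil_class n p) w = (h' \<circ> nil_class n p) w"
    by (rule hom_free_group_eqI[OF Group.hom_compose[OF nil_class_hom assms(2)]
        Group.hom_compose[OF nil_class_hom assms(3)] _ w(1)])
      (use gens in \<open>simp add: nil_gen_def\<close>)
  with w show ?thesis by simp
qed

lemma nil_group_lift:
  assumes "group K" "h \<in> hom (free_group p) K" "h ` nil_kernel n p \<subseteq> {\<one>\<^bsub>K\<^esub>}"
  obtains g where "g \<in> hom (nil_group n p) K"
    "\<And>w. w \<in> carrier (free_group p) \<Longrightarrow> g (nil_class n p w) = h w"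
proof -
  interpret group_hom "free_group p" K h
    using assms by (simp add: group_hom_def group_hom_axioms_def group_free_group)
  have "nil_kernel n p \<subseteq> kernel (free_group p) K h"
    using assms(3) normal_imp_subgroup[OF nil_kernel_normal] subgroup.subset
    by (fastforce simp: kernel_def)
  then obtain g where "g \<in> hom (free_group p Mod nil_kernel n p) K"
    "\<And>w. w \<in> carrier (free_group p) \<Longrightarrow> g (nil_kernel n p #>\<^bsub>free_group p\<^esub> w) = h w"
    using FactGroup_universal_kernel[OF nil_kernel_normal] by metis
  with that show ?thesis by (simp add: nil_group_def nil_class_def)
qed

lemma nil_class_kernel: "w \<in> nil_kernel n p \<Longrightarrow> nil_class n p w = \<one>\<^bsub>nil_group n p\<^esub>"
  using group.coset_join2[OF group_free_group _ normal_imp_subgroup[OF nil_kernel_normal[of n p]],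
      of w]
    subgroup.mem_carrier[OF normal_imp_subgroup[OF nil_kernel_normal[of n p]], of w]
  by (simp add: nil_class_def nil_group_def)

text \<open>The target has the same class \<open>n\<close>, which makes the images of the generators
  free to choose: representing words define a homomorphism of free groups, and by
  \<open>hom_nil_kernel\<close> it descends. For a target outside the theory this argument fails, so
  \<open>nil_group_1_hom_exists\<close> treats one generator separately.\<close>

lemma nil_group_hom_exists:
  assumes y: "\<And>i. i \<in> {1..p} \<Longrightarrow> y i \<in> carrier (nil_group n q)"
  obtains g where "g \<in> hom (nil_group n p) (nil_group n q)"
    "\<And>i. i \<in> {1..p} \<Longrightarrow> g (nil_gen n p i) = y i"
proof -
  interpret F: group "free_group q" by (rule group_free_group)
  have "\<forall>i. \<exists>z. i \<in> {1..p} \<longrightarrow> z \<in> carrier (free_group q) \<and> nil_class n q z = y i"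
  proof (intro allI)
    fix i
    show "\<exists>z. i \<in> {1..p} \<longrightarrow> z \<in> carrier (free_group q) \<and> nil_class n q z = y i"
      using y[of i] by (cases "i \<in> {1..p}") (auto simp: carrier_nil_group)
  qed
  then obtain z where z: "\<And>i. i \<in> {1..p} \<Longrightarrow> z i \<in> carrier (free_group q)"
    "\<And>i. i \<in> {1..p} \<Longrightarrow> nil_class n q (z i) = y i" by metis
  let ?h = "word_eval (free_group q) z"
  have h: "?h \<in> hom (free_group p) (free_group q)" using z(1) by (rule F.word_eval_hom)
  have "nil_class n q \<circ> ?h \<in> hom (free_group p) (nil_group n q)"
    using Group.hom_compose[OF h nil_class_hom] .
  moreover have "(nil_class n q \<circ> ?h) ` nil_kernel n p \<subseteq> {\<one>\<^bsub>nil_group n q\<^esub>}"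
    using hom_nil_kernel[OF h, of n] by (simp add: image_subset_iff nil_class_kernel)
  ultimately obtain g where "g \<in> hom (nil_group n p) (nil_group n q)"
    "\<And>w. w \<in> carrier (free_group p) \<Longrightarrow> g (nil_class n p w) = nil_class n q (?h w)"
    using nil_group_lift[OF group_nil_group] by (metis comp_apply)
  with that show ?thesis using z by (auto simp: nil_gen_def generator_carrier)
qed

text \<open>A free group on one generator is abelian, so it maps onto its nilpotent quotients
  isomorphically.\<close>

lemma nil_group_1_hom_exists:
  assumes K: "group K" and k: "k \<in> carrier K" and n: "n \<ge> 1"
  obtains g where "g \<in> hom (nil_group n 1) K" "g (nil_gen n 1 1) = k"
proof -
  interpret K: group K by fact
  interpret F: group "free_group 1" by (rule group_free_group)
  define h where "h = word_eval K (\<lambda>_. k)"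
  have h: "h \<in> hom (free_group 1) K" unfolding h_def using k by (intro K.word_eval_hom)
  interpret h: group_hom "free_group 1" K h by unfold_locales (rule h)
  \<comment> \<open>Commutativity of the image is obtained without describing words as powers:
    \<open>h\<close> followed by conjugation with \<open>a\<close> is a homomorphism, so it equals
    \<open>h\<close> as soon as \<open>a\<close> commutes with the value \<open>k\<close> of the
    single generator.\<close>
  have conj: "(\<lambda>w. a \<otimes>\<^bsub>K\<^esub> h w \<otimes>\<^bsub>K\<^esub> inv\<^bsub>K\<^esub> a) \<in> hom (free_group 1) K" if a: "a \<in> carrier K" for a
  proof (rule homI)
    fix u v assume uv: "u \<in> carrier (free_group 1)" "v \<in> carrier (free_group 1)"
    have "inv\<^bsub>K\<^esub> a \<otimes>\<^bsub>K\<^esub> (a \<otimes>\<^bsub>K\<^esub> (h v \<otimes>\<^bsub>K\<^esub> inv\<^bsub>K\<^esub> a)) = h v \<otimes>\<^bsub>K\<^esub> inv\<^bsub>K\<^esub> a"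
      using uv(2) a by (simp flip: K.m_assoc)
    then show "a \<otimes>\<^bsub>K\<^esub> h (u \<otimes>\<^bsub>free_group 1\<^esub> v) \<otimes>\<^bsub>K\<^esub> inv\<^bsub>K\<^esub> a =
        a \<otimes>\<^bsub>K\<^esub> h u \<otimes>\<^bsub>K\<^esub> inv\<^bsub>K\<^esub> a \<otimes>\<^bsub>K\<^esub> (a \<otimes>\<^bsub>K\<^esub> h v \<otimes>\<^bsub>K\<^esub> inv\<^bsub>K\<^esub> a)"
      using uv a by (simp add: K.m_assoc)
  qed (use a in simp)
  have commI: "a \<otimes>\<^bsub>K\<^esub> h w = h w \<otimes>\<^bsub>K\<^esub> a"
    if a: "a \<in> carrier K" "a \<otimes>\<^bsub>K\<^esub> k = k \<otimes>\<^bsub>K\<^esub> a" and w: "w \<in> carrier (free_group 1)" for a w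
  proof -
    have "a \<otimes>\<^bsub>K\<^esub> k \<otimes>\<^bsub>K\<^esub> inv\<^bsub>K\<^esub> a = k" using a k by (simp add: K.m_assoc)
    then have "a \<otimes>\<^bsub>K\<^esub> h w \<otimes>\<^bsub>K\<^esub> inv\<^bsub>K\<^esub> a = h w"
      by (intro K.hom_free_group_eqI[OF conj[OF a(1)] h _ w]) (use k in \<open>simp add: h_def\<close>)
    then have "h w \<otimes>\<^bsub>K\<^esub> a = a \<otimes>\<^bsub>K\<^esub> h w \<otimes>\<^bsub>K\<^esub> inv\<^bsub>K\<^esub> a \<otimes>\<^bsub>K\<^esub> a" by simp
    then show ?thesis using a(1) w by (simp add: K.m_assoc)
  qed
  \<comment> \<open>\<open>commI\<close> is used twice, first with \<open>a = k\<close> to see that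
    \<open>h u\<close> commutes with \<open>k\<close>, then with \<open>a = h u\<close>.\<close>
  have comm: "h u \<otimes>\<^bsub>K\<^esub> h w = h w \<otimes>\<^bsub>K\<^esub> h u"
    if "u \<in> carrier (free_group 1)" "w \<in> carrier (free_group 1)" for u w
    using commI[OF k refl that(1)] by (intro commI that h.hom_closed) simp
  have "h ` nil_kernel n 1 \<subseteq> {\<one>\<^bsub>K\<^esub>}"
  proof (cases n)
    case (enat m)
    \<comment> \<open>Here \<open>n \<ge> 1\<close> enters: the kernel is a term \<open>lcs\<close>
      at a successor, generated by commutators, and these are killed by \<open>h\<close>. For
      \<open>n = 0\<close> the kernel would be the whole group.\<close>
    then obtain m' where m: "m = Suc m'" using n by (cases m) (auto simp: one_enat_def)
    let ?S = "{x \<otimes>\<^bsub>free_group 1\<^esub> y \<otimes>\<^bsub>free_group 1\<^esub> inv\<^bsub>free_group 1\<^esub> x \<otimes>\<^bsub>free_group 1\<^esub>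
        inv\<^bsub>free_group 1\<^esub> y
      | x y. x \<in> carrier (free_group 1) \<and> y \<in> lcs (free_group 1) m'}"
    have sub: "lcs (free_group 1) m' \<subseteq> carrier (free_group 1)"
      using F.lcs_normal normal_imp_subgroup subgroup.subset by blast
    have "?S \<subseteq> kernel (free_group 1) K h"
    proof
      fix z assume "z \<in> ?S"
      then obtain x y where xy: "x \<in> carrier (free_group 1)" "y \<in> carrier (free_group 1)"
        "z = x \<otimes>\<^bsub>free_group 1\<^esub> y \<otimes>\<^bsub>free_group 1\<^esub> inv\<^bsub>free_group 1\<^esub> x \<otimes>\<^bsub>free_group 1\<^esub>
            inv\<^bsub>free_group 1\<^esub> y"
        using sub by blast
      then have "h z = h x \<otimes>\<^bsub>K\<^esub> h y \<otimes>\<^bsub>K\<^esub> inv\<^bsub>K\<^esub> h x \<otimes>\<^bsub>K\<^esub> inv\<^bsub>K\<^esub> h y"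
        by simp
      also have "\<dots> = \<one>\<^bsub>K\<^esub>"
        using xy(1,2) comm[OF xy(1,2)] by (simp add: K.m_assoc)
      finally show "z \<in> kernel (free_group 1) K h"
        using xy by (simp add: kernel_def)
    qed
    then have "generate (free_group 1) ?S \<subseteq> kernel (free_group 1) K h"
      using F.generate_subgroup_incl h.subgroup_kernel by blast
    with enat m show ?thesis by (auto simp: nil_kernel_def kernel_def)
  qed (use h.hom_one in \<open>simp add: nil_kernel_def\<close>)
  then obtain g where "g \<in> hom (nil_group n 1) K"
    "\<And>w. w \<in> carrier (free_group 1) \<Longrightarrow> g (nil_class n 1 w) = h w"
    using nil_group_lift[OF K h] by metis
  with that show ?thesis using k by (auto simp: nil_gen_def generator_carrier h_def)
qed

section \<open>The theories of free nilpotent groups\<close>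

abbreviation nil_app :: "nil_arrow \<Rightarrow> (nat \<times> bool) list set \<Rightarrow> (nat \<times> bool) list set" where
  "nil_app f \<equiv> snd (snd f)"

lemma nil_cat_simps:
  "Obj (nil_cat n) = UNIV"
  "Dom (nil_cat n) (p, q, h) = p"
  "Cod (nil_cat n) (p, q, h) = q"
  "Ident (nil_cat n) p = (p, p, \<lambda>c \<in> carrier (nil_group n p). c)"
  "(q', r, g) \<cdot>\<^bsub>nil_cat n\<^esub> (p, q, h) = (p, r, compose (carrier (nil_group n p)) g h)"
  "Zero (nil_cat n) = 0"
  "Cop (nil_cat n) p q = p + q"
  "In1 (nil_cat n) p q = nil_shift n 0 p (p + q)"
  "In2 (nil_cat n) p q = nil_shift n p q (p + q)"
  by (simp_all add: nil_cat_def)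

lemma nil_Hom_iff:
  "f \<in> Hom (nil_cat n) p q \<longleftrightarrow>
    (\<exists>h. f = (p, q, h) \<and> h \<in> hom (nil_group n p) (nil_group n q) \<and>
      h \<in> extensional (carrier (nil_group n p)))"
  by (auto simp: Hom_def nil_cat_def)

lemma nil_app_hom: "f \<in> Hom (nil_cat n) p q \<Longrightarrow> nil_app f \<in> hom (nil_group n p) (nil_group n q)"
  by (auto simp: nil_Hom_iff)

lemma nil_app_closed:
  "\<lbrakk>f \<in> Hom (nil_cat n) p q; c \<in> carrier (nil_group n p)\<rbrakk> \<Longrightarrow> nil_app f c \<in> carrier (nil_group n q)"
  using nil_app_hom by (rule hom_in_carrier)

lemma nil_app_Comp:
  "\<lbrakk>f \<in> Hom (nil_cat n) p q; g \<in> Hom (nil_cat n) q r; c \<in> carrier (nil_group n p)\<rbrakk>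
    \<Longrightarrow> nil_app (g \<cdot>\<^bsub>nil_cat n\<^esub> f) c = nil_app g (nil_app f c)"
  by (auto simp: nil_Hom_iff nil_cat_simps compose_def)

lemma nil_app_Ident: "c \<in> carrier (nil_group n p) \<Longrightarrow> nil_app (Ident (nil_cat n) p) c = c"
  by (simp add: nil_cat_simps)

lemma nil_Hom_eqI:
  assumes f: "f \<in> Hom (nil_cat n) p q" and f': "f' \<in> Hom (nil_cat n) p q"
    and gens: "\<And>i. i \<in> {1..p} \<Longrightarrow> nil_app f (nil_gen n p i) = nil_app f' (nil_gen n p i)"
  shows "f = f'"
proof -
  have "nil_app f c = nil_app f' c" if "c \<in> carrier (nil_group n p)" for c
    using group_nil_group nil_app_hom[OF f] nil_app_hom[OF f'] gens that
    by (rule hom_nil_group_eqI)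
  with f f' show ?thesis
    by (auto simp: nil_Hom_iff intro: extensionalityI)
qed

lemma nil_Hom_of_hom:
  assumes "h \<in> hom (nil_group n p) (nil_group n q)"
  shows "(p, q, restrict h (carrier (nil_group n p))) \<in> Hom (nil_cat n) p q"
  using assms group.is_monoid[OF group_nil_group, of n p]
  by (auto simp: nil_Hom_iff hom_def monoid.m_closed)

lemma nil_Hom_exists:
  assumes "\<And>i. i \<in> {1..p} \<Longrightarrow> y i \<in> carrier (nil_group n q)"
  shows "\<exists>f \<in> Hom (nil_cat n) p q. \<forall>i \<in> {1..p}. nil_app f (nil_gen n p i) = y i"
proof -
  obtain h where h: "h \<in> hom (nil_group n p) (nil_group n q)"
    "\<And>i. i \<in> {1..p} \<Longrightarrow> h (nil_gen n p i) = y i"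
    using nil_group_hom_exists assms by metis
  show ?thesis
    by (rule bexI[OF _ nil_Hom_of_hom[OF h(1)]]) (use h nil_gen_carrier in auto)
qed

lemma nil_Hom_1_exists:
  "g \<in> carrier (nil_group n q) \<Longrightarrow> \<exists>w \<in> Hom (nil_cat n) 1 q. nil_app w (nil_gen n 1 1) = g"
  using nil_Hom_exists[of 1 "\<lambda>_. g" n q] unfolding atLeastAtMost_singleton by blast

lemma category_nil_cat: "category (nil_cat n)"
proof
  fix f g p q r assume "f \<in> Hom (nil_cat n) p q" "g \<in> Hom (nil_cat n) q r"
  then show "g \<cdot>\<^bsub>nil_cat n\<^esub> f \<in> Hom (nil_cat n) p r"
    using group.hom_compose[OF group_nil_group] by (auto simp: nil_Hom_iff nil_cat_simps)
next
  fix p show "Ident (nil_cat n) p \<in> Hom (nil_cat n) p p"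
    using nil_Hom_of_hom[of "\<lambda>c. c" n p p] by (auto simp: nil_cat_simps hom_def)
next
  fix f p q assume f: "f \<in> Hom (nil_cat n) p q"
  then show "Ident (nil_cat n) q \<cdot>\<^bsub>nil_cat n\<^esub> f = f"
    using hom_in_carrier
    by (fastforce simp: nil_Hom_iff nil_cat_simps compose_def extensional_def fun_eq_iff)
  show "f \<cdot>\<^bsub>nil_cat n\<^esub> Ident (nil_cat n) p = f"
    using f by (auto simp: nil_Hom_iff nil_cat_simps compose_def extensional_def fun_eq_iff)
next
  fix f g h p q r s
  assume "f \<in> Hom (nil_cat n) p q" "g \<in> Hom (nil_cat n) q r" "h \<in> Hom (nil_cat n) r s"
  then show "h \<cdot>\<^bsub>nil_cat n\<^esub> g \<cdot>\<^bsub>nil_cat n\<^esub> f = h \<cdot>\<^bsub>nil_cat n\<^esub> (g \<cdot>\<^bsub>nil_cat n\<^esub> f)"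
    using hom_in_carrier
    by (fastforce simp: nil_Hom_iff nil_cat_simps compose_def fun_eq_iff)
qed (simp_all add: nil_cat_simps)

text \<open>The union in \<open>nil_shift\<close> runs over a coset. Shifting the letters is a
  homomorphism of free groups and therefore maps kernel to kernel, so all members of the union equal
  the value of the induced homomorphism \<open>g\<close>.\<close>

lemma nil_shift:
  assumes "s + p \<le> q"
  shows nil_shift_Hom: "nil_shift n s p q \<in> Hom (nil_cat n) p q"
    and nil_shift_gen: "i \<in> {1..p} \<Longrightarrow> nil_app (nil_shift n s p q) (nil_gen n p i)
        = nil_gen n q (i + s)"
proof -
  let ?sh = "map (\<lambda>(i, b). (i + s, b)) :: (nat \<times> bool) list \<Rightarrow> _"
  \<comment> \<open>Adding a constant to the indices preserves and reflects cancellation, so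
    shifting commutes with reduction.\<close>
  have push: "?sh (push x w) = push (case x of (i, b) \<Rightarrow> (i + s, b)) (?sh w)" for x w
    by (cases w) (auto simp: cancels_def split: prod.splits)
  have red: "?sh (reduce w) = reduce (?sh w)" for w
    by (induction w) (simp_all add: reduce_def push)
  have rsh: "reduced w \<Longrightarrow> reduced (?sh w)" for w
    unfolding successively_map by (erule successively_mono) (auto simp: cancels_def)
  have sh: "?sh \<in> hom (free_group p) (free_group q)"
  proof (rule homI)
    fix w assume w: "w \<in> carrier (free_group p)"
    have "fst ` set (?sh w) = (\<lambda>i. i + s) ` fst ` set w" by force
    with w show "?sh w \<in> carrier (free_group q)"
      using assms rsh by (auto simp: free_group_simps)
  qed (simp add: free_group_simps red)
  interpret sh: group_hom "free_group p" "free_group q" ?sh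
    using sh by (simp add: group_hom_def group_hom_axioms_def group_free_group)
  have nq: "nil_class n q \<circ> ?sh \<in> hom (free_group p) (nil_group n q)"
    using Group.hom_compose[OF sh nil_class_hom] .
  have "(nil_class n q \<circ> ?sh) ` nil_kernel n p \<subseteq> {\<one>\<^bsub>nil_group n q\<^esub>}"
    using hom_nil_kernel[OF sh, of n] by (simp add: image_subset_iff nil_class_kernel)
  then obtain g where g: "g \<in> hom (nil_group n p) (nil_group n q)"
    "\<And>w. w \<in> carrier (free_group p) \<Longrightarrow> g (nil_class n p w) = nil_class n q (?sh w)"
    using nil_group_lift[OF group_nil_group nq] by (metis comp_apply)
  have sub: "nil_kernel n p \<subseteq> carrier (free_group p)"
    by (rule subgroup.subset[OF normal_imp_subgroup[OF nil_kernel_normal]])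
  have "(\<Union>w \<in> c. nil_kernel n q #>\<^bsub>free_group q\<^esub> ?sh w) = g c"
    if c: "c \<in> carrier (nil_group n p)" for c
  proof -
    obtain v where v: "v \<in> carrier (free_group p)" "c = nil_class n p v"
      using c unfolding carrier_nil_group by blast
    have "nil_class n q (?sh w) = g c" if w: "w \<in> c" for w
    proof -
      have "w \<in> carrier (free_group p)"
        using subsetD[OF sh.G.r_coset_subset_G[OF sub v(1)]] w v(2) by (simp add: nil_class_def)
      moreover have "nil_class n p w = c"
        using sh.G.repr_independence[OF _ v(1) normal_imp_subgroup[OF nil_kernel_normal], of w n]
            w v(2)
        by (simp add: nil_class_def)
      ultimately show ?thesis using g(2)[of w] by simp
    qed
    moreover have "v \<in> c"
      using sh.G.rcos_self[OF v(1) normal_imp_subgroup[OF nil_kernel_normal], of n] v(2)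
      by (simp add: nil_class_def)
    ultimately show ?thesis unfolding nil_class_def[symmetric] by blast
  qed
  then have eq: "nil_shift n s p q = (p, q, restrict g (carrier (nil_group n p)))"
    by (simp add: nil_shift_def cong: restrict_cong)
  show "nil_shift n s p q \<in> Hom (nil_cat n) p q"
    unfolding eq using g(1) by (rule nil_Hom_of_hom)
  show "nil_app (nil_shift n s p q) (nil_gen n p i) = nil_gen n q (i + s)" if "i \<in> {1..p}"
    using that g(2) nil_gen_carrier[OF that] generator_carrier[OF that]
    by (simp add: eq) (simp add: nil_gen_def)
qed

text \<open>The \<open>i\<close>-th inclusion of the integers into the \<open>q\<close>-fold
  coproduct. Generators are numbered from 1, and generator 1 has to go to \<open>i\<close>, hence
  the offset \<open>i - 1\<close>.\<close>

definition nil_in :: "enat \<Rightarrow> nat \<Rightarrow> nat \<Rightarrow> nil_arrow" where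
  "nil_in n q i = nil_shift n (i - 1) 1 q"

lemma nil_in_Hom: "i \<in> {1..q} \<Longrightarrow> nil_in n q i \<in> Hom (nil_cat n) 1 q"
  unfolding nil_in_def by (rule nil_shift_Hom) auto

lemma nil_in_gen: "i \<in> {1..q} \<Longrightarrow> nil_app (nil_in n q i) (nil_gen n 1 1) = nil_gen n q i"
  unfolding nil_in_def by (subst nil_shift_gen) auto

lemma nil_Hom_1_eqI:
  "\<lbrakk>f \<in> Hom (nil_cat n) 1 q; f' \<in> Hom (nil_cat n) 1 q;
    nil_app f (nil_gen n 1 1) = nil_app f' (nil_gen n 1 1)\<rbrakk> \<Longrightarrow> f = f'"
  by (rule nil_Hom_eqI) auto

lemma nil_app_in:
  assumes "f \<in> Hom (nil_cat n) p q" "i \<in> {1..p}"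
  shows "nil_app (f \<cdot>\<^bsub>nil_cat n\<^esub> nil_in n p i) (nil_gen n 1 1) = nil_app f (nil_gen n p i)"
  using assms nil_app_Comp[OF nil_in_Hom[OF assms(2)] assms(1) nil_gen_carrier]
  by (simp add: nil_in_gen)

text \<open>With \<open>nil_Hom_in_exists\<close> this is the universal property of \<open>p\<close>
  as a \<open>p\<close>-fold coproduct of \<open>1\<close>, in the form in which it will be repeated
  for the images in \<open>A\<close> and for lifts.\<close>

lemma nil_Hom_in_eqI:
  assumes "f \<in> Hom (nil_cat n) p q" "f' \<in> Hom (nil_cat n) p q"
    and "\<And>i. i \<in> {1..p} \<Longrightarrow> f \<cdot>\<^bsub>nil_cat n\<^esub> nil_in n p i = f' \<cdot>\<^bsub>nil_cat n\<^esub> nil_in n p i"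
  shows "f = f'"
  using assms(1,2) by (rule nil_Hom_eqI) (metis assms nil_app_in)

lemma nil_Hom_in_exists:
  assumes "\<And>i. i \<in> {1..p} \<Longrightarrow> w i \<in> Hom (nil_cat n) 1 q"
  shows "\<exists>f \<in> Hom (nil_cat n) p q. \<forall>i \<in> {1..p}. f \<cdot>\<^bsub>nil_cat n\<^esub> nil_in n p i = w i"
proof -
  interpret category "nil_cat n" by (rule category_nil_cat)
  obtain f where f: "f \<in> Hom (nil_cat n) p q"
    "\<And>i. i \<in> {1..p} \<Longrightarrow> nil_app f (nil_gen n p i) = nil_app (w i) (nil_gen n 1 1)"
    using nil_Hom_exists[of p "\<lambda>i. nil_app (w i) (nil_gen n 1 1)" n q]
      nil_app_closed[OF assms nil_gen_carrier[of 1 1]] by fastforce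
  have "f \<cdot>\<^bsub>nil_cat n\<^esub> nil_in n p i = w i" if "i \<in> {1..p}" for i
    using that f assms Comp_Hom[OF nil_in_Hom[OF that] f(1)]
    by (intro nil_Hom_1_eqI[of _ n q]) (simp_all add: nil_app_in)
  with f(1) show ?thesis by blast
qed

lemma nil_in_1: "nil_in n 1 1 = Ident (nil_cat n) 1"
proof -
  interpret category "nil_cat n" by (rule category_nil_cat)
  show ?thesis
    by (rule nil_Hom_1_eqI[OF nil_in_Hom Ident_Hom])
      (auto simp: nil_in_gen[simplified] nil_app_Ident nil_gen_carrier nil_cat_simps(1))
qed

lemma In1_nil_in:
  assumes "i \<in> {1..p}"
  shows "In1 (nil_cat n) p q \<cdot>\<^bsub>nil_cat n\<^esub> nil_in n p i = nil_in n (p + q) i"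
proof -
  interpret category "nil_cat n" by (rule category_nil_cat)
  show ?thesis
    using assms nil_shift_Hom[of 0 p "p + q" n]
    by (intro nil_Hom_1_eqI[of _ n "p + q"])
      (auto simp: nil_app_in nil_in_gen nil_cat_simps nil_shift_gen intro!: nil_in_Hom Comp_Hom)
qed

lemma In2_nil_in:
  assumes "i \<in> {1..q}"
  shows "In2 (nil_cat n) p q \<cdot>\<^bsub>nil_cat n\<^esub> nil_in n q i = nil_in n (p + q) (p + i)"
proof -
  interpret category "nil_cat n" by (rule category_nil_cat)
  show ?thesis
    using assms nil_shift_Hom[of p q "p + q" n]
    by (intro nil_Hom_1_eqI[of _ n "p + q"])
      (auto simp: nil_app_in nil_in_gen nil_cat_simps nil_shift_gen add.commute
        intro!: nil_in_Hom Comp_Hom)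
qed

lemma nil_app_0:
  assumes "f \<in> Hom (nil_cat n) 0 q" "c \<in> carrier (nil_group n 0)"
  shows "nil_app f c = \<one>\<^bsub>nil_group n q\<^esub>"
  by (rule hom_nil_group_eqI[OF group_nil_group nil_app_hom[OF assms(1)]
      trivial_hom[OF group_nil_group]
        _ assms(2)]) simp

text \<open>Inductions on the number of summands treat the successor of \<open>q\<close> as
  \<open>q + 1\<close>, the coproduct of \<open>q\<close> and \<open>1\<close>.\<close>

declare Suc_eq_plus1 [simp]

section \<open>Track categories\<close>

lemma (in category) Hom_Obj: "f \<in> Hom C X Y \<Longrightarrow> X \<in> Obj C" "f \<in> Hom C X Y \<Longrightarrow> Y \<in> Obj C"
  using Dom_Obj Cod_Obj by (auto simp: Hom_def)

context track_category
begin

section \<open>Whiskering, interchange and vertical inverses\<close>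

lemma Arr_Hom: "f \<in> Hom A X Y \<Longrightarrow> f \<in> Arr A" "f \<in> Hom A X Y \<Longrightarrow> Dom A f = X"
  "f \<in> Hom A X Y \<Longrightarrow> Cod A f = Y"
  by (auto simp: Hom_def)

lemma HTrack_Src_Tgt:
  assumes "\<eta> \<in> HTrack A X Y"
  shows "Src A \<eta> \<in> Hom A X Y" "Tgt A \<eta> \<in> Hom A X Y" "\<eta> \<in> Track A (Src A \<eta>) (Tgt A \<eta>)"
  using assms Src_Tgt_Hom by (auto simp: HTrack_def Track_def)

lemma HTrackI: "\<lbrakk>\<eta> \<in> Track A f g; f \<in> Hom A X Y\<rbrakk> \<Longrightarrow> \<eta> \<in> HTrack A X Y"
  by (auto simp: HTrack_def Track_def)

lemma Track_Hom: "\<lbrakk>\<eta> \<in> Track A f g; f \<in> Hom A X Y\<rbrakk> \<Longrightarrow> g \<in> Hom A X Y"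
  using Src_Tgt_Hom HTrackI by (fastforce simp: Track_def)

lemma Track_unique: "\<lbrakk>\<eta> \<in> Track A f g; \<eta> \<in> Track A f' g'\<rbrakk> \<Longrightarrow> f = f' \<and> g = g'"
  by (auto simp: Track_def)

lemma VId_Hom: "f \<in> Hom A X Y \<Longrightarrow> VId A f \<in> Track A f f"
  by (auto simp: VId_Track Hom_def)

lemma VId_HTrack: "f \<in> Hom A X Y \<Longrightarrow> VId A f \<in> HTrack A X Y"
  using VId_Hom HTrackI by blast

lemma VId_inject: "\<lbrakk>f \<in> Hom A X Y; f' \<in> Hom A X' Y'; VId A f = VId A f'\<rbrakk> \<Longrightarrow> f = f'"
  using VId_Hom Track_unique by metis

lemma post_Track:
  "\<lbrakk>\<eta> \<in> Track A f f'; f \<in> Hom A X Y; g \<in> Hom A Y Z\<rbrakk> \<Longrightarrow> post A g \<eta> \<in> Track A (g \<cdot> f) (g \<cdot> f')"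
  unfolding post_def by (rule HComp_Track) (auto intro: VId_Hom)

lemma pre_Track:
  "\<lbrakk>\<theta> \<in> Track A g g'; g \<in> Hom A Y Z; h \<in> Hom A X Y\<rbrakk> \<Longrightarrow> pre A h \<theta> \<in> Track A (g \<cdot> h) (g' \<cdot> h)"
  unfolding pre_def by (rule HComp_Track) (auto intro: VId_Hom)

lemma pre_HTrack: "\<lbrakk>\<eta> \<in> HTrack A Y Z; h \<in> Hom A X Y\<rbrakk> \<Longrightarrow> pre A h \<eta> \<in> HTrack A X Z"
  using HTrack_Src_Tgt pre_Track Comp_Hom HTrackI by metis

lemma post_VComp:
  "\<lbrakk>\<eta> \<in> Track A f f'; \<eta>' \<in> Track A f' f''; f \<in> Hom A X Y; g \<in> Hom A Y Z\<rbrakk>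
    \<Longrightarrow> post A g (\<eta>' \<box> \<eta>) = post A g \<eta>' \<box> post A g \<eta>"
  unfolding post_def using HComp_VComp[of f X Y g Z \<eta> f' \<eta>' f'' "VId A g" g "VId A g" g]
  by (simp add: VId_Hom VId_left[OF VId_Hom])

lemma pre_VComp:
  "\<lbrakk>\<theta> \<in> Track A g g'; \<theta>' \<in> Track A g' g''; g \<in> Hom A Y Z; h \<in> Hom A X Y\<rbrakk>
    \<Longrightarrow> pre A h (\<theta>' \<box> \<theta>) = pre A h \<theta>' \<box> pre A h \<theta>"
  unfolding pre_def using HComp_VComp[of h X Y g Z "VId A h" h "VId A h" h \<theta> g' \<theta>' g'']
  by (simp add: VId_Hom VId_left[OF VId_Hom])

lemma post_post:
  "\<lbrakk>\<eta> \<in> HTrack A W X; g \<in> Hom A X Y; h \<in> Hom A Y Z\<rbrakk> \<Longrightarrow> post A h (post A g \<eta>) = post A (h \<cdot> g) \<eta>"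
  unfolding post_def using HComp_assoc[of \<eta> W X "VId A g" Y "VId A h" Z]
  by (simp add: VId_HTrack HComp_VId)

lemma pre_pre:
  "\<lbrakk>\<eta> \<in> HTrack A Y Z; g \<in> Hom A X Y; h \<in> Hom A W X\<rbrakk> \<Longrightarrow> pre A h (pre A g \<eta>) = pre A (g \<cdot> h) \<eta>"
  unfolding pre_def using HComp_assoc[of "VId A h" W X "VId A g" Y \<eta> Z]
  by (simp add: VId_HTrack HComp_VId)

lemma pre_post:
  "\<lbrakk>\<eta> \<in> HTrack A X Y; g \<in> Hom A Y Z; h \<in> Hom A W X\<rbrakk>
    \<Longrightarrow> pre A h (post A g \<eta>) = post A g (pre A h \<eta>)"
  unfolding pre_def post_def using HComp_assoc[of "VId A h" W X \<eta> Y "VId A g" Z]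
  by (simp add: VId_HTrack)

lemma post_VId: "\<lbrakk>f \<in> Hom A X Y; g \<in> Hom A Y Z\<rbrakk> \<Longrightarrow> post A g (VId A f) = VId A (g \<cdot> f)"
  by (simp add: post_def HComp_VId)

lemma pre_VId: "\<lbrakk>f \<in> Hom A X Y; g \<in> Hom A Y Z\<rbrakk> \<Longrightarrow> pre A f (VId A g) = VId A (g \<cdot> f)"
  by (simp add: pre_def HComp_VId)

lemma post_Ident: "\<eta> \<in> HTrack A X Y \<Longrightarrow> post A (Ident A Y) \<eta> = \<eta>"
  by (simp add: post_def HComp_Ident_left)

lemma pre_Ident: "\<eta> \<in> HTrack A X Y \<Longrightarrow> pre A (Ident A X) \<eta> = \<eta>"
  by (simp add: pre_def HComp_Ident_right)

text \<open>Both sides are the horizontal composite \<open>HComp A \<theta> \<eta>\<close>, factored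
  in the two possible ways.\<close>

lemma interchange:
  assumes "\<eta> \<in> Track A f f'" "\<theta> \<in> Track A g g'" "f \<in> Hom A X Y" "g \<in> Hom A Y Z"
  shows "pre A f' \<theta> \<box> post A g \<eta> = post A g' \<eta> \<box> pre A f \<theta>"
proof -
  have f': "f' \<in> Hom A X Y" and g': "g' \<in> Hom A Y Z" using assms Track_Hom by blast+
  have "pre A f' \<theta> \<box> post A g \<eta> = HComp A \<theta> \<eta>"
    unfolding pre_def post_def
    using HComp_VComp[OF assms(3,4,1) VId_Hom[OF f'] VId_Hom[OF assms(4)] assms(2)]
    by (simp add: VId_left[OF assms(1)] VId_right[OF assms(2)])
  moreover have "post A g' \<eta> \<box> pre A f \<theta> = HComp A \<theta> \<eta>"
    unfolding pre_def post_def
    using HComp_VComp[OF assms(3,4) VId_Hom[OF assms(3)] assms(1,2) VId_Hom[OF g']]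
    by (simp add: VId_left[OF assms(2)] VId_right[OF assms(1)])
  ultimately show ?thesis by simp
qed

definition vinv :: "'t \<Rightarrow> 't" where
  "vinv \<eta> = (SOME \<phi>. \<phi> \<in> Track A (Tgt A \<eta>) (Src A \<eta>) \<and> \<phi> \<box> \<eta> = VId A (Src A \<eta>) \<and>
     \<eta> \<box> \<phi> = VId A (Tgt A \<eta>))"

lemma vinv:
  assumes "\<eta> \<in> Track A f g"
  shows vinv_Track: "vinv \<eta> \<in> Track A g f" and vinv_left: "vinv \<eta> \<box> \<eta> = VId A f"
    and vinv_right: "\<eta> \<box> vinv \<eta> = VId A g"
proof -
  have "\<exists>\<phi>. \<phi> \<in> Track A (Tgt A \<eta>) (Src A \<eta>) \<and> \<phi> \<box> \<eta> = VId A (Src A \<eta>) \<and> \<eta> \<box> \<phi> = VId A (Tgt A \<eta>)"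
    using VComp_inverse[OF assms] assms by (auto simp: Track_def)
  from someI_ex[OF this] assms show "vinv \<eta> \<in> Track A g f" "vinv \<eta> \<box> \<eta> = VId A f"
    "\<eta> \<box> vinv \<eta> = VId A g"
    unfolding vinv_def by (auto simp: Track_def)
qed

lemma VComp_vinv_cancel:
  assumes "\<eta> \<in> Track A f g" "\<phi> \<in> Track A f h"
  shows "\<phi> \<box> vinv \<eta> \<box> \<eta> = \<phi>"
  using VComp_assoc[OF assms(1) vinv_Track[OF assms(1)] assms(2)]
  by (simp add: vinv_left[OF assms(1)] VId_right[OF assms(2)])

lemma VComp_right_cancel:
  assumes "\<eta> \<in> Track A f g" "\<phi> \<in> Track A g h" "\<psi> \<in> Track A g k" "\<phi> \<box> \<eta> = \<psi> \<box> \<eta>"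
  shows "\<phi> = \<psi>"
proof -
  have "\<phi> = \<phi> \<box> \<eta> \<box> vinv \<eta>"
    by (simp add: VComp_assoc[OF vinv_Track[OF assms(1)] assms(1,2)] vinv_right[OF assms(1)]
        VId_right[OF assms(2)])
  also have "\<dots> = \<psi> \<box> \<eta> \<box> vinv \<eta>" by (simp only: assms(4))
  also have "\<dots> = \<psi>"
    by (simp add: VComp_assoc[OF vinv_Track[OF assms(1)] assms(1,3)] vinv_right[OF assms(1)]
        VId_right[OF assms(3)])
  finally show ?thesis .
qed

lemma VComp_left_cancel:
  assumes "\<eta> \<in> Track A g h" "\<phi> \<in> Track A f g" "\<psi> \<in> Track A f g" "\<eta> \<box> \<phi> = \<eta> \<box> \<psi>"
  shows "\<phi> = \<psi>"
proof -
  have "\<phi> = vinv \<eta> \<box> (\<eta> \<box> \<phi>)"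
    by (simp add: VComp_assoc[OF assms(2,1) vinv_Track[OF assms(1)], symmetric]
        vinv_left[OF assms(1)] VId_left[OF assms(2)])
  also have "\<dots> = vinv \<eta> \<box> (\<eta> \<box> \<psi>)" by (simp only: assms(4))
  also have "\<dots> = \<psi>"
    by (simp add: VComp_assoc[OF assms(3,1) vinv_Track[OF assms(1)], symmetric]
        vinv_left[OF assms(1)] VId_left[OF assms(3)])
  finally show ?thesis .
qed

text \<open>Typing by equations for \<open>Src\<close> and \<open>Tgt\<close>, here and in
  \<open>VComp_simps\<close>, discharges the side conditions of \<open>VComp_assoc_Trk\<close>, so
  that long vertical pastings can be reassociated by rewriting.\<close>

lemma Track_simps:
  assumes "\<eta> \<in> Track A f g"
  shows "\<eta> \<in> Trk A" "Src A \<eta> = f" "Tgt A \<eta> = g"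
  using assms by (auto simp: Track_def)

lemma VComp_simps:
  assumes "\<eta> \<in> Trk A" "\<phi> \<in> Trk A" "Tgt A \<eta> = Src A \<phi>"
  shows "\<phi> \<box> \<eta> \<in> Trk A" "Src A (\<phi> \<box> \<eta>) = Src A \<eta>" "Tgt A (\<phi> \<box> \<eta>) = Tgt A \<phi>"
  using VComp_Track[of \<eta> "Src A \<eta>" "Tgt A \<eta>" \<phi> "Tgt A \<phi>"] assms by (auto simp: Track_def)

lemma VComp_assoc_Trk:
  "\<lbrakk>\<eta> \<in> Trk A; \<phi> \<in> Trk A; \<psi> \<in> Trk A; Tgt A \<eta> = Src A \<phi>; Tgt A \<phi> = Src A \<psi>\<rbrakk>
    \<Longrightarrow> (\<psi> \<box> \<phi>) \<box> \<eta> = \<psi> \<box> (\<phi> \<box> \<eta>)"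
  by (rule VComp_assoc) (auto simp: Track_def)

end

locale strict_track_category = track_category A
  for A :: "('o, 'a, 't, 'm) trackcat_scheme" (structure) +
  assumes cops: "strict_coproducts A" and zero: "strict_zero A"
begin

section \<open>Universal properties of strict coproducts and of the strict zero object\<close>

lemma Cop_In:
  assumes "X \<in> Obj A" "Y \<in> Obj A"
  shows Cop_Obj: "Cop A X Y \<in> Obj A" and In1_Hom: "In1 A X Y \<in> Hom A X (Cop A X Y)"
    and In2_Hom: "In2 A X Y \<in> Hom A Y (Cop A X Y)"
  using cops assms by (auto simp: strict_coproducts_def)

lemma Cop_bij:
  assumes "X \<in> Obj A" "Y \<in> Obj A" "Z \<in> Obj A"
  shows "bij_betw (\<lambda>m. (m \<cdot> In1 A X Y, m \<cdot> In2 A X Y))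
           (Hom A (Cop A X Y) Z) (Hom A X Z \<times> Hom A Y Z)"
    "bij_betw (\<lambda>\<eta>. (pre A (In1 A X Y) \<eta>, pre A (In2 A X Y) \<eta>))
           (HTrack A (Cop A X Y) Z) (HTrack A X Z \<times> HTrack A Y Z)"
  using cops assms by (auto simp: strict_coproducts_def)

lemma Cop_Hom_eqI:
  assumes "f \<in> Hom A (Cop A X Y) Z" "f' \<in> Hom A (Cop A X Y) Z" "X \<in> Obj A" "Y \<in> Obj A"
    and "f \<cdot> In1 A X Y = f' \<cdot> In1 A X Y" "f \<cdot> In2 A X Y = f' \<cdot> In2 A X Y"
  shows "f = f'"
proof -
  have "Z \<in> Obj A" using assms(1) Hom_Obj by blast
  with Cop_bij(1)[of X Y Z] assms show ?thesis
    unfolding bij_betw_def inj_on_def by blast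
qed

lemma copair:
  assumes a: "a \<in> Hom A X Z" and b: "b \<in> Hom A Y Z"
  shows copair_Hom: "copair A a b \<in> Hom A (Cop A X Y) Z"
    and copair_In1: "copair A a b \<cdot> In1 A X Y = a" and copair_In2: "copair A a b \<cdot> In2 A X Y = b"
proof -
  have o: "X \<in> Obj A" "Y \<in> Obj A" "Z \<in> Obj A" using a b Hom_Obj by blast+
  have "(a, b) \<in> (\<lambda>m. (m \<cdot> In1 A X Y, m \<cdot> In2 A X Y)) ` Hom A (Cop A X Y) Z"
    using Cop_bij(1)[OF o] a b by (auto simp: bij_betw_def)
  then have "\<exists>!m. m \<in> Hom A (Cop A X Y) Z \<and> m \<cdot> In1 A X Y = a \<and> m \<cdot> In2 A X Y = b"
    using Cop_Hom_eqI[OF _ _ o(1,2)] by (auto 0 3)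
  from theI'[OF this] show "copair A a b \<in> Hom A (Cop A X Y) Z"
    "copair A a b \<cdot> In1 A X Y = a" "copair A a b \<cdot> In2 A X Y = b"
    using a b by (simp_all add: copair_def Arr_Hom)
qed

lemma Cop_HTrack_eqI:
  assumes "\<eta> \<in> HTrack A (Cop A X Y) Z" "\<eta>' \<in> HTrack A (Cop A X Y) Z" "X \<in> Obj A" "Y \<in> Obj A"
    and "pre A (In1 A X Y) \<eta> = pre A (In1 A X Y) \<eta>'" "pre A (In2 A X Y) \<eta> = pre A (In2 A X Y) \<eta>'"
  shows "\<eta> = \<eta>'"
proof -
  have "Z \<in> Obj A" using assms(1) HTrack_Src_Tgt Hom_Obj by blast
  with Cop_bij(2)[of X Y Z] assms show ?thesis
    unfolding bij_betw_def inj_on_def by blast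
qed

lemma tcopair:
  assumes s: "s \<in> HTrack A X Z" and t: "t \<in> HTrack A Y Z"
  shows tcopair_HTrack: "tcopair A s t \<in> HTrack A (Cop A X Y) Z"
    and tcopair_In1: "pre A (In1 A X Y) (tcopair A s t) = s"
    and tcopair_In2: "pre A (In2 A X Y) (tcopair A s t) = t"
proof -
  have o: "X \<in> Obj A" "Y \<in> Obj A" "Z \<in> Obj A" using s t HTrack_Src_Tgt Hom_Obj by blast+
  have "(s, t) \<in> (\<lambda>\<eta>. (pre A (In1 A X Y) \<eta>, pre A (In2 A X Y) \<eta>)) ` HTrack A (Cop A X Y) Z"
    using Cop_bij(2)[OF o] s t by (auto simp: bij_betw_def)
  then have "\<exists>!\<eta>. \<eta> \<in> HTrack A (Cop A X Y) Z \<and> pre A (In1 A X Y) \<eta> = s \<and> pre A (In2 A X Y) \<eta> = t"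
    using Cop_HTrack_eqI[OF _ _ o(1,2)] by (auto 0 3)
  from theI'[OF this] show "tcopair A s t \<in> HTrack A (Cop A X Y) Z"
    "pre A (In1 A X Y) (tcopair A s t) = s" "pre A (In2 A X Y) (tcopair A s t) = t"
    using HTrack_Src_Tgt(1)[OF s] HTrack_Src_Tgt(1)[OF t] by (simp_all add: tcopair_def Arr_Hom)
qed

lemma tcopair_eqI:
  assumes "s \<in> HTrack A X Z" "t \<in> HTrack A Y Z" "\<eta> \<in> HTrack A (Cop A X Y) Z"
    and "pre A (In1 A X Y) \<eta> = s" "pre A (In2 A X Y) \<eta> = t"
  shows "\<eta> = tcopair A s t"
proof -
  have "X \<in> Obj A" "Y \<in> Obj A" using assms(1,2) HTrack_Src_Tgt(1) Hom_Obj by blast+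
  then show ?thesis
    using assms by (intro Cop_HTrack_eqI[OF assms(3) tcopair_HTrack]) (simp_all add: tcopair)
qed

lemma zero_HTrack_eqI:
  "\<lbrakk>\<eta> \<in> HTrack A (Zero A) X; \<eta>' \<in> HTrack A (Zero A) X\<rbrakk> \<Longrightarrow> \<eta> = \<eta>'"
  "\<lbrakk>\<eta> \<in> HTrack A X (Zero A); \<eta>' \<in> HTrack A X (Zero A)\<rbrakk> \<Longrightarrow> \<eta> = \<eta>'"
  using zero HTrack_Src_Tgt(1) Hom_Obj unfolding strict_zero_def by metis+

end

section \<open>Coproduct preserving pseudofunctors on nilpotent theories\<close>

lemma nil_copair:
  assumes f: "f \<in> Hom (nil_cat n) p r" and g: "g \<in> Hom (nil_cat n) q r"
  shows nil_copair_Hom: "copair (nil_cat n) f g \<in> Hom (nil_cat n) (p + q) r"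
    and nil_copair_In1: "copair (nil_cat n) f g \<cdot>\<^bsub>nil_cat n\<^esub> In1 (nil_cat n) p q = f"
    and nil_copair_In2: "copair (nil_cat n) f g \<cdot>\<^bsub>nil_cat n\<^esub> In2 (nil_cat n) p q = g"
    and nil_copair_eqI: "\<And>m. \<lbrakk>m \<in> Hom (nil_cat n) (p + q) r;
      m \<cdot>\<^bsub>nil_cat n\<^esub> In1 (nil_cat n) p q = f; m \<cdot>\<^bsub>nil_cat n\<^esub> In2 (nil_cat n) p q = g\<rbrakk>
      \<Longrightarrow> copair (nil_cat n) f g = m"
proof -
  interpret category "nil_cat n" by (rule category_nil_cat)
  let ?In1 = "In1 (nil_cat n) p q" and ?In2 = "In2 (nil_cat n) p q"
  let ?P = "\<lambda>m. m \<in> Hom (nil_cat n) (p + q) r \<and> m \<cdot>\<^bsub>nil_cat n\<^esub> ?In1 = f \<and> m \<cdot>\<^bsub>nil_cat n\<^esub> ?In2 = g"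
  have In: "?In1 \<in> Hom (nil_cat n) p (p + q)" "?In2 \<in> Hom (nil_cat n) q (p + q)"
    by (simp_all add: nil_cat_simps nil_shift_Hom)
  \<comment> \<open>Both conditions are restated on the \<open>p + q\<close> inclusions of
    \<open>1\<close>: the first \<open>p\<close> of them factor through \<open>In1\<close>, the
    others through \<open>In2\<close> with index lowered by \<open>p\<close>. Existence and
    uniqueness of the copair then come from the \<open>p + q\<close>-fold coproduct.\<close>
  have iff: "?P m \<longleftrightarrow> m \<in> Hom (nil_cat n) (p + q) r \<and>
      (\<forall>i\<in>{1..p + q}. m \<cdot>\<^bsub>nil_cat n\<^esub> nil_in n (p + q) i =
        (if i \<le> p then f \<cdot>\<^bsub>nil_cat n\<^esub> nil_in n p i else g \<cdot>\<^bsub>nil_cat n\<^esub> nil_in n q (i - p)))" for m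
  proof (cases "m \<in> Hom (nil_cat n) (p + q) r")
    case m: True
    have 1: "m \<cdot>\<^bsub>nil_cat n\<^esub> ?In1 \<cdot>\<^bsub>nil_cat n\<^esub> nil_in n p i = m \<cdot>\<^bsub>nil_cat n\<^esub> nil_in n (p + q) i"
      if "i \<in> {1..p}" for i
      using Comp_assoc[OF nil_in_Hom[OF that] In(1) m] In1_nil_in[OF that] by simp
    have 2: "m \<cdot>\<^bsub>nil_cat n\<^esub> ?In2 \<cdot>\<^bsub>nil_cat n\<^esub> nil_in n q i
        = m \<cdot>\<^bsub>nil_cat n\<^esub> nil_in n (p + q) (p + i)"
      if "i \<in> {1..q}" for i
      using Comp_assoc[OF nil_in_Hom[OF that] In(2) m] In2_nil_in[OF that] by simp
    have split: "(\<forall>i\<in>{1..p + q}. Q i) \<longleftrightarrow> (\<forall>i\<in>{1..p}. Q i) \<and> (\<forall>i\<in>{1..q}. Q (p + i))" for Q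
    proof (intro iffI conjI ballI)
      fix i assume Q: "(\<forall>i\<in>{1..p}. Q i) \<and> (\<forall>i\<in>{1..q}. Q (p + i))" and i: "i \<in> {1..p + q}"
      show "Q i"
      proof (cases "i \<le> p")
        case False
        with i have "i - p \<in> {1..q}" "p + (i - p) = i" by auto
        with Q show ?thesis by metis
      qed (use Q i in auto)
    qed auto
    have "m \<cdot>\<^bsub>nil_cat n\<^esub> ?In1 = f \<longleftrightarrow> (\<forall>i\<in>{1..p}. m \<cdot>\<^bsub>nil_cat n\<^esub> nil_in n (p + q) i
        = f \<cdot>\<^bsub>nil_cat n\<^esub> nil_in n p i)"
      using 1 nil_Hom_in_eqI[OF Comp_Hom[OF In(1) m] f] by metis
    moreover have "m \<cdot>\<^bsub>nil_cat n\<^esub> ?In2 = g \<longleftrightarrow> (\<forall>i\<in>{1..q}. m \<cdot>\<^bsub>nil_cat n\<^esub> nil_in n (p + q) (p + i)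
        = g \<cdot>\<^bsub>nil_cat n\<^esub> nil_in n q i)"
      using 2 nil_Hom_in_eqI[OF Comp_Hom[OF In(2) m] g] by metis
    ultimately show ?thesis using m unfolding split by simp
  qed simp
  let ?w = "\<lambda>i. if i \<le> p then f \<cdot>\<^bsub>nil_cat n\<^esub> nil_in n p i else g \<cdot>\<^bsub>nil_cat n\<^esub> nil_in n q (i - p)"
  have w: "?w i \<in> Hom (nil_cat n) 1 r" if "i \<in> {1..p + q}" for i
    using that f g by (auto intro!: Comp_Hom nil_in_Hom)
  have "\<exists>m. ?P m" unfolding iff
    using nil_Hom_in_exists[of "p + q" ?w n r] w by blast
  then obtain m where m: "?P m" by blast
  have uniq: "m' = m" if "?P m'" for m'
    using that m unfolding iff by (intro nil_Hom_in_eqI[of m' n "p + q" r m]) simp_all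
  have eq: "copair (nil_cat n) f g = (THE m. ?P m)"
    using f g by (simp add: copair_def nil_cat_simps Hom_def)
  have c: "copair (nil_cat n) f g = m" unfolding eq by (rule the_equality[of ?P, OF m uniq])
  show "copair (nil_cat n) f g \<in> Hom (nil_cat n) (p + q) r"
    "copair (nil_cat n) f g \<cdot>\<^bsub>nil_cat n\<^esub> ?In1 = f" "copair (nil_cat n) f g \<cdot>\<^bsub>nil_cat n\<^esub> ?In2 = g"
    unfolding c using m by blast+
  show "copair (nil_cat n) f g = m'" if "m' \<in> Hom (nil_cat n) (p + q) r"
    "m' \<cdot>\<^bsub>nil_cat n\<^esub> ?In1 = f" "m' \<cdot>\<^bsub>nil_cat n\<^esub> ?In2 = g" for m'
    unfolding c using uniq[of m'] that by blast
qed

lemma nil_In_Hom: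
  "In1 (nil_cat n) p q \<in> Hom (nil_cat n) p (p + q)" "In2 (nil_cat n) p q
      \<in> Hom (nil_cat n) q (p + q)"
  by (simp_all add: nil_cat_simps nil_shift_Hom)

lemma nil_in_Suc:
  "i \<in> {1..q} \<Longrightarrow> nil_in n (q + 1) i = In1 (nil_cat n) q 1 \<cdot>\<^bsub>nil_cat n\<^esub> nil_in n q i"
  "nil_in n (q + 1) (q + 1) = In2 (nil_cat n) q 1"
proof -
  interpret category "nil_cat n" by (rule category_nil_cat)
  show "i \<in> {1..q} \<Longrightarrow> nil_in n (q + 1) i = In1 (nil_cat n) q 1 \<cdot>\<^bsub>nil_cat n\<^esub> nil_in n q i"
    by (simp add: In1_nil_in)
  have "In2 (nil_cat n) q 1 \<cdot>\<^bsub>nil_cat n\<^esub> nil_in n 1 1 = nil_in n (q + 1) (q + 1)"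
    by (rule In2_nil_in) simp
  then show "nil_in n (q + 1) (q + 1) = In2 (nil_cat n) q 1"
    by (simp add: nil_in_1 Ident_right[OF nil_In_Hom(2)])
qed

locale nil_pseudofunctor = cop_pseudofunctor "nil_cat n" A \<phi> + strict_track_category A
  for n :: enat
    and A :: "('p, 'b, 't, 'm) trackcat_scheme" (structure)
    and \<phi> :: "(nat, nil_arrow, 'p, 'b, 't) psfunctor"
begin

section \<open>Triviality of comparison tracks at coproduct inclusions\<close>

abbreviation "e q i \<equiv> PArr \<phi> (nil_in n q i)"

lemma PObj [simp, intro]: "PObj \<phi> p \<in> Obj A"
  by (simp add: PObj_Obj nil_cat_simps)

lemma e_Hom: "i \<in> {1..q} \<Longrightarrow> e q i \<in> Hom A (PObj \<phi> 1) (PObj \<phi> q)"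
  by (intro PArr_Hom nil_in_Hom)

lemma PComp_Ident:
  assumes "f \<in> Hom (nil_cat n) p q"
  shows "PComp \<phi> f (Ident (nil_cat n) p) = VId A (PArr \<phi> f)"
    "PComp \<phi> (Ident (nil_cat n) q) f = VId A (PArr \<phi> f)"
proof -
  note f = PArr_Hom[OF assms]
  have I: "Ident A (PObj \<phi> p) \<in> Hom A (PObj \<phi> p) (PObj \<phi> p)" for p by (simp add: A.Ident_Hom)
  show "PComp \<phi> f (Ident (nil_cat n) p) = VId A (PArr \<phi> f)"
    using PComp_Ident_right[OF assms] A.post_VId[OF I f] A.Ident_right[OF f]
    by (simp add: PUnit_trivial nil_cat_simps(1))
  show "PComp \<phi> (Ident (nil_cat n) q) f = VId A (PArr \<phi> f)"
    using PComp_Ident_left[OF assms] A.pre_VId[OF f I] A.Ident_left[OF f]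
    by (simp add: PUnit_trivial nil_cat_simps(1))
qed

abbreviation \<iota> where "\<iota> p q \<equiv> cop_comparison (nil_cat n) A \<phi> p q"

lemma cop_comparison_Hom: "\<iota> p q \<in> Hom A (Cop A (PObj \<phi> p) (PObj \<phi> q)) (PObj \<phi> (p + q))"
  and cop_comparison_In1: "\<iota> p q \<cdot> In1 A (PObj \<phi> p) (PObj \<phi> q) = PArr \<phi> (In1 (nil_cat n) p q)"
  and cop_comparison_In2: "\<iota> p q \<cdot> In2 A (PObj \<phi> p) (PObj \<phi> q) = PArr \<phi> (In2 (nil_cat n) p q)"
  unfolding cop_comparison_def
  using copair[OF PArr_Hom[OF nil_In_Hom(1)] PArr_Hom[OF nil_In_Hom(2)], of p q] by auto

text \<open>Coproduct preservation is applied to the copair of the two inclusions, which is the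
  identity. The comparison track of \<open>g\<close> and an identity is trivial, and its components
  are the comparison tracks of \<open>g\<close> with the inclusions.\<close>

lemma PComp_In:
  assumes g: "g \<in> Hom (nil_cat n) (p + q) r"
  shows "PComp \<phi> g (In1 (nil_cat n) p q) = VId A (PArr \<phi> g \<cdot> PArr \<phi> (In1 (nil_cat n) p q))"
    and "PComp \<phi> g (In2 (nil_cat n) p q) = VId A (PArr \<phi> g \<cdot> PArr \<phi> (In2 (nil_cat n) p q))"
proof -
  let ?In1 = "In1 (nil_cat n) p q" and ?In2 = "In2 (nil_cat n) p q"
  let ?J1 = "In1 A (PObj \<phi> p) (PObj \<phi> q)" and ?J2 = "In2 A (PObj \<phi> p) (PObj \<phi> q)"
  have "copair (nil_cat n) ?In1 ?In2 = Ident (nil_cat n) (p + q)"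
    using nil_In_Hom[of n p q]
    by (intro nil_copair_eqI) (auto simp: C.Ident_left C.Ident_Hom nil_cat_simps(1))
  then have eq: "pre A (\<iota> p q) (VId A (PArr \<phi> g)) = tcopair A (PComp \<phi> g ?In1) (PComp \<phi> g ?In2)"
    using PComp_copair[OF nil_In_Hom[of n p q] g] PComp_Ident(1)[OF g] by simp
  have T: "PComp \<phi> g ?In1 \<in> HTrack A (PObj \<phi> p) (PObj \<phi> r)"
    "PComp \<phi> g ?In2 \<in> HTrack A (PObj \<phi> q) (PObj \<phi> r)"
    using g nil_In_Hom by (meson A.HTrackI PComp_Track A.Comp_Hom PArr_Hom)+
  have J: "?J1 \<in> Hom A (PObj \<phi> p) (Cop A (PObj \<phi> p) (PObj \<phi> q))"
    "?J2 \<in> Hom A (PObj \<phi> q) (Cop A (PObj \<phi> p) (PObj \<phi> q))"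
    by (simp_all add: In1_Hom In2_Hom)
  note V = A.VId_HTrack[OF PArr_Hom[OF g]]
  show "PComp \<phi> g ?In1 = VId A (PArr \<phi> g \<cdot> PArr \<phi> ?In1)"
    using tcopair_In1[OF T] A.pre_pre[OF V cop_comparison_Hom J(1)] cop_comparison_In1
      A.pre_VId[OF PArr_Hom[OF nil_In_Hom(1)] PArr_Hom[OF g]] by (simp add: eq)
  show "PComp \<phi> g ?In2 = VId A (PArr \<phi> g \<cdot> PArr \<phi> ?In2)"
    using tcopair_In2[OF T] A.pre_pre[OF V cop_comparison_Hom J(2)] cop_comparison_In2
      A.pre_VId[OF PArr_Hom[OF nil_In_Hom(2)] PArr_Hom[OF g]] by (simp add: eq)
qed

text \<open>An identity track has equal source and target, so a trivial comparison track makes the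
  pseudofunctor strict on that composite.\<close>

lemma PArr_Comp:
  assumes f: "f \<in> Hom (nil_cat n) p q" and g: "g \<in> Hom (nil_cat n) q r"
    and "PComp \<phi> g f = VId A (PArr \<phi> g \<cdot> PArr \<phi> f)"
  shows "PArr \<phi> (g \<cdot>\<^bsub>nil_cat n\<^esub> f) = PArr \<phi> g \<cdot> PArr \<phi> f"
  using PComp_Track[OF f g] A.VId_Hom[OF A.Comp_Hom[OF PArr_Hom[OF f] PArr_Hom[OF g]]] assms(3)
  by (auto simp: Track_def)

text \<open>The last inclusion is \<open>In2\<close>; any other factors through \<open>In1\<close>,
  and in the coherence law for \<open>g\<close>, \<open>In1\<close> and \<open>nil_in n q i\<close>
  the three remaining tracks are trivial. The induction varies \<open>g\<close>, because the
  hypothesis is used both for \<open>In1\<close> and for the composite of \<open>g\<close> and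
  \<open>In1\<close>.\<close>

lemma PComp_nil_in:
  "\<lbrakk>i \<in> {1..q}; g \<in> Hom (nil_cat n) q r\<rbrakk> \<Longrightarrow> PComp \<phi> g (nil_in n q i) = VId A (PArr \<phi> g \<cdot> e q i)"
proof (induction q arbitrary: g i r)
  case (Suc q)
  let ?In1 = "In1 (nil_cat n) q 1"
  have g: "g \<in> Hom (nil_cat n) (q + 1) r" using Suc.prems by simp
  show ?case
  proof (cases "i = q + 1")
    case True
    then show ?thesis using PComp_In(2)[OF g] nil_in_Suc(2)[of n q] by simp
  next
    case False
    then have i: "i \<in> {1..q}" using Suc.prems by auto
    note In = nil_In_Hom(1)[of n q 1]
    have e: "nil_in n (q + 1) i = ?In1 \<cdot>\<^bsub>nil_cat n\<^esub> nil_in n q i" by (rule nil_in_Suc(1)[OF i])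
    have 1: "PArr \<phi> (g \<cdot>\<^bsub>nil_cat n\<^esub> ?In1) = PArr \<phi> g \<cdot> PArr \<phi> ?In1"
      by (rule PArr_Comp[OF In g PComp_In(1)[OF g]])
    have 2: "PArr \<phi> (?In1 \<cdot>\<^bsub>nil_cat n\<^esub> nil_in n q i) = PArr \<phi> ?In1 \<cdot> e q i"
      by (rule PArr_Comp[OF nil_in_Hom[OF i] In Suc.IH[OF i In]])
    note H = PArr_Hom[OF nil_in_Hom[OF i, of n]] PArr_Hom[OF In] PArr_Hom[OF g]
    have ee: "PArr \<phi> g \<cdot> PArr \<phi> ?In1 \<cdot> e q i = PArr \<phi> g \<cdot> (PArr \<phi> ?In1 \<cdot> e q i)"
      by (rule A.Comp_assoc[OF H])
    note HH = A.Comp_Hom[OF A.Comp_Hom[OF H(1,2)] H(3)]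
    have T: "PComp \<phi> g (nil_in n (q + 1) i) \<in> Track A (PArr \<phi> g \<cdot> e (q + 1) i)
        (PArr \<phi> (g \<cdot>\<^bsub>nil_cat n\<^esub> nil_in n (q + 1) i))"
      using PComp_Track[OF nil_in_Hom[OF Suc.prems(1)] Suc.prems(2)] by simp
    show ?thesis
      using PComp_assoc[OF nil_in_Hom[OF i] In g] Suc.IH[OF i In]
        Suc.IH[OF i C.Comp_Hom[OF In g]] PComp_In(1)[OF g]
        A.post_VId[OF A.Comp_Hom[OF H(1,2)] H(3)] A.pre_VId[OF H(1) A.Comp_Hom[OF H(2,3)]]
        A.VId_right[OF T] A.VId_left[OF A.VId_Hom[OF HH]]
      by (simp add: 1 2 e ee)
  qed
qed simp

lemma PArr_Comp_nil_in:
  "\<lbrakk>i \<in> {1..q}; g \<in> Hom (nil_cat n) q r\<rbrakk> \<Longrightarrow> PArr \<phi> (g \<cdot>\<^bsub>nil_cat n\<^esub> nil_in n q i) = PArr \<phi> g \<cdot> e q i"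
  by (rule PArr_Comp[OF nil_in_Hom _ PComp_nil_in])

lemma e_Suc:
  "i \<in> {1..q} \<Longrightarrow> e (q + 1) i = PArr \<phi> (In1 (nil_cat n) q 1) \<cdot> e q i"
  "e (q + 1) (q + 1) = PArr \<phi> (In2 (nil_cat n) q 1)"
  using nil_In_Hom[of n q 1] by (simp_all add: nil_in_Suc PArr_Comp_nil_in)

text \<open>The strict coproduct property of \<open>A\<close> is carried along the isomorphisms
  \<open>\<iota> q 1\<close>, one summand at a time, starting from the strict zero object. With
  \<open>copower_HTrack_exists\<close> it makes \<phi>(q) a strict \<open>q\<close>-fold coproduct
  of \<phi>(1).\<close>

lemma copower_HTrack_eqI:
  "\<lbrakk>\<eta> \<in> HTrack A (PObj \<phi> q) Z; \<eta>' \<in> HTrack A (PObj \<phi> q) Z;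
    \<And>i. i \<in> {1..q} \<Longrightarrow> pre A (e q i) \<eta> = pre A (e q i) \<eta>'\<rbrakk> \<Longrightarrow> \<eta> = \<eta>'"
proof (induction q arbitrary: \<eta> \<eta>')
  case 0
  then show ?case using PObj_Zero zero_HTrack_eqI by (simp add: nil_cat_simps)
next
  case (Suc q)
  let ?In1 = "In1 (nil_cat n) q 1" and ?In2 = "In2 (nil_cat n) q 1"
  let ?J1 = "In1 A (PObj \<phi> q) (PObj \<phi> 1)" and ?J2 = "In2 A (PObj \<phi> q) (PObj \<phi> 1)"
  note In = PArr_Hom[OF nil_In_Hom(1)[of n q 1]] PArr_Hom[OF nil_In_Hom(2)[of n q 1]]
  have J: "?J1 \<in> Hom A (PObj \<phi> q) (Cop A (PObj \<phi> q) (PObj \<phi> 1))"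
    "?J2 \<in> Hom A (PObj \<phi> 1) (Cop A (PObj \<phi> q) (PObj \<phi> 1))"
    by (simp_all add: In1_Hom In2_Hom)
  have T: "\<eta> \<in> HTrack A (PObj \<phi> (q + 1)) Z" "\<eta>' \<in> HTrack A (PObj \<phi> (q + 1)) Z"
    using Suc.prems by simp_all
  have 1: "pre A (PArr \<phi> ?In1) \<eta> = pre A (PArr \<phi> ?In1) \<eta>'"
  proof (rule Suc.IH)
    fix i assume i: "i \<in> {1..q}"
    then have "pre A (e (q + 1) i) \<eta> = pre A (e (q + 1) i) \<eta>'" using Suc.prems(3)[of i] by simp
    then show "pre A (e q i) (pre A (PArr \<phi> ?In1) \<eta>) = pre A (e q i) (pre A (PArr \<phi> ?In1) \<eta>')"
      using A.pre_pre[OF T(1) In(1) e_Hom[OF i]] A.pre_pre[OF T(2) In(1) e_Hom[OF i]]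
          e_Suc(1)[OF i] by simp
  qed (use T In(1) A.pre_HTrack in auto)
  have 2: "pre A (PArr \<phi> ?In2) \<eta> = pre A (PArr \<phi> ?In2) \<eta>'"
    using Suc.prems(3)[of "q + 1"] e_Suc(2)[of q] by simp
  have 3: "pre A (\<iota> q 1) \<eta> = pre A (\<iota> q 1) \<eta>'"
    using A.pre_pre[OF T(1) cop_comparison_Hom J(1)] A.pre_pre[OF T(1) cop_comparison_Hom J(2)]
      A.pre_pre[OF T(2) cop_comparison_Hom J(1)] A.pre_pre[OF T(2) cop_comparison_Hom J(2)] 1 2
    by (intro Cop_HTrack_eqI[OF A.pre_HTrack[OF T(1) cop_comparison_Hom]
        A.pre_HTrack[OF T(2) cop_comparison_Hom]])
      (simp_all add: cop_comparison_In1 cop_comparison_In2)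
  \<comment> \<open>Uniqueness needs \<open>w\<close> as a right inverse of
    \<open>\<iota> q 1\<close>; existence, in \<open>copower_HTrack_exists\<close>, needs a left
    inverse.\<close>
  obtain w where w: "w \<in> Hom A (PObj \<phi> (q + 1)) (Cop A (PObj \<phi> q) (PObj \<phi> 1))"
    "\<iota> q 1 \<cdot> w = Ident A (PObj \<phi> (q + 1))"
    using cop_comparison_iso[of q 1] cop_comparison_Hom[of q 1]
    by (auto simp: iso_arrow_def nil_cat_simps(1) A.Arr_Hom)
  have "pre A w (pre A (\<iota> q 1) \<theta>) = \<theta>" if "\<theta> \<in> HTrack A (PObj \<phi> (q + 1)) Z" for \<theta>
    using A.pre_pre[OF that cop_comparison_Hom w(1)] A.pre_Ident[OF that] w(2) by simp
  with T 3 show ?case by metis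
qed

lemma copower_HTrack_exists:
  assumes "Z \<in> Obj A" "\<And>i. i \<in> {1..q} \<Longrightarrow> t i \<in> HTrack A (PObj \<phi> 1) Z"
  shows "\<exists>\<eta> \<in> HTrack A (PObj \<phi> q) Z. \<forall>i \<in> {1..q}. pre A (e q i) \<eta> = t i"
  using assms(2)
proof (induction q)
  case 0
  then show ?case using PObj_Zero zero assms(1) by (auto simp: nil_cat_simps strict_zero_def)
next
  case (Suc q)
  let ?In1 = "In1 (nil_cat n) q 1" and ?In2 = "In2 (nil_cat n) q 1"
  let ?J1 = "In1 A (PObj \<phi> q) (PObj \<phi> 1)" and ?J2 = "In2 A (PObj \<phi> q) (PObj \<phi> 1)"
  note In = PArr_Hom[OF nil_In_Hom(1)[of n q 1]] PArr_Hom[OF nil_In_Hom(2)[of n q 1]]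
  have J: "?J1 \<in> Hom A (PObj \<phi> q) (Cop A (PObj \<phi> q) (PObj \<phi> 1))"
    "?J2 \<in> Hom A (PObj \<phi> 1) (Cop A (PObj \<phi> q) (PObj \<phi> 1))"
    by (simp_all add: In1_Hom In2_Hom)
  obtain \<eta> where \<eta>: "\<eta> \<in> HTrack A (PObj \<phi> q) Z" "\<And>i. i \<in> {1..q} \<Longrightarrow> pre A (e q i) \<eta> = t i"
    using Suc by fastforce
  have t: "t (q + 1) \<in> HTrack A (PObj \<phi> 1) Z" using Suc.prems by simp
  let ?\<theta> = "tcopair A \<eta> (t (q + 1))"
  note \<theta> = tcopair[OF \<eta>(1) t]
  obtain w where w: "w \<in> Hom A (PObj \<phi> (q + 1)) (Cop A (PObj \<phi> q) (PObj \<phi> 1))"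
    "w \<cdot> \<iota> q 1 = Ident A (Cop A (PObj \<phi> q) (PObj \<phi> 1))"
    using cop_comparison_iso[of q 1] cop_comparison_Hom[of q 1]
    by (auto simp: iso_arrow_def nil_cat_simps(1) A.Arr_Hom)
  have T: "pre A w ?\<theta> \<in> HTrack A (PObj \<phi> (q + 1)) Z" using \<theta>(1) w(1) A.pre_HTrack by blast
  have w\<iota>: "pre A (\<iota> q 1) (pre A w ?\<theta>) = ?\<theta>"
    using A.pre_pre[OF \<theta>(1) w(1) cop_comparison_Hom] w(2) A.pre_Ident[OF \<theta>(1)] by simp
  have 1: "pre A (PArr \<phi> ?In1) (pre A w ?\<theta>) = \<eta>" "pre A (PArr \<phi> ?In2) (pre A w ?\<theta>) = t (q + 1)"
    using A.pre_pre[OF T cop_comparison_Hom J(1)] A.pre_pre[OF T cop_comparison_Hom J(2)] w\<iota> \<theta>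
    by (simp_all add: cop_comparison_In1 cop_comparison_In2)
  have "pre A (e (q + 1) i) (pre A w ?\<theta>) = t i" if i: "i \<in> {1..q + 1}" for i
  proof (cases "i = q + 1")
    case True
    then show ?thesis using 1(2) e_Suc(2) by simp
  next
    case False
    then have i: "i \<in> {1..q}" using i by auto
    show ?thesis
      using A.pre_pre[OF T In(1) e_Hom[OF i]] e_Suc(1)[OF i] 1(1) \<eta>(2)[OF i] by simp
  qed
  with T show ?case by (intro bexI[of _ "pre A w ?\<theta>"]) auto
qed

text \<open>Maps are identity tracks, so the statement for tracks covers them.\<close>

lemma copower_Hom_eqI:
  assumes "f \<in> Hom A (PObj \<phi> q) Z" "f' \<in> Hom A (PObj \<phi> q) Z"
    and "\<And>i. i \<in> {1..q} \<Longrightarrow> f \<cdot> e q i = f' \<cdot> e q i"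
  shows "f = f'"
proof -
  have "pre A (e q i) (VId A f) = pre A (e q i) (VId A f')" if "i \<in> {1..q}" for i
    using A.pre_VId[OF e_Hom[OF that] assms(1)] A.pre_VId[OF e_Hom[OF that] assms(2)]
        assms(3)[OF that]
    by simp
  then have "VId A f = VId A f'"
    by (rule copower_HTrack_eqI[OF A.VId_HTrack[OF assms(1)] A.VId_HTrack[OF assms(2)]])
  then show ?thesis using A.VId_inject assms by blast
qed

text \<open>The identity tracks of the given maps are glued; the source of the resulting track has
  the required components.\<close>

lemma copower_Hom_exists:
  assumes "Z \<in> Obj A" "\<And>i. i \<in> {1..q} \<Longrightarrow> m i \<in> Hom A (PObj \<phi> 1) Z"
  shows "\<exists>f \<in> Hom A (PObj \<phi> q) Z. \<forall>i \<in> {1..q}. f \<cdot> e q i = m i"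
proof -
  obtain \<eta> where \<eta>: "\<eta> \<in> HTrack A (PObj \<phi> q) Z" "\<And>i. i \<in> {1..q} \<Longrightarrow> pre A (e q i) \<eta> = VId A (m i)"
    using copower_HTrack_exists[OF assms(1), of q "\<lambda>i. VId A (m i)"] assms(2) A.VId_HTrack by blast
  have "Src A \<eta> \<cdot> e q i = m i" if "i \<in> {1..q}" for i
    using A.pre_Track[OF A.HTrack_Src_Tgt(3)[OF \<eta>(1)] A.HTrack_Src_Tgt(1)[OF \<eta>(1)] e_Hom[OF that]]
      \<eta>(2)[OF that] A.VId_Hom[OF assms(2)[OF that]] A.Track_unique by simp
  with A.HTrack_Src_Tgt(1)[OF \<eta>(1)] show ?thesis by blast
qed

end

section \<open>The category of lifts\<close>

locale lifting = strict_track_category A + \<phi>: nil_pseudofunctor n A \<phi> + \<psi>: nil_pseudofunctor n A \<psi>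
  for n :: enat
    and A :: "('p, 'b, 't, 'm) trackcat_scheme" (structure)
    and \<phi> :: "(nat, nil_arrow, 'p, 'b, 't) psfunctor"
    and \<psi> :: "(nat, nil_arrow, 'p, 'b, 't) psfunctor" +
  fixes f :: 'b
  assumes f: "f \<in> Hom A (PObj \<phi> 1) (PObj \<psi> 1)"
begin

section \<open>The maps induced by \<open>f\<close> on summands, and composition of lifts\<close>

abbreviation N where "N \<equiv> nil_cat n"

abbreviation F where "F \<equiv> PArr \<phi>"

abbreviation G where "G \<equiv> PArr \<psi>"

text \<open>These components are forced: \<open>TObj_\<alpha>\<close> finds them in every coproduct
  preserving transformation with component \<open>f\<close> at \<open>1\<close>. By
  \<open>a_eqI\<close> the choice is unique.\<close>

definition a :: "nat \<Rightarrow> 'b" where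
  "a p = (SOME m. m \<in> Hom A (PObj \<phi> p) (PObj \<psi> p) \<and>
     (\<forall>i \<in> {1..p}. m \<cdot> \<phi>.e p i = \<psi>.e p i \<cdot> f))"

lemma a_Hom: "a p \<in> Hom A (PObj \<phi> p) (PObj \<psi> p)"
  and a_e: "i \<in> {1..p} \<Longrightarrow> a p \<cdot> \<phi>.e p i = \<psi>.e p i \<cdot> f"
proof -
  have "\<exists>m. m \<in> Hom A (PObj \<phi> p) (PObj \<psi> p) \<and> (\<forall>i \<in> {1..p}. m \<cdot> \<phi>.e p i = \<psi>.e p i \<cdot> f)"
    using \<phi>.copower_Hom_exists[of "PObj \<psi> p" p "\<lambda>i. \<psi>.e p i \<cdot> f"] Comp_Hom[OF f \<psi>.e_Hom] by blast
  from someI_ex[OF this] show "a p \<in> Hom A (PObj \<phi> p) (PObj \<psi> p)"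
    "i \<in> {1..p} \<Longrightarrow> a p \<cdot> \<phi>.e p i = \<psi>.e p i \<cdot> f"
    unfolding a_def by blast+
qed

lemma a_eqI:
  assumes "m \<in> Hom A (PObj \<phi> p) (PObj \<psi> p)" "\<And>i. i \<in> {1..p} \<Longrightarrow> m \<cdot> \<phi>.e p i = \<psi>.e p i \<cdot> f"
  shows "m = a p"
  by (rule \<phi>.copower_Hom_eqI[OF assms(1) a_Hom]) (simp only: assms(2) a_e)

lemma a_1: "a 1 = f"
proof -
  have "\<phi>.e 1 1 = Ident A (PObj \<phi> 1)" "\<psi>.e 1 1 = Ident A (PObj \<psi> 1)"
    by (simp_all add: nil_in_1 \<phi>.PArr_Ident \<psi>.PArr_Ident nil_cat_simps(1))
  then have "f = a 1" using Ident_left[OF f] Ident_right[OF f] by (intro a_eqI[OF f]) auto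
  then show ?thesis ..
qed

lemma a_In:
  "a (p + q) \<cdot> F (In1 N p q) = G (In1 N p q) \<cdot> a p"
  "a (p + q) \<cdot> F (In2 N p q) = G (In2 N p q) \<cdot> a q"
proof -
  have In: "In1 N p q \<in> Hom N p (p + q)" "In2 N p q \<in> Hom N q (p + q)" by (rule nil_In_Hom)+
  note \<phi>In = In[THEN \<phi>.PArr_Hom] and \<psi>In = In[THEN \<psi>.PArr_Hom]
  \<comment> \<open>Both inclusions are handled at once: the argument only needs an arrow
    \<open>j\<close> that sends each inclusion of \<open>1\<close> to another one, with index
    \<open>d i\<close>. On such composites both pseudofunctors are strict.\<close>
  have *: "a r \<cdot> F j = G j \<cdot> a s"
    if j: "j \<in> Hom N s r" "\<And>i. i \<in> {1..s} \<Longrightarrow> d i \<in> {1..r}"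
      "\<And>i. i \<in> {1..s} \<Longrightarrow> j \<cdot>\<^bsub>N\<^esub> nil_in n s i = nil_in n r (d i)" for j r s d
  proof (rule \<phi>.copower_Hom_eqI)
    note Hj = \<phi>.PArr_Hom[OF j(1)] \<psi>.PArr_Hom[OF j(1)]
    show "a r \<cdot> F j \<in> Hom A (PObj \<phi> s) (PObj \<psi> r)" "G j \<cdot> a s \<in> Hom A (PObj \<phi> s) (PObj \<psi> r)"
      using Hj a_Hom Comp_Hom by blast+
    fix i assume i: "i \<in> {1..s}"
    have "a r \<cdot> F j \<cdot> \<phi>.e s i = a r \<cdot> \<phi>.e r (d i)"
      using Comp_assoc[OF \<phi>.e_Hom[OF i] Hj(1) a_Hom] \<phi>.PArr_Comp_nil_in[OF i j(1)] j(3)[OF i]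
          by simp
    also have "\<dots> = \<psi>.e r (d i) \<cdot> f" by (rule a_e[OF j(2)[OF i]])
    also have "\<dots> = G j \<cdot> (\<psi>.e s i \<cdot> f)"
      using Comp_assoc[OF f \<psi>.e_Hom[OF i] Hj(2)] \<psi>.PArr_Comp_nil_in[OF i j(1)] j(3)[OF i] by simp
    also have "\<dots> = G j \<cdot> a s \<cdot> \<phi>.e s i"
      using Comp_assoc[OF \<phi>.e_Hom[OF i] a_Hom Hj(2)] a_e[OF i] by simp
    finally show "a r \<cdot> F j \<cdot> \<phi>.e s i = G j \<cdot> a s \<cdot> \<phi>.e s i" .
  qed
  show "a (p + q) \<cdot> F (In1 N p q) = G (In1 N p q) \<cdot> a p"
    by (rule *[OF In(1), of "\<lambda>i. i"]) (auto simp: In1_nil_in)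
  show "a (p + q) \<cdot> F (In2 N p q) = G (In2 N p q) \<cdot> a q"
    by (rule *[OF In(2), of "\<lambda>i. p + i"]) (auto simp: In2_nil_in)
qed

text \<open>The composition axiom of a pseudo natural transformation, solved for the track at the
  composite arrow. The axiom for \<alpha> thus says that pairing each arrow with its track is
  compatible with composition of lifts.\<close>

definition lift_comp :: "nil_arrow \<Rightarrow> 't \<Rightarrow> nil_arrow \<Rightarrow> 't \<Rightarrow> 't" where
  "lift_comp g t h s = pre A (a (Dom N h)) (PComp \<psi> g h) \<box>
     (post A (G g) s \<box> pre A (F h) t) \<box> vinv (post A (a (Cod N g)) (PComp \<phi> g h))"

definition lifts :: "(nat, nil_arrow \<times> 't) cat" where
  "lifts = \<lparr>Obj = UNIV,
     Arr = {(g, t). g \<in> Arr N \<and> t \<in> Track A (a (Cod N g) \<cdot> F g) (G g \<cdot> a (Dom N g))},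
     Dom = Dom N \<circ> fst, Cod = Cod N \<circ> fst,
     Ident = (\<lambda>p. (Ident N p, VId A (a p))),
     Comp = (\<lambda>(g, t) (h, s). (g \<cdot>\<^bsub>N\<^esub> h, lift_comp g t h s))\<rparr>"

lemma lifts_simps [simp]:
  "Obj lifts = UNIV" "Ident lifts p = (Ident N p, VId A (a p))"
  "(g, t) \<cdot>\<^bsub>lifts\<^esub> (h, s) = (g \<cdot>\<^bsub>N\<^esub> h, lift_comp g t h s)"
  "fst (u \<cdot>\<^bsub>lifts\<^esub> v) = fst u \<cdot>\<^bsub>N\<^esub> fst v"
  by (auto simp: lifts_def split: prod.splits)

lemma lifts_Hom_iff:
  "(g, t) \<in> Hom lifts p q \<longleftrightarrow> g \<in> Hom N p q \<and> t \<in> Track A (a q \<cdot> F g) (G g \<cdot> a p)"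
  by (auto simp: Hom_def lifts_def)

lemma lifts_Hom_fst: "u \<in> Hom lifts p q \<Longrightarrow> fst u \<in> Hom N p q"
  by (cases u) (simp add: lifts_Hom_iff)

lemma lift_comp:
  assumes h: "h \<in> Hom N p q" and g: "g \<in> Hom N q r"
    and s: "s \<in> Track A (a q \<cdot> F h) (G h \<cdot> a p)"
    and t: "t \<in> Track A (a r \<cdot> F g) (G g \<cdot> a q)"
  shows lift_comp_Track: "lift_comp g t h s \<in>
      Track A (a r \<cdot> F (g \<cdot>\<^bsub>N\<^esub> h)) (G (g \<cdot>\<^bsub>N\<^esub> h) \<cdot> a p)"
    and lift_comp_eq: "lift_comp g t h s \<box> post A (a r) (PComp \<phi> g h) =
      pre A (a p) (PComp \<psi> g h) \<box> (post A (G g) s \<box> pre A (F h) t)"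
    and lift_comp_pieces: "post A (a r) (PComp \<phi> g h) \<in>
        Track A (a r \<cdot> (F g \<cdot> F h)) (a r \<cdot> F (g \<cdot>\<^bsub>N\<^esub> h))"
      "pre A (a p) (PComp \<psi> g h) \<in>
        Track A (G g \<cdot> (G h \<cdot> a p)) (G (g \<cdot>\<^bsub>N\<^esub> h) \<cdot> a p)"
      "post A (G g) s \<in>
        Track A (G g \<cdot> (a q \<cdot> F h)) (G g \<cdot> (G h \<cdot> a p))"
      "pre A (F h) t \<in>
        Track A (a r \<cdot> (F g \<cdot> F h)) (G g \<cdot> (a q \<cdot> F h))"
proof -
  note H = \<phi>.PArr_Hom[OF h] \<phi>.PArr_Hom[OF g] \<psi>.PArr_Hom[OF h] \<psi>.PArr_Hom[OF g]
  show 1: "post A (a r) (PComp \<phi> g h) \<in>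
        Track A (a r \<cdot> (F g \<cdot> F h)) (a r \<cdot> F (g \<cdot>\<^bsub>N\<^esub> h))"
    by (rule post_Track[OF \<phi>.PComp_Track[OF h g] Comp_Hom[OF H(1,2)] a_Hom])
  show 2: "pre A (a p) (PComp \<psi> g h) \<in>
        Track A (G g \<cdot> (G h \<cdot> a p)) (G (g \<cdot>\<^bsub>N\<^esub> h) \<cdot> a p)"
    using pre_Track[OF \<psi>.PComp_Track[OF h g] Comp_Hom[OF H(3,4)] a_Hom] Comp_assoc[OF a_Hom H(3,4)]
    by simp
  show 3: "post A (G g) s \<in>
        Track A (G g \<cdot> (a q \<cdot> F h)) (G g \<cdot> (G h \<cdot> a p))"
    by (rule post_Track[OF s Comp_Hom[OF H(1) a_Hom] H(4)])
  show 4: "pre A (F h) t \<in>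
        Track A (a r \<cdot> (F g \<cdot> F h)) (G g \<cdot> (a q \<cdot> F h))"
    using pre_Track[OF t Comp_Hom[OF H(2) a_Hom] H(1)] Comp_assoc[OF H(1,2) a_Hom]
      Comp_assoc[OF H(1) a_Hom H(4)] by simp
  note 5 = VComp_Track[OF VComp_Track[OF 4 3] 2]
  have eq: "lift_comp g t h s = pre A (a p) (PComp \<psi> g h) \<box>
     (post A (G g) s \<box> pre A (F h) t) \<box> vinv (post A (a r) (PComp \<phi> g h))"
    using g h by (auto simp: lift_comp_def Hom_def)
  show "lift_comp g t h s \<in> Track A (a r \<cdot> F (g \<cdot>\<^bsub>N\<^esub> h)) (G (g \<cdot>\<^bsub>N\<^esub> h) \<cdot> a p)"
    unfolding eq by (rule VComp_Track[OF vinv_Track[OF 1] 5])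
  show "lift_comp g t h s \<box> post A (a r) (PComp \<phi> g h) =
      pre A (a p) (PComp \<psi> g h) \<box> (post A (G g) s \<box> pre A (F h) t)"
    unfolding eq by (rule VComp_vinv_cancel[OF 1 5])
qed

lemma lift_comp_eqI:
  assumes h: "h \<in> Hom N p q" and g: "g \<in> Hom N q r"
    and s: "s \<in> Track A (a q \<cdot> F h) (G h \<cdot> a p)"
    and t: "t \<in> Track A (a r \<cdot> F g) (G g \<cdot> a q)"
    and c: "c \<in> Track A (a r \<cdot> F (g \<cdot>\<^bsub>N\<^esub> h)) (G (g \<cdot>\<^bsub>N\<^esub> h) \<cdot> a p)"
    and eq: "c \<box> post A (a r) (PComp \<phi> g h) =
      pre A (a p) (PComp \<psi> g h) \<box> (post A (G g) s \<box> pre A (F h) t)"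
  shows "lift_comp g t h s = c"
  using lift_comp_eq[OF h g s t] eq
  by (intro VComp_right_cancel[OF lift_comp_pieces(1)[OF h g s t] lift_comp_Track[OF h g s t] c])
      simp

text \<open>Both sides are pasted from the same three squares. They are compared after composition
  with an invertible comparison track of \<phi>; the difference is absorbed by coherence of \<phi>
  (\<open>PP\<close>) and of \<psi> (\<open>QQ\<close>) and by two interchanges, of the track over
  \<open>h\<close> with the comparison of \<open>k\<close> and \<open>g\<close> (\<open>eU\<close>),
  and of the track over \<open>k\<close> with the comparison of \<open>g\<close> and
  \<open>h\<close> (\<open>eV\<close>).\<close>

lemma lift_comp_assoc:
  assumes h: "h \<in> Hom N p q" and g: "g \<in> Hom N q r" and k: "k \<in> Hom N r w"
    and th: "th \<in> Track A (a q \<cdot> F h) (G h \<cdot> a p)"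
    and tg: "tg \<in> Track A (a r \<cdot> F g) (G g \<cdot> a q)"
    and tk: "tk \<in> Track A (a w \<cdot> F k) (G k \<cdot> a r)"
  shows "lift_comp (k \<cdot>\<^bsub>N\<^esub> g) (lift_comp k tk g tg) h th
      = lift_comp k tk (g \<cdot>\<^bsub>N\<^esub> h) (lift_comp g tg h th)"
proof -
  note H = \<phi>.PArr_Hom[OF h] \<phi>.PArr_Hom[OF g] \<phi>.PArr_Hom[OF k]
    and K = \<psi>.PArr_Hom[OF h] \<psi>.PArr_Hom[OF g] \<psi>.PArr_Hom[OF k]
  have gh: "g \<cdot>\<^bsub>N\<^esub> h \<in> Hom N p r" and kg: "k \<cdot>\<^bsub>N\<^esub> g \<in> Hom N q w"
    using h g k \<phi>.C.Comp_Hom by blast+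
  have kgh: "k \<cdot>\<^bsub>N\<^esub> g \<cdot>\<^bsub>N\<^esub> h = k \<cdot>\<^bsub>N\<^esub> (g \<cdot>\<^bsub>N\<^esub> h)" by (rule \<phi>.C.Comp_assoc[OF h g k])
  define u where "u = lift_comp k tk g tg"
  define v where "v = lift_comp g tg h th"
  note u = lift_comp_Track[OF g k tg tk, folded u_def] and v
      = lift_comp_Track[OF h g th tg, folded v_def]
  define L where "L = lift_comp (k \<cdot>\<^bsub>N\<^esub> g) u h th"
  define M where "M = lift_comp k tk (g \<cdot>\<^bsub>N\<^esub> h) v"
  note L = lift_comp_Track[OF h kg th u, folded L_def, unfolded kgh]
    and M = lift_comp_Track[OF gh k v tk, folded M_def]
  \<comment> \<open>The letter \<open>P\<close> marks comparison tracks of \<phi>, \<open>Q\<close>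
    those of \<psi>, and \<open>R\<close> the given tracks over \<open>h\<close>, \<open>g\<close>,
    \<open>k\<close>. The pairs \<open>S1\<close>, \<open>S2\<close> and \<open>V1\<close>,
    \<open>V2\<close> contain the two partial composites; \<open>U\<close> and \<open>X\<close> are
    comparisons at the intermediate stages.\<close>
  define P1 where "P1 = post A (a w) (PComp \<phi> k (g \<cdot>\<^bsub>N\<^esub> h))"
  define P2 where "P2 = post A (a w) (post A (F k) (PComp \<phi> g h))"
  define P3 where "P3 = post A (a w) (PComp \<phi> (k \<cdot>\<^bsub>N\<^esub> g) h)"
  define P4 where "P4 = post A (a w) (pre A (F h) (PComp \<phi> k g))"
  define Q1 where "Q1 = pre A (a p) (PComp \<psi> k (g \<cdot>\<^bsub>N\<^esub> h))"
  define Q2 where "Q2 = pre A (a p) (post A (G k) (PComp \<psi> g h))"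
  define Q3 where "Q3 = pre A (a p) (PComp \<psi> (k \<cdot>\<^bsub>N\<^esub> g) h)"
  define Q4 where "Q4 = pre A (a p) (pre A (G h) (PComp \<psi> k g))"
  define R1 where "R1 = post A (G k) (post A (G g) th)"
  define R2 where "R2 = post A (G k) (pre A (F h) tg)"
  define R3 where "R3 = pre A (F h) (pre A (F g) tk)"
  define S1 where "S1 = post A (G (k \<cdot>\<^bsub>N\<^esub> g)) th"
  define S2 where "S2 = pre A (F h) u"
  define U where "U = pre A (F h) (pre A (a q) (PComp \<psi> k g))"
  define V1 where "V1 = post A (G k) v"
  define V2 where "V2 = pre A (F (g \<cdot>\<^bsub>N\<^esub> h)) tk"
  define X where "X = post A (G k) (post A (a r) (PComp \<phi> g h))"
  note gh_pieces = lift_comp_pieces[OF h g th tg] and kg_pieces = lift_comp_pieces[OF g k tg tk]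
    and L_pieces = lift_comp_pieces[OF h kg th u, unfolded kgh] and M_pieces
        = lift_comp_pieces[OF gh k v tk]
  note \<phi>gh = \<phi>.PComp_Track[OF h g] and \<phi>kg = \<phi>.PComp_Track[OF g k]
    and \<psi>gh = \<psi>.PComp_Track[OF h g] and \<psi>kg = \<psi>.PComp_Track[OF g k]
  note HH = Comp_Hom[OF H(1,2)] Comp_Hom[OF H(2,3)] and KK = Comp_Hom[OF K(1,2)] Comp_Hom[OF K(2,3)]
  note \<phi>H = \<phi>.PArr_Hom[OF gh] \<phi>.PArr_Hom[OF kg] and \<psi>K = \<psi>.PArr_Hom[OF gh] \<psi>.PArr_Hom[OF kg]
  have P1: "P1 \<in> Track A (a w \<cdot> (F k \<cdot> F (g \<cdot>\<^bsub>N\<^esub> h))) (a w \<cdot> F (k \<cdot>\<^bsub>N\<^esub> (g \<cdot>\<^bsub>N\<^esub> h)))"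
    unfolding P1_def by (rule M_pieces)
  have P2: "P2 \<in> Track A (a w \<cdot> (F k \<cdot> (F g \<cdot> F h))) (a w \<cdot> (F k \<cdot> F (g \<cdot>\<^bsub>N\<^esub> h)))"
    unfolding P2_def by (rule post_Track[OF post_Track[OF \<phi>gh HH(1) H(3)] Comp_Hom[OF HH(1) H(3)]
        a_Hom])
  have P3: "P3 \<in> Track A (a w \<cdot> (F (k \<cdot>\<^bsub>N\<^esub> g) \<cdot> F h)) (a w \<cdot> F (k \<cdot>\<^bsub>N\<^esub> (g \<cdot>\<^bsub>N\<^esub> h)))"
    unfolding P3_def by (rule L_pieces)
  have P4: "P4 \<in> Track A (a w \<cdot> (F k \<cdot> (F g \<cdot> F h))) (a w \<cdot> (F (k \<cdot>\<^bsub>N\<^esub> g) \<cdot> F h))"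
    unfolding P4_def
    using post_Track[OF pre_Track[OF \<phi>kg HH(2) H(1)] Comp_Hom[OF H(1) HH(2)] a_Hom]
        Comp_assoc[OF H] by simp
  have Q1: "Q1 \<in> Track A (G k \<cdot> (G (g \<cdot>\<^bsub>N\<^esub> h) \<cdot> a p)) (G (k \<cdot>\<^bsub>N\<^esub> (g \<cdot>\<^bsub>N\<^esub> h)) \<cdot> a p)"
    unfolding Q1_def by (rule M_pieces)
  have Q2: "Q2 \<in> Track A (G k \<cdot> (G g \<cdot> (G h \<cdot> a p))) (G k \<cdot> (G (g \<cdot>\<^bsub>N\<^esub> h) \<cdot> a p))"
    unfolding Q2_def
    using pre_Track[OF post_Track[OF \<psi>gh KK(1) K(3)] Comp_Hom[OF KK(1) K(3)] a_Hom]
      Comp_assoc[OF a_Hom KK(1) K(3)] Comp_assoc[OF a_Hom K(1,2)] Comp_assoc[OF a_Hom \<psi>K(1) K(3)]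
          by simp
  have Q3: "Q3 \<in> Track A (G (k \<cdot>\<^bsub>N\<^esub> g) \<cdot> (G h \<cdot> a p)) (G (k \<cdot>\<^bsub>N\<^esub> (g \<cdot>\<^bsub>N\<^esub> h)) \<cdot> a p)"
    unfolding Q3_def by (rule L_pieces)
  note ha = Comp_Hom[OF a_Hom K(1)] and ah = Comp_Hom[OF H(1) a_Hom]
  have Q4': "Q4 = pre A (G h \<cdot> a p) (PComp \<psi> k g)"
    unfolding Q4_def by (rule pre_pre[OF HTrackI[OF \<psi>kg KK(2)] K(1) a_Hom])
  have Q4: "Q4 \<in> Track A (G k \<cdot> (G g \<cdot> (G h \<cdot> a p))) (G (k \<cdot>\<^bsub>N\<^esub> g) \<cdot> (G h \<cdot> a p))"
    using pre_Track[OF \<psi>kg KK(2) ha] Comp_assoc[OF ha K(2,3)] unfolding Q4' by simp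
  have R1: "R1 \<in> Track A (G k \<cdot> (G g \<cdot> (a q \<cdot> F h))) (G k \<cdot> (G g \<cdot> (G h \<cdot> a p)))"
    unfolding R1_def by (rule post_Track[OF gh_pieces(3) Comp_Hom[OF ah K(2)] K(3)])
  have R1': "R1 = post A (G k \<cdot> G g) th"
    unfolding R1_def by (rule post_post[OF HTrackI[OF th ah] K(2,3)])
  have Hagh: "a r \<cdot> (F g \<cdot> F h) \<in> Hom A (PObj \<phi> p) (PObj \<psi> r)"
    by (rule Comp_Hom[OF HH(1) a_Hom])
  have R2: "R2 \<in> Track A (G k \<cdot> (a r \<cdot> (F g \<cdot> F h))) (G k \<cdot> (G g \<cdot> (a q \<cdot> F h)))"
    unfolding R2_def by (rule post_Track[OF gh_pieces(4) Hagh K(3)])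
  have R3': "R3 = pre A (F g \<cdot> F h) tk"
    unfolding R3_def by (rule pre_pre[OF HTrackI[OF tk Comp_Hom[OF H(3) a_Hom]] H(2,1)])
  have R3: "R3 \<in> Track A (a w \<cdot> (F k \<cdot> (F g \<cdot> F h))) (G k \<cdot> (a r \<cdot> (F g \<cdot> F h)))"
    using pre_Track[OF tk Comp_Hom[OF H(3) a_Hom] HH(1)] Comp_assoc[OF HH(1) H(3) a_Hom]
      Comp_assoc[OF HH(1) a_Hom K(3)] unfolding R3' by simp
  have S1: "S1 \<in> Track A (G (k \<cdot>\<^bsub>N\<^esub> g) \<cdot> (a q \<cdot> F h)) (G (k \<cdot>\<^bsub>N\<^esub> g) \<cdot> (G h \<cdot> a p))"
    unfolding S1_def by (rule L_pieces)
  have S2: "S2 \<in> Track A (a w \<cdot> (F (k \<cdot>\<^bsub>N\<^esub> g) \<cdot> F h)) (G (k \<cdot>\<^bsub>N\<^esub> g) \<cdot> (a q \<cdot> F h))"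
    unfolding S2_def by (rule L_pieces)
  have U': "U = pre A (a q \<cdot> F h) (PComp \<psi> k g)"
    unfolding U_def by (rule pre_pre[OF HTrackI[OF \<psi>kg KK(2)] a_Hom H(1)])
  have U: "U \<in> Track A (G k \<cdot> (G g \<cdot> (a q \<cdot> F h))) (G (k \<cdot>\<^bsub>N\<^esub> g) \<cdot> (a q \<cdot> F h))"
    using pre_Track[OF \<psi>kg KK(2) ah] Comp_assoc[OF ah K(2,3)] unfolding U' by simp
  have V1: "V1 \<in> Track A (G k \<cdot> (a r \<cdot> F (g \<cdot>\<^bsub>N\<^esub> h))) (G k \<cdot> (G (g \<cdot>\<^bsub>N\<^esub> h) \<cdot> a p))"
    unfolding V1_def by (rule M_pieces)
  have V2: "V2 \<in> Track A (a w \<cdot> (F k \<cdot> F (g \<cdot>\<^bsub>N\<^esub> h))) (G k \<cdot> (a r \<cdot> F (g \<cdot>\<^bsub>N\<^esub> h)))"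
    unfolding V2_def by (rule M_pieces)
  have X: "X \<in> Track A (G k \<cdot> (a r \<cdot> (F g \<cdot> F h))) (G k \<cdot> (a r \<cdot> F (g \<cdot>\<^bsub>N\<^esub> h)))"
    unfolding X_def by (rule post_Track[OF gh_pieces(1) Hagh K(3)])
  note T = Track_simps[OF L] Track_simps[OF M] Track_simps[OF P1] Track_simps[OF P2]
      Track_simps[OF P3]
    Track_simps[OF P4] Track_simps[OF Q1] Track_simps[OF Q2] Track_simps[OF Q3] Track_simps[OF Q4]
    Track_simps[OF R1] Track_simps[OF R2] Track_simps[OF R3] Track_simps[OF S1] Track_simps[OF S2]
    Track_simps[OF U] Track_simps[OF V1] Track_simps[OF V2] Track_simps[OF X] VComp_simps
        VComp_assoc_Trk
  have PP: "P1 \<box> P2 = P3 \<box> P4"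
    unfolding P1_def P2_def P3_def P4_def
    using post_VComp[OF post_Track[OF \<phi>gh HH(1) H(3)] \<phi>.PComp_Track[OF gh k]
        Comp_Hom[OF HH(1) H(3)] a_Hom]
      post_VComp[OF pre_Track[OF \<phi>kg HH(2) H(1)] \<phi>.PComp_Track[OF h kg] Comp_Hom[OF H(1) HH(2)]
          a_Hom]
      \<phi>.PComp_assoc[OF h g k] by simp
  have QQ: "Q1 \<box> Q2 = Q3 \<box> Q4"
    unfolding Q1_def Q2_def Q3_def Q4_def
    using pre_VComp[OF post_Track[OF \<psi>gh KK(1) K(3)] \<psi>.PComp_Track[OF gh k]
        Comp_Hom[OF KK(1) K(3)] a_Hom]
      pre_VComp[OF pre_Track[OF \<psi>kg KK(2) K(1)] \<psi>.PComp_Track[OF h kg] Comp_Hom[OF K(1) KK(2)]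
          a_Hom]
      \<psi>.PComp_assoc[OF h g k] by simp
  have eL: "L \<box> P3 = Q3 \<box> (S1 \<box> S2)"
    unfolding L_def P3_def Q3_def S1_def S2_def by (rule lift_comp_eq[OF h kg th u])
  have eM: "M \<box> P1 = Q1 \<box> (V1 \<box> V2)"
    unfolding M_def P1_def Q1_def V1_def V2_def by (rule lift_comp_eq[OF gh k v tk])
  have eS: "S2 \<box> P4 = U \<box> (R2 \<box> R3)"
  proof -
    have 1: "P4 = pre A (F h) (post A (a w) (PComp \<phi> k g))"
      unfolding P4_def by (rule pre_post[OF HTrackI[OF \<phi>kg HH(2)] a_Hom H(1), symmetric])
    have 2: "R2 = pre A (F h) (post A (G k) tg)"
      unfolding R2_def by (rule pre_post[OF HTrackI[OF tg Comp_Hom[OF H(2) a_Hom]] K(3) H(1),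
          symmetric])
    have Hwkg: "a w \<cdot> (F k \<cdot> F g) \<in> Hom A (PObj \<phi> q) (PObj \<psi> w)"
      by (rule Comp_Hom[OF HH(2) a_Hom])
    show ?thesis
      unfolding 1 2 S2_def U_def R3_def
      using pre_VComp[OF kg_pieces(1) u Hwkg H(1)] lift_comp_eq[OF g k tg tk, folded u_def]
        pre_VComp[OF VComp_Track[OF kg_pieces(4,3)] kg_pieces(2) Hwkg H(1)]
        pre_VComp[OF kg_pieces(4,3) Hwkg H(1)] by simp
  qed
  have eU: "S1 \<box> U = Q4 \<box> R1"
    unfolding S1_def U' Q4' R1' by (rule interchange[OF th \<psi>kg ah KK(2), symmetric])
  have eV: "V2 \<box> P2 = X \<box> R3"
  proof -
    have 1: "P2 = post A (a w \<cdot> F k) (PComp \<phi> g h)"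
      unfolding P2_def by (rule post_post[OF HTrackI[OF \<phi>gh HH(1)] H(3) a_Hom])
    have 2: "X = post A (G k \<cdot> a r) (PComp \<phi> g h)"
      unfolding X_def by (rule post_post[OF HTrackI[OF \<phi>gh HH(1)] a_Hom K(3)])
    show ?thesis unfolding 1 2 V2_def R3'
      by (rule interchange[OF \<phi>gh tk HH(1) Comp_Hom[OF H(3) a_Hom]])
  qed
  have eX: "V1 \<box> X = Q2 \<box> (R1 \<box> R2)"
  proof -
    have 1: "Q2 = post A (G k) (pre A (a p) (PComp \<psi> g h))"
      unfolding Q2_def by (rule pre_post[OF HTrackI[OF \<psi>gh KK(1)] K(3) a_Hom])
    show ?thesis
      unfolding 1 V1_def X_def R1_def R2_def
      using post_VComp[OF gh_pieces(1) v Hagh K(3)] lift_comp_eq[OF h g th tg, folded v_def]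
        post_VComp[OF VComp_Track[OF gh_pieces(4,3)] gh_pieces(2) Hagh K(3)]
        post_VComp[OF gh_pieces(4,3) Hagh K(3)] by simp
  qed
  have "L \<box> (P3 \<box> P4) = (L \<box> P3) \<box> P4" by (simp add: T)
  also have "\<dots> = Q3 \<box> (S1 \<box> (S2 \<box> P4))" unfolding eL by (simp add: T)
  also have "\<dots> = Q3 \<box> ((S1 \<box> U) \<box> (R2 \<box> R3))" unfolding eS by (simp add: T)
  also have "\<dots> = (Q3 \<box> Q4) \<box> (R1 \<box> (R2 \<box> R3))" unfolding eU by (simp add: T)
  also have "\<dots> = Q1 \<box> ((Q2 \<box> (R1 \<box> R2)) \<box> R3)" unfolding QQ[symmetric] by (simp add: T)
  also have "\<dots> = Q1 \<box> (V1 \<box> (X \<box> R3))" unfolding eX[symmetric] by (simp add: T)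
  also have "\<dots> = (Q1 \<box> (V1 \<box> V2)) \<box> P2" unfolding eV[symmetric] by (simp add: T)
  also have "\<dots> = M \<box> (P3 \<box> P4)" unfolding eM[symmetric] PP[symmetric] by (simp add: T)
  finally have "L = M"
    by (rule VComp_right_cancel[OF VComp_Track[OF P4 P3] L M])
  then show ?thesis by (simp add: L_def M_def u_def v_def)
qed

lemma lift_comp_trivial:
  assumes h: "h \<in> Hom N p q" and g: "g \<in> Hom N q r"
    and s: "s \<in> Track A (a q \<cdot> F h) (G h \<cdot> a p)"
    and t: "t \<in> Track A (a r \<cdot> F g) (G g \<cdot> a q)"
    and \<phi>: "PComp \<phi> g h = VId A (F g \<cdot> F h)"
    and \<psi>: "PComp \<psi> g h = VId A (G g \<cdot> G h)"
  shows "lift_comp g t h s = post A (G g) s \<box> pre A (F h) t"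
proof (rule lift_comp_eqI[OF h g s t])
  note \<phi>C = \<phi>.PArr_Comp[OF h g \<phi>] and \<psi>C = \<psi>.PArr_Comp[OF h g \<psi>]
  note H = \<phi>.PArr_Hom[OF h] \<phi>.PArr_Hom[OF g] \<psi>.PArr_Hom[OF h] \<psi>.PArr_Hom[OF g]
  have c: "post A (G g) s \<box> pre A (F h) t \<in>
      Track A (a r \<cdot> (F g \<cdot> F h)) (G g \<cdot> (G h \<cdot> a p))"
    by (rule VComp_Track[OF lift_comp_pieces(4)[OF h g s t] lift_comp_pieces(3)[OF h g s t]])
  then show "post A (G g) s \<box> pre A (F h) t \<in>
      Track A (a r \<cdot> F (g \<cdot>\<^bsub>N\<^esub> h)) (G (g \<cdot>\<^bsub>N\<^esub> h) \<cdot> a p)"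
    using Comp_assoc[OF a_Hom H(3,4)] by (simp add: \<phi>C \<psi>C)
  have "post A (a r) (PComp \<phi> g h) = VId A (a r \<cdot> (F g \<cdot> F h))"
    unfolding \<phi> by (rule post_VId[OF Comp_Hom[OF H(1,2)] a_Hom])
  moreover have "pre A (a p) (PComp \<psi> g h) = VId A (G g \<cdot> (G h \<cdot> a p))"
    unfolding \<psi> Comp_assoc[OF a_Hom H(3,4), symmetric]
        by (rule pre_VId[OF a_Hom Comp_Hom[OF H(3,4)]])
  ultimately show "post A (G g) s \<box> pre A (F h) t \<box> post A (a r) (PComp \<phi> g h) =
      pre A (a p) (PComp \<psi> g h) \<box> (post A (G g) s \<box> pre A (F h) t)"
    by (simp add: VId_left[OF c] VId_right[OF c])
qed

lemma PArr_Ident_N: "F (Ident N p) = Ident A (PObj \<phi> p)" "G (Ident N p) = Ident A (PObj \<psi> p)"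
  by (simp_all add: \<phi>.PArr_Ident \<psi>.PArr_Ident nil_cat_simps(1))

lemma Ident_N_Hom: "Ident N p \<in> Hom N p p"
  by (rule \<phi>.C.Ident_Hom) (simp add: nil_cat_simps(1))

lemma lift_comp_Ident:
  assumes g: "g \<in> Hom N p q" and t: "t \<in> Track A (a q \<cdot> F g) (G g \<cdot> a p)"
  shows "lift_comp (Ident N q) (VId A (a q)) g t = t"
    and "lift_comp g t (Ident N p) (VId A (a p)) = t"
proof -
  note H = \<phi>.PArr_Hom[OF g] \<psi>.PArr_Hom[OF g]
  have V: "VId A (a r) \<in> Track A (a r \<cdot> F (Ident N r)) (G (Ident N r) \<cdot> a r)" for r
    using VId_Hom[OF a_Hom[of r]] by (simp add: PArr_Ident_N Ident_left[OF a_Hom]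
        Ident_right[OF a_Hom])
  note T = HTrackI[OF t Comp_Hom[OF H(1) a_Hom]]
  show "lift_comp (Ident N q) (VId A (a q)) g t = t"
    using lift_comp_trivial[OF g Ident_N_Hom t V] \<phi>.PComp_Ident(2)[OF g] \<psi>.PComp_Ident(2)[OF g]
    by (simp add: PArr_Ident_N Ident_left[OF H(1)] Ident_left[OF H(2)] post_Ident[OF T]
        pre_VId[OF H(1) a_Hom] VId_right[OF t])
  show "lift_comp g t (Ident N p) (VId A (a p)) = t"
    using lift_comp_trivial[OF Ident_N_Hom g V t] \<phi>.PComp_Ident(1)[OF g] \<psi>.PComp_Ident(1)[OF g]
    by (simp add: PArr_Ident_N Ident_right[OF H(1)] Ident_right[OF H(2)] pre_Ident[OF T]
        post_VId[OF a_Hom H(2)] VId_left[OF t])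
qed

lemma category_lifts: "category lifts"
proof
  fix u v p q r assume "u \<in> Hom lifts p q" "v \<in> Hom lifts q r"
  then show "v \<cdot>\<^bsub>lifts\<^esub> u \<in> Hom lifts p r"
    by (cases u; cases v) (auto simp: lifts_Hom_iff intro: lift_comp_Track \<phi>.C.Comp_Hom)
next
  fix p show "Ident lifts p \<in> Hom lifts p p"
    using VId_Hom[OF a_Hom[of p]]
    by (simp add: lifts_Hom_iff Ident_N_Hom PArr_Ident_N Ident_left[OF a_Hom] Ident_right[OF a_Hom])
next
  fix u p q assume "u \<in> Hom lifts p q"
  then obtain g t where u: "u = (g, t)" "g \<in> Hom N p q"
    "t \<in> Track A (a q \<cdot> F g) (G g \<cdot> a p)"
    by (cases u) (simp add: lifts_Hom_iff)
  then show "Ident lifts q \<cdot>\<^bsub>lifts\<^esub> u = u" "u \<cdot>\<^bsub>lifts\<^esub> Ident lifts p = u"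
    using lift_comp_Ident[OF u(2,3)] \<phi>.C.Ident_left[OF u(2)] \<phi>.C.Ident_right[OF u(2)] by simp_all
next
  fix u v w p q r s assume "u \<in> Hom lifts p q" "v \<in> Hom lifts q r" "w \<in> Hom lifts r s"
  then show "w \<cdot>\<^bsub>lifts\<^esub> v \<cdot>\<^bsub>lifts\<^esub> u = w \<cdot>\<^bsub>lifts\<^esub> (v \<cdot>\<^bsub>lifts\<^esub> u)"
    by (cases u; cases v; cases w) (auto simp: lifts_Hom_iff intro: lift_comp_assoc \<phi>.C.Comp_assoc)
qed simp_all

text \<open>Pasting with an identity square across trivial comparison tracks leaves only the
  whiskered track. This describes composition with all lifted coproduct inclusions.\<close>

lemma lifts_comp_trivial:
  assumes h: "h \<in> Hom N p q" and u: "u \<in> Hom lifts q r"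
    and \<phi>: "PComp \<phi> (fst u) h = VId A (F (fst u) \<cdot> F h)"
    and \<psi>: "PComp \<psi> (fst u) h = VId A (G (fst u) \<cdot> G h)"
    and a: "a q \<cdot> F h = G h \<cdot> a p"
  shows "u \<cdot>\<^bsub>lifts\<^esub> (h, VId A (a q \<cdot> F h)) = (fst u \<cdot>\<^bsub>N\<^esub> h, pre A (F h) (snd u))"
proof -
  obtain g t where gt: "u = (g, t)" by (cases u)
  have g: "g \<in> Hom N q r" and t: "t \<in> Track A (a r \<cdot> F g) (G g \<cdot> a q)"
    using u by (simp_all add: gt lifts_Hom_iff)
  note H = \<phi>.PArr_Hom[OF h] \<phi>.PArr_Hom[OF g] \<psi>.PArr_Hom[OF h] \<psi>.PArr_Hom[OF g]
  have s: "VId A (a q \<cdot> F h) \<in> Track A (a q \<cdot> F h) (G h \<cdot> a p)"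
    using VId_Hom[OF Comp_Hom[OF H(1) a_Hom]] a by simp
  have "lift_comp g t h (VId A (a q \<cdot> F h)) = pre A (F h) t"
    using lift_comp_trivial[OF h g s t] \<phi> \<psi> VId_left[OF lift_comp_pieces(4)[OF h g s t]]
    by (simp add: gt post_VId[OF Comp_Hom[OF H(1) a_Hom] H(4)])
  then show ?thesis by (simp add: gt)
qed

text \<open>The identity track is a lift of the inclusion because \<open>a_e\<close> makes the
  square commute strictly.\<close>

definition inc :: "nat \<Rightarrow> nat \<Rightarrow> nil_arrow \<times> 't" where
  "inc q i = (nil_in n q i, VId A (a q \<cdot> \<phi>.e q i))"

lemma inc_Hom:
  assumes "i \<in> {1..q}"
  shows "inc q i \<in> Hom lifts 1 q"
  using VId_Hom[OF Comp_Hom[OF \<phi>.e_Hom[OF assms] a_Hom]] a_e[OF assms] nil_in_Hom[OF assms]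
  by (simp add: inc_def lifts_Hom_iff a_1)

lemma comp_inc:
  assumes i: "i \<in> {1..q}" and u: "u \<in> Hom lifts q r"
  shows "u \<cdot>\<^bsub>lifts\<^esub> inc q i = (fst u \<cdot>\<^bsub>N\<^esub> nil_in n q i, pre A (\<phi>.e q i) (snd u))"
  unfolding inc_def
  by (rule lifts_comp_trivial[OF nil_in_Hom[OF i] u \<phi>.PComp_nil_in[OF i lifts_Hom_fst[OF u]]
        \<psi>.PComp_nil_in[OF i lifts_Hom_fst[OF u]]]) (simp add: a_e[OF i] a_1)

lemma lifts_HTrack: "u \<in> Hom lifts p q \<Longrightarrow> snd u \<in> HTrack A (PObj \<phi> p) (PObj \<psi> q)"
  by (cases u) (auto simp: lifts_Hom_iff intro: HTrackI Comp_Hom a_Hom \<phi>.PArr_Hom)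

lemma lifts_eqI:
  assumes u: "u \<in> Hom lifts q r" and v: "v \<in> Hom lifts q r"
    and eq: "\<And>i. i \<in> {1..q} \<Longrightarrow> u \<cdot>\<^bsub>lifts\<^esub> inc q i = v \<cdot>\<^bsub>lifts\<^esub> inc q i"
  shows "u = v"
proof (rule prod_eqI)
  have *: "fst u \<cdot>\<^bsub>N\<^esub> nil_in n q i = fst v \<cdot>\<^bsub>N\<^esub> nil_in n q i"
    "pre A (\<phi>.e q i) (snd u) = pre A (\<phi>.e q i) (snd v)" if "i \<in> {1..q}" for i
    using eq[OF that] comp_inc[OF that u] comp_inc[OF that v] by simp_all
  show "fst u = fst v"
    by (rule nil_Hom_in_eqI[OF lifts_Hom_fst[OF u] lifts_Hom_fst[OF v] *(1)])
  show "snd u = snd v"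
    by (rule \<phi>.copower_HTrack_eqI[OF lifts_HTrack[OF u] lifts_HTrack[OF v] *(2)])
qed

text \<open>Arrows are glued in the theory and tracks in \<open>A\<close>, both being
  \<open>q\<close>-fold coproducts there. It remains to see that the glued track lies over the glued
  arrow, and its source and target are determined on the summands.\<close>

lemma lifts_exists:
  assumes t: "\<And>i. i \<in> {1..q} \<Longrightarrow> t i \<in> Hom lifts 1 r"
  shows "\<exists>u \<in> Hom lifts q r. \<forall>i \<in> {1..q}. u \<cdot>\<^bsub>lifts\<^esub> inc q i = t i"
proof -
  obtain g where g: "g \<in> Hom N q r" "\<And>i. i \<in> {1..q} \<Longrightarrow> g \<cdot>\<^bsub>N\<^esub> nil_in n q i = fst (t i)"
    using nil_Hom_in_exists[of q "\<lambda>i. fst (t i)" n r] lifts_Hom_fst[OF t] by blast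
  note H = \<phi>.PArr_Hom[OF g(1)] \<psi>.PArr_Hom[OF g(1)]
  obtain \<eta> where \<eta>: "\<eta> \<in> HTrack A (PObj \<phi> q) (PObj \<psi> r)"
    "\<And>i. i \<in> {1..q} \<Longrightarrow> pre A (\<phi>.e q i) \<eta> = snd (t i)"
    using \<phi>.copower_HTrack_exists[of "PObj \<psi> r" q "\<lambda>i. snd (t i)"] lifts_HTrack[OF t] by blast
  note T = HTrack_Src_Tgt[OF \<eta>(1)]
  have ti: "Src A \<eta> \<cdot> \<phi>.e q i = a r \<cdot> F (fst (t i)) \<and> Tgt A \<eta> \<cdot> \<phi>.e q i = G (fst (t i)) \<cdot> a 1"
    if i: "i \<in> {1..q}" for i
  proof (rule Track_unique)
    show "snd (t i) \<in> Track A (Src A \<eta> \<cdot> \<phi>.e q i) (Tgt A \<eta> \<cdot> \<phi>.e q i)"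
      using pre_Track[OF T(3,1) \<phi>.e_Hom[OF i]] \<eta>(2)[OF i] by simp
    show "snd (t i) \<in> Track A (a r \<cdot> F (fst (t i))) (G (fst (t i)) \<cdot> a 1)"
      using t[OF i] by (cases "t i") (simp add: lifts_Hom_iff)
  qed
  have Src: "Src A \<eta> = a r \<cdot> F g"
  proof (rule \<phi>.copower_Hom_eqI[OF T(1) Comp_Hom[OF H(1) a_Hom]])
    fix i assume i: "i \<in> {1..q}"
    show "Src A \<eta> \<cdot> \<phi>.e q i = a r \<cdot> F g \<cdot> \<phi>.e q i"
      using ti[OF i] Comp_assoc[OF \<phi>.e_Hom[OF i] H(1) a_Hom] \<phi>.PArr_Comp_nil_in[OF i g(1)]
          g(2)[OF i]
      by simp
  qed
  have Tgt: "Tgt A \<eta> = G g \<cdot> a q"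
  proof (rule \<phi>.copower_Hom_eqI[OF T(2) Comp_Hom[OF a_Hom H(2)]])
    fix i assume i: "i \<in> {1..q}"
    show "Tgt A \<eta> \<cdot> \<phi>.e q i = G g \<cdot> a q \<cdot> \<phi>.e q i"
      using ti[OF i] Comp_assoc[OF \<phi>.e_Hom[OF i] a_Hom H(2)] \<psi>.PArr_Comp_nil_in[OF i g(1)]
          g(2)[OF i]
        a_e[OF i] Comp_assoc[OF f \<psi>.e_Hom[OF i] H(2)] by (simp add: a_1)
  qed
  have u: "(g, \<eta>) \<in> Hom lifts q r" using g(1) T(3) by (simp add: lifts_Hom_iff Src Tgt)
  have "(g, \<eta>) \<cdot>\<^bsub>lifts\<^esub> inc q i = t i" if "i \<in> {1..q}" for i
    using comp_inc[OF that u] g(2)[OF that] \<eta>(2)[OF that] by simp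
  with u show ?thesis by blast
qed

text \<open>Over an identity arrow composition of lifts is vertical composition of tracks, so the
  inverse track serves.\<close>

lemma lifts_Ident_iso:
  assumes u: "u \<in> Hom lifts p p" and fst: "fst u = Ident N p"
  shows "\<exists>v \<in> Hom lifts p p. v \<cdot>\<^bsub>lifts\<^esub> u = Ident lifts p"
proof -
  obtain t where ut: "u = (Ident N p, t)" using fst by (cases u) simp
  note I = PArr_Ident_N[of p] Ident_left[OF a_Hom[of p]] Ident_right[OF a_Hom[of p]]
  have t: "t \<in> Track A (a p) (a p)" using u by (simp add: ut lifts_Hom_iff I)
  note v = vinv_Track[OF t]
  have 1: "Ident A (PObj \<psi> p) \<cdot> Ident A (PObj \<psi> p) = Ident A (PObj \<psi> p)"
    "Ident A (PObj \<phi> p) \<cdot> Ident A (PObj \<phi> p) = Ident A (PObj \<phi> p)"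
    by (simp_all add: Ident_left[OF Ident_Hom])
  have "lift_comp (Ident N p) (vinv t) (Ident N p) t = VId A (a p)"
    using lift_comp_trivial[OF Ident_N_Hom Ident_N_Hom, of t p "vinv t"] t v
      \<phi>.PComp_Ident(1)[OF Ident_N_Hom[of p]] \<psi>.PComp_Ident(1)[OF Ident_N_Hom[of p]]
      post_Ident[OF HTrackI[OF t a_Hom]] pre_Ident[OF HTrackI[OF v a_Hom]] vinv_right[OF t]
    by (simp add: I 1)
  moreover have "(Ident N p, vinv t) \<in> Hom lifts p p"
    using v by (simp add: lifts_Hom_iff I Ident_N_Hom)
  ultimately show ?thesis
    by (intro bexI[of _ "(Ident N p, vinv t)"]) (simp_all add: ut \<phi>.C.Ident_left[OF Ident_N_Hom])
qed

lemma inc_1: "inc 1 1 = Ident lifts 1"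
  by (simp add: inc_def nil_in_1 PArr_Ident_N Ident_right[OF a_Hom])

end

section \<open>Extensions of the theory of nilpotent groups\<close>

text \<open>These axioms are those properties of the category of lifts that do not mention
  projections. They come as a separate first stage because lifted projections are constructed from
  them, and the axioms of \<open>nil_extension\<close> are stated in terms of those
  projections.\<close>

locale pre_extension = category E
  for n :: enat and E :: "(nat, 'e) cat" (structure)
    and P :: "'e \<Rightarrow> nil_arrow" and inc :: "nat \<Rightarrow> nat \<Rightarrow> 'e" +
  assumes n: "n \<ge> 1"
    and Obj_UNIV [simp]: "Obj E = UNIV"
    and P_Hom: "u \<in> Hom E p q \<Longrightarrow> P u \<in> Hom (nil_cat n) p q"
    and P_Comp: "\<lbrakk>u \<in> Hom E p q; v \<in> Hom E q r\<rbrakk> \<Longrightarrow> P (v \<cdot> u) = P v \<cdot>\<^bsub>nil_cat n\<^esub> P u"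
    and P_Ident: "P (Ident E p) = Ident (nil_cat n) p"
    and inc_Hom: "i \<in> {1..q} \<Longrightarrow> inc q i \<in> Hom E 1 q"
    and P_inc: "i \<in> {1..q} \<Longrightarrow> P (inc q i) = nil_in n q i"
    and inc_1: "inc 1 1 = Ident E 1"
    and ext_eqI: "\<lbrakk>u \<in> Hom E q r; v \<in> Hom E q r; \<And>i. i \<in> {1..q} \<Longrightarrow> u \<cdot> inc q i = v \<cdot> inc q i\<rbrakk>
      \<Longrightarrow> u = v"
    and ext_exists: "(\<And>i. i \<in> {1..q} \<Longrightarrow> t i \<in> Hom E 1 r)
      \<Longrightarrow> \<exists>u \<in> Hom E q r. \<forall>i \<in> {1..q}. u \<cdot> inc q i = t i"
    and P_surj: "w \<in> Hom (nil_cat n) 1 q \<Longrightarrow> \<exists>u \<in> Hom E 1 q. P u = w"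
    and lift_Ident_iso: "\<lbrakk>u \<in> Hom E p p; P u = Ident (nil_cat n) p\<rbrakk>
      \<Longrightarrow> \<exists>v \<in> Hom E p p. v \<cdot> u = Ident E p"
begin

section \<open>Copairing, zero arrows and projections in an extension\<close>

abbreviation N where "N \<equiv> nil_cat n"

abbreviation G where "G \<equiv> nil_group n"

definition ext :: "nat \<Rightarrow> nat \<Rightarrow> (nat \<Rightarrow> 'e) \<Rightarrow> 'e" where
  "ext q r t = (SOME u. u \<in> Hom E q r \<and> (\<forall>i \<in> {1..q}. u \<cdot> inc q i = t i))"

lemma ext:
  assumes "\<And>i. i \<in> {1..q} \<Longrightarrow> t i \<in> Hom E 1 r"
  shows ext_Hom: "ext q r t \<in> Hom E q r"
    and ext_inc: "\<And>i. i \<in> {1..q} \<Longrightarrow> ext q r t \<cdot> inc q i = t i"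
proof -
  have "\<exists>u. u \<in> Hom E q r \<and> (\<forall>i \<in> {1..q}. u \<cdot> inc q i = t i)"
    using ext_exists[of q t r, OF assms] by blast
  from someI_ex[OF this] show "ext q r t \<in> Hom E q r"
    "\<And>i. i \<in> {1..q} \<Longrightarrow> ext q r t \<cdot> inc q i = t i"
    unfolding ext_def by blast+
qed

lemma Ident_1: "Ident E 1 \<in> Hom E 1 1"
  by (simp add: Ident_Hom)

text \<open>At this stage \<open>0\<close> is known to be initial among lifts but not terminal,
  hence a choice. In a \<open>nil_extension\<close> the axiom \<open>proj_eqI\<close> for
  \<open>q = 0\<close> makes it unique.\<close>

definition to0 :: 'e where "to0 = (SOME u. u \<in> Hom E 1 0)"

text \<open>There are no summands, so the family \<open>undefined\<close> is never evaluated in the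
  condition on \<open>ext\<close>.\<close>

definition zero :: "nat \<Rightarrow> 'e" where "zero q = ext 0 q (\<lambda>_. undefined) \<cdot> to0"

lemma from0_Hom: "ext 0 q t \<in> Hom E 0 q"
  by (rule ext_Hom) simp

lemma from0_eqI: "\<lbrakk>u \<in> Hom E 0 q; v \<in> Hom E 0 q\<rbrakk> \<Longrightarrow> u = v"
  by (rule ext_eqI) auto

lemma to0_Hom: "to0 \<in> Hom E 1 0"
proof -
  have "\<one>\<^bsub>G 0\<^esub> \<in> carrier (G 0)"
    by (simp add: group.is_monoid[OF group_nil_group] monoid.one_closed)
  then obtain w where "w \<in> Hom N 1 0" using nil_Hom_1_exists by blast
  then have "\<exists>u. u \<in> Hom E 1 0" using P_surj by blast
  then show ?thesis unfolding to0_def by (rule someI_ex)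
qed

lemma zero_Hom: "zero q \<in> Hom E 1 q"
  unfolding zero_def by (rule Comp_Hom[OF to0_Hom from0_Hom])

lemma comp_zero:
  assumes "u \<in> Hom E q r"
  shows "u \<cdot> zero q = zero r"
proof -
  let ?t = "\<lambda>_. undefined"
  have "u \<cdot> ext 0 q ?t = ext 0 r ?t" by (rule from0_eqI[OF Comp_Hom[OF from0_Hom assms] from0_Hom])
  then show ?thesis using Comp_assoc[OF to0_Hom from0_Hom assms, of ?t] by (simp add: zero_def)
qed

text \<open>An arrow from \<open>1\<close> to \<open>q\<close> in the theory amounts to an element
  of \<open>G q\<close>, the image of the generator; \<open>el u\<close> is the element below the
  lift \<open>u\<close>.\<close>

abbreviation el :: "'e \<Rightarrow> (nat \<times> bool) list set" where
  "el u \<equiv> nil_app (P u) (nil_gen n 1 1)"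

lemma gen_1: "nil_gen n 1 1 \<in> carrier (G 1)"
  by (rule nil_gen_carrier) simp

lemma el_closed: "u \<in> Hom E 1 q \<Longrightarrow> el u \<in> carrier (G q)"
  using nil_app_closed[OF P_Hom gen_1] .

lemma P_eqI: "\<lbrakk>u \<in> Hom E 1 q; v \<in> Hom E 1 q; el u = el v\<rbrakk> \<Longrightarrow> P u = P v"
  using nil_Hom_1_eqI[OF P_Hom P_Hom] .

lemma el_Comp: "\<lbrakk>u \<in> Hom E 1 q; v \<in> Hom E q r\<rbrakk> \<Longrightarrow> el (v \<cdot> u) = nil_app (P v) (el u)"
  using P_Comp nil_app_Comp[OF P_Hom P_Hom gen_1] by simp

lemma el_Ident: "el (Ident E 1) = nil_gen n 1 1"
  by (simp add: P_Ident nil_app_Ident gen_1)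

lemma el_inc: "i \<in> {1..q} \<Longrightarrow> el (inc q i) = nil_gen n q i"
  by (simp add: P_inc nil_in_gen)

lemma app_mult:
  "\<lbrakk>u \<in> Hom E q r; g \<in> carrier (G q); h \<in> carrier (G q)\<rbrakk>
    \<Longrightarrow> nil_app (P u) (g \<otimes>\<^bsub>G q\<^esub> h) = nil_app (P u) g \<otimes>\<^bsub>G r\<^esub> nil_app (P u) h"
  using nil_app_hom[OF P_Hom] by (rule hom_mult)

lemma el_lift:
  assumes "g \<in> carrier (G q)"
  shows "\<exists>u \<in> Hom E 1 q. el u = g"
  using nil_Hom_1_exists[OF assms] P_surj by metis

lemma el_zero: "el (zero q) = \<one>\<^bsub>G q\<^esub>"
proof -
  let ?u = "ext 0 q (\<lambda>_. undefined)"
  have "nil_app (P ?u) (el to0) = \<one>\<^bsub>G q\<^esub>"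
    by (rule nil_app_0[OF P_Hom[OF from0_Hom] el_closed[OF to0_Hom]])
  then show ?thesis by (simp add: zero_def el_Comp[OF to0_Hom from0_Hom])
qed

definition proj :: "nat \<Rightarrow> nat \<Rightarrow> 'e" where
  "proj q j = ext q 1 (\<lambda>i. if i = j then Ident E 1 else zero 1)"

lemma proj_Hom: "proj q j \<in> Hom E q 1"
  unfolding proj_def by (rule ext_Hom) (simp add: Ident_1 zero_Hom)

lemma proj_inc: "i \<in> {1..q} \<Longrightarrow> proj q j \<cdot> inc q i = (if i = j then Ident E 1 else zero 1)"
  unfolding proj_def by (rule ext_inc) (simp_all add: Ident_1 zero_Hom)

lemma app_proj:
  assumes "i \<in> {1..q}"
  shows "nil_app (P (proj q j)) (nil_gen n q i) = (if i = j then nil_gen n 1 1 else \<one>\<^bsub>G 1\<^esub>)"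
  using el_Comp[OF inc_Hom[OF assms] proj_Hom[of q j]] proj_inc[OF assms, of j] el_inc[OF assms]
  by (simp add: el_Ident el_zero split: if_splits)

end

text \<open>The two axioms say that \<open>E(1,q)\<close> is a pullback: a lift is an arrow of the
  theory together with arbitrary lifts of its \<open>q\<close> projections.\<close>

locale nil_extension = pre_extension n E P inc
  for n :: enat and E :: "(nat, 'e) cat" (structure)
    and P :: "'e \<Rightarrow> nil_arrow" and inc :: "nat \<Rightarrow> nat \<Rightarrow> 'e" +
  assumes proj_eqI: "\<lbrakk>u \<in> Hom E 1 q; v \<in> Hom E 1 q; P u = P v;
      \<And>j. j \<in> {1..q} \<Longrightarrow> proj q j \<cdot> u = proj q j \<cdot> v\<rbrakk> \<Longrightarrow> u = v"
    and proj_exists: "\<lbrakk>w \<in> Hom (nil_cat n) 1 q; \<And>j. j \<in> {1..q} \<Longrightarrow> t j \<in> Hom E 1 1;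
        \<And>j. j \<in> {1..q} \<Longrightarrow> P (t j) = P (proj q j) \<cdot>\<^bsub>nil_cat n\<^esub> w\<rbrakk>
      \<Longrightarrow> \<exists>u \<in> Hom E 1 q. P u = w \<and> (\<forall>j \<in> {1..q}. proj q j \<cdot> u = t j)"
begin

section \<open>The group structure on lifts of arrows out of the integers\<close>

lemma el_proj_eqI:
  "\<lbrakk>u \<in> Hom E 1 q; v \<in> Hom E 1 q; el u = el v;
    \<And>j. j \<in> {1..q} \<Longrightarrow> proj q j \<cdot> u = proj q j \<cdot> v\<rbrakk> \<Longrightarrow> u = v"
  using proj_eqI P_eqI by blast

lemma el_proj_exists:
  assumes g: "g \<in> carrier (G q)" and t: "\<And>j. j \<in> {1..q} \<Longrightarrow> t j \<in> Hom E 1 1"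
    and el: "\<And>j. j \<in> {1..q} \<Longrightarrow> el (t j) = nil_app (P (proj q j)) g"
  shows "\<exists>u \<in> Hom E 1 q. el u = g \<and> (\<forall>j \<in> {1..q}. proj q j \<cdot> u = t j)"
proof -
  interpret N: category N by (rule category_nil_cat)
  obtain w where w: "w \<in> Hom N 1 q" "nil_app w (nil_gen n 1 1) = g" using nil_Hom_1_exists[OF g]
      by blast
  have "P (t j) = P (proj q j) \<cdot>\<^bsub>N\<^esub> w" if "j \<in> {1..q}" for j
    using el[OF that] w nil_app_Comp[OF w(1) P_Hom[OF proj_Hom] gen_1]
    by (intro nil_Hom_1_eqI[OF P_Hom[OF t[OF that]] N.Comp_Hom[OF w(1) P_Hom[OF proj_Hom]]]) simp
  from proj_exists[OF w(1) t this] w(2) show ?thesis by blast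
qed

text \<open>The conditions on \<open>proj 2 j\<close> are the two counit laws. They can be
  prescribed because both projections send the product of the two generators to the generator, over
  which the identity lies.\<close>

definition comul :: 'e where
  "comul = (SOME u. u \<in> Hom E 1 2 \<and> el u = nil_gen n 2 1 \<otimes>\<^bsub>G 2\<^esub> nil_gen n 2 2 \<and>
     (\<forall>j \<in> {1..2}. proj 2 j \<cdot> u = Ident E 1))"

lemma comul: "comul \<in> Hom E 1 2" "el comul = nil_gen n 2 1 \<otimes>\<^bsub>G 2\<^esub> nil_gen n 2 2"
  "j \<in> {1..2} \<Longrightarrow> proj 2 j \<cdot> comul = Ident E 1"
proof -
  interpret G1: group "G 1" by (rule group_nil_group)
  interpret G2: group "G 2" by (rule group_nil_group)
  have g: "nil_gen n 2 1 \<in> carrier (G 2)" "nil_gen n 2 2 \<in> carrier (G 2)"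
    by (auto intro: nil_gen_carrier)
  have "el (Ident E 1) = nil_app (P (proj 2 j)) (nil_gen n 2 1 \<otimes>\<^bsub>G 2\<^esub> nil_gen n 2 2)"
    if "j \<in> {1..2}" for j
  proof -
    have "j = 1 \<or> j = 2" using that by auto
    then show ?thesis using g gen_1
      by (auto simp: app_mult[OF proj_Hom] app_proj el_Ident)
  qed
  then have "\<exists>u. u \<in> Hom E 1 2 \<and> el u = nil_gen n 2 1 \<otimes>\<^bsub>G 2\<^esub> nil_gen n 2 2 \<and>
     (\<forall>j \<in> {1..2}. proj 2 j \<cdot> u = Ident E 1)"
    using el_proj_exists[of "nil_gen n 2 1 \<otimes>\<^bsub>G 2\<^esub> nil_gen n 2 2" 2 "\<lambda>_. Ident E 1"] g Ident_1
    by blast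
  from someI_ex[OF this] show "comul \<in> Hom E 1 2" "el comul = nil_gen n 2 1 \<otimes>\<^bsub>G 2\<^esub> nil_gen n 2 2"
    "j \<in> {1..2} \<Longrightarrow> proj 2 j \<cdot> comul = Ident E 1"
    unfolding comul_def by blast+
qed

definition pair :: "nat \<Rightarrow> 'e \<Rightarrow> 'e \<Rightarrow> 'e" where
  "pair q u v = ext 2 q (\<lambda>i. if i = 1 then u else v)"

definition add :: "nat \<Rightarrow> 'e \<Rightarrow> 'e \<Rightarrow> 'e" where
  "add q u v = pair q u v \<cdot> comul"

context
  fixes q u v
  assumes u: "u \<in> Hom E 1 q" and v: "v \<in> Hom E 1 q"
begin

lemma pair_Hom: "pair q u v \<in> Hom E 2 q"
  unfolding pair_def by (rule ext_Hom) (simp add: u v)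

lemma pair_inc: "pair q u v \<cdot> inc 2 1 = u" "pair q u v \<cdot> inc 2 2 = v"
  unfolding pair_def by (subst ext_inc; simp add: u v)+

lemma pair_eqI:
  assumes "m \<in> Hom E 2 q" "m \<cdot> inc 2 1 = u" "m \<cdot> inc 2 2 = v"
  shows "m = pair q u v"
proof (rule ext_eqI[OF assms(1) pair_Hom])
  fix i :: nat assume "i \<in> {1..2}"
  then have "i = 1 \<or> i = 2" by auto
  then show "m \<cdot> inc 2 i = pair q u v \<cdot> inc 2 i" using assms pair_inc by auto
qed

lemma add_Hom: "add q u v \<in> Hom E 1 q"
  unfolding add_def by (rule Comp_Hom[OF comul(1) pair_Hom])

lemma el_add: "el (add q u v) = el u \<otimes>\<^bsub>G q\<^esub> el v"
proof -
  have i: "(1::nat) \<in> {1..2}" "(2::nat) \<in> {1..2}" by auto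
  have "el (add q u v) = nil_app (P (pair q u v)) (nil_gen n 2 1 \<otimes>\<^bsub>G 2\<^esub> nil_gen n 2 2)"
    by (simp add: add_def el_Comp[OF comul(1) pair_Hom] comul(2))
  also have "\<dots> = nil_app (P (pair q u v)) (nil_gen n 2 1) \<otimes>\<^bsub>G q\<^esub> nil_app (P (pair q u v))
      (nil_gen n 2 2)"
    using i by (intro app_mult[OF pair_Hom] nil_gen_carrier)
  also have "\<dots> = el u \<otimes>\<^bsub>G q\<^esub> el v"
    using el_Comp[OF inc_Hom[OF i(1)] pair_Hom] el_Comp[OF inc_Hom[OF i(2)] pair_Hom]
      el_inc[OF i(1)] el_inc[OF i(2)] pair_inc by simp
  finally show ?thesis .
qed

lemma comp_pair:
  assumes h: "h \<in> Hom E q r"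
  shows "h \<cdot> pair q u v = ext 2 r (\<lambda>i. if i = 1 then h \<cdot> u else h \<cdot> v)"
proof (rule ext_eqI[OF Comp_Hom[OF pair_Hom h]])
  let ?t = "\<lambda>i. if i = (1::nat) then h \<cdot> u else h \<cdot> v"
  have t: "?t i \<in> Hom E 1 r" for i using Comp_Hom[OF u h] Comp_Hom[OF v h] by simp
  show "ext 2 r ?t \<in> Hom E 2 r" by (rule ext_Hom[OF t])
  fix i :: nat assume i: "i \<in> {1..2}"
  then have "i = 1 \<or> i = 2" by auto
  then show "h \<cdot> pair q u v \<cdot> inc 2 i = ext 2 r ?t \<cdot> inc 2 i"
    unfolding ext_inc[OF t i] Comp_assoc[OF inc_Hom[OF i] pair_Hom h]
    using pair_inc by auto
qed

text \<open>Addition is precomposition of a pairing with \<open>comul\<close>, so every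
  postcomposition preserves it.\<close>

lemma comp_add:
  assumes h: "h \<in> Hom E q r"
  shows "h \<cdot> add q u v = add r (h \<cdot> u) (h \<cdot> v)"
  unfolding add_def Comp_assoc[OF comul(1) pair_Hom h, symmetric] comp_pair[OF h]
  by (simp add: pair_def)

end

lemma pair_proj: "proj 2 1 = pair 1 (Ident E 1) (zero 1)" "proj 2 2 = pair 1 (zero 1) (Ident E 1)"
  by (rule pair_eqI; simp add: Ident_1 zero_Hom proj_Hom proj_inc)+

text \<open>The projections of \<open>2\<close> are the pairings of the identity with zero, so the
  counit laws are the unit laws for the identity; postcomposition with \<open>u\<close> gives the
  general case.\<close>

lemma add_zero:
  assumes u: "u \<in> Hom E 1 q"
  shows add_zero_right: "add q u (zero q) = u" and add_zero_left: "add q (zero q) u = u"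
proof -
  have "add 1 (Ident E 1) (zero 1) = Ident E 1" "add 1 (zero 1) (Ident E 1) = Ident E 1"
    by (simp_all add: add_def comul(3) flip: pair_proj)
  then show "add q u (zero q) = u" "add q (zero q) u = u"
    using comp_add[OF Ident_1 zero_Hom u] comp_add[OF zero_Hom Ident_1 u]
    by (simp_all add: Ident_right[OF u] comp_zero[OF u])
qed

text \<open>It suffices to treat the three inclusions into \<open>3\<close> and to postcompose with
  the arrow having components \<open>u\<close>, \<open>v\<close>, \<open>w\<close>. Both generic
  sums lie over the same element, by associativity in \<open>G 3\<close>, and every projection
  replaces all but one summand by zero, so the unit laws give equal projections. Coassociativity is
  therefore automatic.\<close>

lemma add_assoc:
  assumes u: "u \<in> Hom E 1 q" and v: "v \<in> Hom E 1 q" and w: "w \<in> Hom E 1 q"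
  shows "add q (add q u v) w = add q u (add q v w)"
proof -
  interpret G3: group "G 3" by (rule group_nil_group)
  have i: "(1::nat) \<in> {1..3}" "(2::nat) \<in> {1..3}" "(3::nat) \<in> {1..3}" by auto
  note I = i[THEN inc_Hom]
  let ?l = "add 3 (add 3 (inc 3 1) (inc 3 2)) (inc 3 3)"
  let ?r = "add 3 (inc 3 1) (add 3 (inc 3 2) (inc 3 3))"
  note l = add_Hom[OF add_Hom[OF I(1,2)] I(3)] and r = add_Hom[OF I(1) add_Hom[OF I(2,3)]]
  have generic: "?l = ?r"
  proof (rule el_proj_eqI[OF l r])
    show "el ?l = el ?r"
      using I[THEN el_closed]
      by (simp add: el_add add_Hom I G3.m_assoc)
    fix j :: nat assume "j \<in> {1..3}"
    then have "j = 1 \<or> j = 2 \<or> j = 3" by auto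
    then show "proj 3 j \<cdot> ?l = proj 3 j \<cdot> ?r"
      by (auto simp: comp_add[OF add_Hom[OF I(1,2)] I(3) proj_Hom] comp_add[OF I(1,2) proj_Hom]
          comp_add[OF I(1) add_Hom[OF I(2,3)] proj_Hom] comp_add[OF I(2,3) proj_Hom]
          proj_inc add_zero Ident_1 zero_Hom)
  qed
  define t where "t i = (if i = 1 then u else if i = 2 then v else w)" for i :: nat
  have t: "t i \<in> Hom E 1 q" for i by (simp add: t_def u v w)
  define h where "h = ext 3 q t"
  have h: "h \<in> Hom E 3 q" "h \<cdot> inc 3 1 = u" "h \<cdot> inc 3 2 = v" "h \<cdot> inc 3 3 = w"
    unfolding h_def by (rule ext_Hom[OF t], (subst ext_inc[OF t]; simp add: t_def)+)
  have "h \<cdot> ?l = add q (add q u v) w"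
    by (simp add: comp_add[OF add_Hom[OF I(1,2)] I(3) h(1)] comp_add[OF I(1,2) h(1)] h)
  moreover have "h \<cdot> ?r = add q u (add q v w)"
    by (simp add: comp_add[OF I(1) add_Hom[OF I(2,3)] h(1)] comp_add[OF I(2,3) h(1)] h)
  ultimately show ?thesis using generic by simp
qed

text \<open>A lift \<open>\<nu>\<close> of the inverse satisfies \<open>\<nu> + 1 = z\<close> for a lift \<open>z\<close> of the zero map only; the
  shear map \<open>(e\<^sub>1 + z e\<^sub>2, e\<^sub>2)\<close> lifts an identity, and its inverse provides the correction.\<close>

lemma add_inverse_generic: "\<exists>\<nu> \<in> Hom E 1 1. add 1 \<nu> (Ident E 1) = zero 1"
proof -
  interpret G1: group "G 1" by (rule group_nil_group)
  interpret G2: group "G 2" by (rule group_nil_group)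
  obtain \<nu> where \<nu>: "\<nu> \<in> Hom E 1 1" "el \<nu> = inv\<^bsub>G 1\<^esub> nil_gen n 1 1"
    using el_lift[of "inv\<^bsub>G 1\<^esub> nil_gen n 1 1" 1] gen_1 by auto
  \<comment> \<open>The sum \<open>z\<close> lies over the neutral element but may differ from
    \<open>zero 1\<close> by an automorphism track.\<close>
  define z where "z = add 1 \<nu> (Ident E 1)"
  have z: "z \<in> Hom E 1 1" "el z = \<one>\<^bsub>G 1\<^esub>"
    using gen_1 by (simp_all add: z_def add_Hom el_add \<nu> Ident_1 el_Ident)
  have i: "(1::nat) \<in> {1..2}" "(2::nat) \<in> {1..2}" by auto
  note I = i[THEN inc_Hom]
  note e2z = Comp_Hom[OF z(1) I(2)]
  have el_e2z: "el (inc 2 2 \<cdot> z) = \<one>\<^bsub>G 2\<^esub>"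
    using el_Comp[OF z(1) I(2)] z(2) group_hom.hom_one[of "G 1" "G 2"]
        nil_app_hom[OF P_Hom[OF I(2)]]
    by (simp add: group_hom_def group_hom_axioms_def group_nil_group)
  \<comment> \<open>The first component of the shear. Since \<open>z\<close> lies over the neutral
    element, the shear lies over the identity of \<open>2\<close> and has a left inverse
    \<open>k\<close>.\<close>
  let ?s = "add 2 (inc 2 1) (inc 2 2 \<cdot> z)"
  note s = add_Hom[OF I(1) e2z]
  define h where "h = pair 2 ?s (inc 2 2)"
  have h: "h \<in> Hom E 2 2" "h \<cdot> inc 2 1 = ?s" "h \<cdot> inc 2 2 = inc 2 2"
    unfolding h_def by (simp_all add: pair_Hom pair_inc s I)
  have "P h = Ident N 2"
  proof (rule nil_Hom_eqI[OF P_Hom[OF h(1)]])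
    interpret N: category N by (rule category_nil_cat)
    show "Ident N 2 \<in> Hom N 2 2" by (rule N.Ident_Hom) (simp add: nil_cat_simps)
    have e12: "el (h \<cdot> inc 2 1) = nil_gen n 2 1" "el (h \<cdot> inc 2 2) = nil_gen n 2 2"
      using nil_gen_carrier[OF i(1), of n]
      by (simp_all add: h(2,3) el_add[OF I(1) e2z] el_e2z el_inc[OF i(1)] el_inc[OF i(2)])
    fix i :: nat assume i2: "i \<in> {1..2}"
    then have "i = 1 \<or> i = 2" by auto
    moreover have "nil_app (P h) (nil_gen n 2 i) = el (h \<cdot> inc 2 i)"
      using el_Comp[OF inc_Hom[OF i2] h(1)] el_inc[OF i2] by simp
    ultimately show "nil_app (P h) (nil_gen n 2 i) = nil_app (Ident N 2) (nil_gen n 2 i)"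
      using e12 nil_app_Ident[OF nil_gen_carrier[OF i2]] by auto
  qed
  then obtain k where k: "k \<in> Hom E 2 2" "k \<cdot> h = Ident E 2" using lift_Ident_iso[OF h(1)] by blast
  have ke2: "k \<cdot> inc 2 2 = inc 2 2"
    using Comp_assoc[OF I(2) h(1) k(1)] k(2) h(3) Ident_left[OF I(2)] by simp
  \<comment> \<open>Applying \<open>k\<close> to the shear equation expresses the first inclusion as
    the sum of \<open>k \<cdot> inc 2 1\<close> and \<open>inc 2 2 \<cdot> z\<close>. Under the
    second projection this reads \<kappa> + z = 0, so \<kappa> + \<nu> is the left inverse
    sought.\<close>
  define \<kappa> where "\<kappa> = proj 2 2 \<cdot> (k \<cdot> inc 2 1)"
  have \<kappa>: "\<kappa> \<in> Hom E 1 1" unfolding \<kappa>_def by (rule Comp_Hom[OF Comp_Hom[OF I(1) k(1)] proj_Hom])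
  have "add 2 (k \<cdot> inc 2 1) (inc 2 2 \<cdot> z) = inc 2 1"
    using Comp_assoc[OF I(1) h(1) k(1)] k(2) h(2) Ident_left[OF I(1)]
      comp_add[OF I(1) e2z k(1)] Comp_assoc[OF z(1) I(2) k(1)] ke2 by simp
  then have "proj 2 2 \<cdot> add 2 (k \<cdot> inc 2 1) (inc 2 2 \<cdot> z) = proj 2 2 \<cdot> inc 2 1" by simp
  then have "add 1 \<kappa> z = zero 1"
    using comp_add[OF Comp_Hom[OF I(1) k(1)] e2z proj_Hom[of 2 2]]
        Comp_assoc[OF z(1) I(2) proj_Hom[of 2 2]]
    by (simp add: \<kappa>_def proj_inc Ident_left[OF z(1)])
  then have "add 1 (add 1 \<kappa> \<nu>) (Ident E 1) = zero 1"
    by (simp add: z_def add_assoc[OF \<kappa> \<nu>(1) Ident_1])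
  then show ?thesis using add_Hom[OF \<kappa> \<nu>(1)] by blast
qed

definition lift_group :: "nat \<Rightarrow> 'e monoid" where
  "lift_group q = \<lparr>carrier = Hom E 1 q, mult = add q, one = zero q\<rparr>"

lemma lift_group_simps [simp]:
  "carrier (lift_group q) = Hom E 1 q" "u \<otimes>\<^bsub>lift_group q\<^esub> v = add q u v" "\<one>\<^bsub>lift_group q\<^esub> = zero q"
  by (simp_all add: lift_group_def)

text \<open>Postcomposing the generic identity for \<nu> with \<open>u\<close> makes
  \<open>u \<cdot> \<nu>\<close> a left inverse of \<open>u\<close>.\<close>

lemma group_lift_group: "group (lift_group q)"
proof (rule groupI)
  fix u assume "u \<in> carrier (lift_group q)"
  then have u: "u \<in> Hom E 1 q" by simp
  obtain \<nu> where \<nu>: "\<nu> \<in> Hom E 1 1" "add 1 \<nu> (Ident E 1) = zero 1"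
    using add_inverse_generic by blast
  have "add q (u \<cdot> \<nu>) u = zero q"
    using comp_add[OF \<nu>(1) Ident_1 u] \<nu>(2) comp_zero[OF u] Ident_right[OF u] by simp
  then show "\<exists>v\<in>carrier (lift_group q). v \<otimes>\<^bsub>lift_group q\<^esub> u = \<one>\<^bsub>lift_group q\<^esub>"
    using Comp_Hom[OF \<nu>(1) u] by auto
qed (simp_all add: add_Hom zero_Hom add_assoc add_zero)

lemma comp_hom: "h \<in> Hom E q r \<Longrightarrow> (\<lambda>u. h \<cdot> u) \<in> hom (lift_group q) (lift_group r)"
  by (rule homI) (simp_all add: Comp_Hom comp_add)

lemma el_hom: "el \<in> hom (lift_group q) (G q)"
  by (rule homI) (simp_all add: el_closed el_add)

section \<open>Homomorphic splittings and the functorial section\<close>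

definition sec1 :: "(nat \<times> bool) list set \<Rightarrow> 'e" where
  "sec1 = (SOME s. s \<in> hom (G 1) (lift_group 1) \<and> s (nil_gen n 1 1) = Ident E 1)"

lemma sec1: "sec1 \<in> hom (G 1) (lift_group 1)" "sec1 (nil_gen n 1 1) = Ident E 1"
proof -
  have "\<exists>s. s \<in> hom (G 1) (lift_group 1) \<and> s (nil_gen n 1 1) = Ident E 1"
    \<comment> \<open>Freeness of the integers, and with it \<open>n \<ge> 1\<close>, gives the
      splitting; it sends the generator to the identity, so that the section will preserve
      identities.\<close>
    by (rule nil_group_1_hom_exists[OF group_lift_group _ n, of "Ident E 1" 1]) (auto simp: Ident_1)
  from someI_ex[OF this] show "sec1 \<in> hom (G 1) (lift_group 1)" "sec1 (nil_gen n 1 1) = Ident E 1"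
    unfolding sec1_def by blast+
qed

lemma sec1_Hom: "g \<in> carrier (G 1) \<Longrightarrow> sec1 g \<in> Hom E 1 1"
  using hom_in_carrier[OF sec1(1)] by simp

lemma el_sec1:
  assumes "g \<in> carrier (G 1)"
  shows "el (sec1 g) = g"
proof -
  have "(el \<circ> sec1) g = id g"
  proof (rule hom_nil_group_eqI[OF group_nil_group Group.hom_compose[OF sec1(1) el_hom] _ _ assms])
    fix i :: nat assume "i \<in> {1..1}"
    then have "i = 1" by simp
    then show "(el \<circ> sec1) (nil_gen n 1 i) = id (nil_gen n 1 i)" by (simp add: sec1(2) el_Ident)
  qed (simp add: hom_def)
  then show ?thesis by simp
qed

abbreviation "papp q j \<equiv> nil_app (P (proj q j))"

lemma papp_hom: "papp q j \<in> hom (G q) (G 1)"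
  by (rule nil_app_hom[OF P_Hom[OF proj_Hom]])

text \<open>The lift is prescribed by its projections instead of its values on generators. This is
  possible because \<open>sec1\<close> splits \<open>el\<close>, so the prescribed projections lie
  over those of \<open>g\<close>.\<close>

definition sec :: "nat \<Rightarrow> (nat \<times> bool) list set \<Rightarrow> 'e" where
  "sec q g = (SOME u. u \<in> Hom E 1 q \<and> el u = g \<and> (\<forall>j \<in> {1..q}. proj q j \<cdot> u = sec1 (papp q j g)))"

lemma sec:
  assumes "g \<in> carrier (G q)"
  shows sec_Hom: "sec q g \<in> Hom E 1 q" and el_sec: "el (sec q g) = g"
    and proj_sec: "\<And>j. j \<in> {1..q} \<Longrightarrow> proj q j \<cdot> sec q g = sec1 (papp q j g)"
proof -
  have "\<exists>u. u \<in> Hom E 1 q \<and> el u = g \<and> (\<forall>j \<in> {1..q}. proj q j \<cdot> u = sec1 (papp q j g))"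
    using el_proj_exists[OF assms, of "\<lambda>j. sec1 (papp q j g)"] hom_in_carrier[OF papp_hom assms]
    by (auto simp: sec1_Hom el_sec1)
  from someI_ex[OF this] show "sec q g \<in> Hom E 1 q" "el (sec q g) = g"
    "\<And>j. j \<in> {1..q} \<Longrightarrow> proj q j \<cdot> sec q g = sec1 (papp q j g)"
    unfolding sec_def by blast+
qed

lemma sec_eqI:
  assumes u: "u \<in> Hom E 1 q" and el: "el u = g"
    and proj: "\<And>j. j \<in> {1..q} \<Longrightarrow> proj q j \<cdot> u = sec1 (papp q j g)"
  shows "sec q g = u"
proof -
  have g: "g \<in> carrier (G q)" using el_closed[OF u] el by simp
  show ?thesis
    by (rule el_proj_eqI[OF sec_Hom[OF g] u]) (simp_all only: el_sec[OF g] el proj_sec[OF g] proj)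
qed

text \<open>The sum of two split values has the element and the projections that characterise the
  split value of the product, since postcomposition, \<open>papp\<close> and \<open>sec1\<close> are
  homomorphisms.\<close>

lemma sec_hom: "sec q \<in> hom (G q) (lift_group q)"
proof (rule homI)
  interpret group "G q" by (rule group_nil_group)
  fix g h assume g: "g \<in> carrier (G q)" and h: "h \<in> carrier (G q)"
  have "sec q (g \<otimes>\<^bsub>G q\<^esub> h) = add q (sec q g) (sec q h)"
  proof (rule sec_eqI)
    fix j assume j: "j \<in> {1..q}"
    show "proj q j \<cdot> add q (sec q g) (sec q h) = sec1 (papp q j (g \<otimes>\<^bsub>G q\<^esub> h))"
      using hom_mult[OF sec1(1) hom_in_carrier[OF papp_hom g] hom_in_carrier[OF papp_hom h]]
      by (simp add: comp_add[OF sec_Hom[OF g] sec_Hom[OF h] proj_Hom] proj_sec[OF g j]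
          proj_sec[OF h j]
          hom_mult[OF papp_hom g h])
  qed (simp_all add: g h add_Hom el_add sec_Hom el_sec)
  then show "sec q (g \<otimes>\<^bsub>G q\<^esub> h) = sec q g \<otimes>\<^bsub>lift_group q\<^esub> sec q h" by simp
qed (simp add: sec_Hom)

lemma sec1_one: "sec1 \<one>\<^bsub>G 1\<^esub> = zero 1"
  using group_hom.hom_one[of "G 1" "lift_group 1" sec1] sec1(1)
  by (simp add: group_hom_def group_hom_axioms_def group_nil_group group_lift_group)

text \<open>The projections of \<open>inc q i\<close> are the identity and zeros, which are the
  values of \<open>sec1\<close> at the generator and at the neutral element.\<close>

lemma sec_gen:
  assumes "i \<in> {1..q}"
  shows "sec q (nil_gen n q i) = inc q i"
  using assms by (intro sec_eqI) (simp_all only: inc_Hom el_inc app_proj proj_inc sec1 sec1_one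
      split: if_split, simp)

definition nil_section :: "nil_arrow \<Rightarrow> 'e" where
  "nil_section f = ext (Dom N f) (Cod N f) (\<lambda>i. sec (Cod N f) (nil_app f (nil_gen n (Dom N f) i)))"

lemma nil_section:
  assumes f: "f \<in> Hom N p q"
  shows nil_section_Hom: "nil_section f \<in> Hom E p q"
    and nil_section_inc: "\<And>i. i \<in> {1..p} \<Longrightarrow> nil_section f \<cdot> inc p i
        = sec q (nil_app f (nil_gen n p i))"
proof -
  have eq: "nil_section f = ext p q (\<lambda>i. sec q (nil_app f (nil_gen n p i)))"
    using f by (simp add: nil_section_def Hom_def)
  have t: "sec q (nil_app f (nil_gen n p i)) \<in> Hom E 1 q" if "i \<in> {1..p}" for i
    by (rule sec_Hom[OF nil_app_closed[OF f nil_gen_carrier[OF that]]])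
  show "nil_section f \<in> Hom E p q" unfolding eq by (rule ext_Hom[OF t])
  show "\<And>i. i \<in> {1..p} \<Longrightarrow> nil_section f \<cdot> inc p i = sec q (nil_app f (nil_gen n p i))"
    unfolding eq by (rule ext_inc[OF t])
qed

text \<open>As functions of \<open>g\<close> both sides are homomorphisms into
  \<open>lift_group q\<close>, and on generators they agree by construction. Functoriality, tested
  on \<open>inc p i\<close>, is the case of \<open>g\<close> being the image of the
  \<open>i\<close>-th generator.\<close>

lemma nil_section_sec:
  assumes f: "f \<in> Hom N p q" and g: "g \<in> carrier (G p)"
  shows "nil_section f \<cdot> sec p g = sec q (nil_app f g)"
proof -
  have "((\<lambda>u. nil_section f \<cdot> u) \<circ> sec p) g = (sec q \<circ> nil_app f) g"
    by (rule hom_nil_group_eqI[OF group_lift_group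
        Group.hom_compose[OF sec_hom comp_hom[OF nil_section_Hom[OF f]]]
          Group.hom_compose[OF nil_app_hom[OF f] sec_hom] _ g])
      (simp only: comp_apply sec_gen nil_section_inc[OF f])
  then show ?thesis by simp
qed

lemma P_nil_section:
  assumes f: "f \<in> Hom N p q"
  shows "P (nil_section f) = f"
proof (rule nil_Hom_eqI[OF P_Hom[OF nil_section_Hom[OF f]] f])
  fix i assume i: "i \<in> {1..p}"
  show "nil_app (P (nil_section f)) (nil_gen n p i) = nil_app f (nil_gen n p i)"
    using el_Comp[OF inc_Hom[OF i] nil_section_Hom[OF f]] el_inc[OF i] nil_section_inc[OF f i]
      el_sec[OF nil_app_closed[OF f nil_gen_carrier[OF i]]] by simp
qed

lemma nil_section_nil_in:
  assumes i: "i \<in> {1..q}"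
  shows "nil_section (nil_in n q i) = inc q i"
proof (rule ext_eqI[OF nil_section_Hom[OF nil_in_Hom[OF i]] inc_Hom[OF i]])
  fix j :: nat assume "j \<in> {1..1}"
  then have j: "j = 1" by simp
  show "nil_section (nil_in n q i) \<cdot> inc 1 j = inc q i \<cdot> inc 1 j"
    using nil_section_inc[OF nil_in_Hom[OF i], of 1] sec_gen[OF i] nil_in_gen[OF i]
      Ident_right[OF inc_Hom[OF i]] by (simp add: j inc_1)
qed

lemma nil_section_Ident: "nil_section (Ident N p) = Ident E p"
proof -
  interpret N: category N by (rule category_nil_cat)
  have I: "Ident N p \<in> Hom N p p" "Ident E p \<in> Hom E p p"
    by (simp_all add: N.Ident_Hom nil_cat_simps(1) Ident_Hom)
  show ?thesis
    by (rule ext_eqI[OF nil_section_Hom[OF I(1)] I(2)])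
      (simp only: nil_section_inc[OF I(1)] nil_app_Ident nil_gen_carrier sec_gen
          Ident_left[OF inc_Hom])
qed

lemma nil_section_Comp:
  assumes f: "f \<in> Hom N p q" and g: "g \<in> Hom N q r"
  shows "nil_section (g \<cdot>\<^bsub>N\<^esub> f) = nil_section g \<cdot> nil_section f"
proof -
  interpret N: category N by (rule category_nil_cat)
  note gf = N.Comp_Hom[OF f g] and S = nil_section_Hom[OF f] nil_section_Hom[OF g]
  show ?thesis
  proof (rule ext_eqI[OF nil_section_Hom[OF gf] Comp_Hom[OF S]])
    fix i assume i: "i \<in> {1..p}"
    note c = nil_gen_carrier[OF i, of n]
    show "nil_section (g \<cdot>\<^bsub>N\<^esub> f) \<cdot> inc p i = nil_section g \<cdot> nil_section f \<cdot> inc p i"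
      unfolding nil_section_inc[OF gf i] Comp_assoc[OF inc_Hom[OF i] S] nil_section_inc[OF f i]
        nil_section_sec[OF g nil_app_closed[OF f c]] nil_app_Comp[OF f g c] ..
  qed
qed

section \<open>Uniqueness of sections\<close>

definition is_section :: "(nil_arrow \<Rightarrow> 'e) \<Rightarrow> bool" where
  "is_section S \<longleftrightarrow> (\<forall>p q. \<forall>f \<in> Hom N p q. S f \<in> Hom E p q \<and> P (S f) = f) \<and>
     (\<forall>p q r. \<forall>f \<in> Hom N p q. \<forall>g \<in> Hom N q r. S (g \<cdot>\<^bsub>N\<^esub> f) = S g \<cdot> S f) \<and>
     (\<forall>q. \<forall>i \<in> {1..q}. S (nil_in n q i) = inc q i)"

context
  fixes S
  assumes S: "is_section S"
begin

lemma is_section_Hom: "f \<in> Hom N p q \<Longrightarrow> S f \<in> Hom E p q" "f \<in> Hom N p q \<Longrightarrow> P (S f) = f"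
  and is_section_Comp: "\<lbrakk>f \<in> Hom N p q; g \<in> Hom N q r\<rbrakk> \<Longrightarrow> S (g \<cdot>\<^bsub>N\<^esub> f) = S g \<cdot> S f"
  and is_section_in: "i \<in> {1..q} \<Longrightarrow> S (nil_in n q i) = inc q i"
  using S unfolding is_section_def by blast+

text \<open>The equation \<open>S (P u) = u\<close> expresses that \<open>u\<close> is in the image
  of \<open>S\<close>. This image contains the inclusions and is closed under composition; here it
  is closed under copairing. The following lemmas show that it contains every ingredient of the
  addition.\<close>

lemma is_section_ext:
  assumes "u \<in> Hom E p q" "\<And>i. i \<in> {1..p} \<Longrightarrow> S (P (u \<cdot> inc p i)) = u \<cdot> inc p i"
  shows "S (P u) = u"
proof (rule ext_eqI[OF is_section_Hom(1)[OF P_Hom[OF assms(1)]] assms(1)])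
  fix i assume i: "i \<in> {1..p}"
  show "S (P u) \<cdot> inc p i = u \<cdot> inc p i"
    using is_section_Comp[OF P_Hom[OF inc_Hom[OF i]] P_Hom[OF assms(1)]] is_section_in[OF i]
      P_Comp[OF inc_Hom[OF i] assms(1)] P_inc[OF i] assms(2)[OF i] by simp
qed

lemma is_section_Ident_1: "S (P (Ident E 1)) = Ident E 1"
  using is_section_in[of 1 1] P_inc[of 1 1] by (simp add: inc_1)

lemma is_section_zero: "S (P (zero q)) = zero q"
proof -
  \<comment> \<open>For \<open>q = 0\<close> the condition on projections in \<open>proj_eqI\<close>
    is empty, so there is one lift of the arrow from \<open>1\<close> to \<open>0\<close>.\<close>
  have "S (P to0) = to0"
    by (rule proj_eqI[OF is_section_Hom(1)[OF P_Hom[OF to0_Hom]] to0_Hom])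
      (simp_all add: is_section_Hom(2)[OF P_Hom[OF to0_Hom]])
  moreover have "S (P (ext 0 q (\<lambda>_. undefined))) = ext 0 q (\<lambda>_. undefined)"
    by (rule is_section_ext[OF from0_Hom]) simp
  ultimately show ?thesis
    using is_section_Comp[OF P_Hom[OF to0_Hom] P_Hom[OF from0_Hom]] P_Comp[OF to0_Hom from0_Hom]
    by (simp add: zero_def)
qed

lemma is_section_proj: "S (P (proj q j)) = proj q j"
  by (rule is_section_ext[OF proj_Hom]) (simp only: proj_inc is_section_Ident_1 is_section_zero
      split: if_split, simp)

text \<open>A lift is determined by its projections, and the projections of
  \<open>S (P comul)\<close> are again identities, since \<open>S\<close> preserves composites and
  fixes the projections of \<open>2\<close>.\<close>

lemma is_section_comul: "S (P comul) = comul"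
proof (rule proj_eqI[OF is_section_Hom(1)[OF P_Hom[OF comul(1)]] comul(1)])
  show "P (S (P comul)) = P comul" by (rule is_section_Hom(2)[OF P_Hom[OF comul(1)]])
  fix j :: nat assume j: "j \<in> {1..2}"
  have "proj 2 j \<cdot> S (P comul) = S (P (proj 2 j \<cdot> comul))"
    using is_section_Comp[OF P_Hom[OF comul(1)] P_Hom[OF proj_Hom]] P_Comp[OF comul(1) proj_Hom]
    by (simp add: is_section_proj)
  then show "proj 2 j \<cdot> S (P comul) = proj 2 j \<cdot> comul"
    using comul(3)[OF j] by (simp add: is_section_Ident_1)
qed

lemma is_section_add:
  assumes "u \<in> Hom E 1 q" "v \<in> Hom E 1 q" "S (P u) = u" "S (P v) = v"
  shows "S (P (add q u v)) = add q u v"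
proof -
  note p = pair_Hom[OF assms(1,2)]
  have "S (P (pair q u v)) = pair q u v"
  proof (rule is_section_ext[OF p])
    fix i :: nat assume "i \<in> {1..2}"
    then have "i = 1 \<or> i = 2" by auto
    then show "S (P (pair q u v \<cdot> inc 2 i)) = pair q u v \<cdot> inc 2 i"
      using pair_inc[OF assms(1,2)] assms(3,4) by auto
  qed
  then show ?thesis
    using is_section_Comp[OF P_Hom[OF comul(1)] P_Hom[OF p]] P_Comp[OF comul(1) p]
    by (simp add: add_def is_section_comul)
qed

text \<open>Any section is additive because its image contains \<open>comul\<close> and is closed
  under addition. It agrees with \<open>sec\<close> on generators, which are sent to the
  inclusions.\<close>

lemma is_section_eq_sec:
  assumes "w \<in> Hom N 1 q"
  shows "S w = sec q (nil_app w (nil_gen n 1 1))"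
proof -
  \<comment> \<open>\<open>P (sec q g)\<close> is the arrow of the theory with element
    \<open>g\<close>, so \<open>?h\<close> is \<open>S\<close> read as a function of
    elements.\<close>
  let ?h = "\<lambda>g. S (P (sec q g))"
  have c: "nil_app w (nil_gen n 1 1) \<in> carrier (G q)" by (rule nil_app_closed[OF assms gen_1])
  have "?h \<in> hom (G q) (lift_group q)"
  proof (rule homI)
    interpret group "G q" by (rule group_nil_group)
    fix g h assume g: "g \<in> carrier (G q)" and h: "h \<in> carrier (G q)"
    note Sec = P_Hom[OF sec_Hom[OF g]] P_Hom[OF sec_Hom[OF h]]
    note SS = Sec[THEN is_section_Hom(1)] and PS = Sec[THEN is_section_Hom(2)]
    have "P (sec q (g \<otimes>\<^bsub>G q\<^esub> h)) = P (add q (?h g) (?h h))"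
      by (rule P_eqI[OF sec_Hom add_Hom[OF SS]]) (simp_all add: g h el_sec el_add[OF SS] PS)
    then show "?h (g \<otimes>\<^bsub>G q\<^esub> h) = ?h g \<otimes>\<^bsub>lift_group q\<^esub> ?h h"
      using is_section_add[OF SS] PS by simp
  qed (simp add: is_section_Hom(1)[OF P_Hom[OF sec_Hom]])
  then have "?h (nil_app w (nil_gen n 1 1)) = sec q (nil_app w (nil_gen n 1 1))"
    by (rule hom_nil_group_eqI[OF group_lift_group _ sec_hom _ c])
      (simp only: sec_gen P_inc is_section_in)
  moreover have "P (sec q (nil_app w (nil_gen n 1 1))) = w"
    by (rule nil_Hom_1_eqI[OF P_Hom[OF sec_Hom[OF c]] assms]) (simp add: el_sec[OF c])
  ultimately show ?thesis by simp
qed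

lemma is_section_unique:
  assumes f: "f \<in> Hom N p q"
  shows "S f = nil_section f"
proof (rule ext_eqI[OF is_section_Hom(1)[OF f] nil_section_Hom[OF f]])
  interpret N: category N by (rule category_nil_cat)
  fix i assume i: "i \<in> {1..p}"
  show "S f \<cdot> inc p i = nil_section f \<cdot> inc p i"
    using is_section_Comp[OF nil_in_Hom[OF i] f] is_section_in[OF i] nil_section_inc[OF f i]
      is_section_eq_sec[OF N.Comp_Hom[OF nil_in_Hom[OF i] f]] nil_app_in[OF f i] by simp
qed

end

end

section \<open>Additive track categories\<close>

lemma hom_finprod:
  assumes "comm_group G" "comm_group K" and h: "h \<in> hom G K" and x: "x \<in> A \<rightarrow> carrier G"
  shows "h (finprod G x A) = finprod K (\<lambda>i. h (x i)) A"
proof -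
  interpret G: comm_group G by fact
  interpret K: comm_group K by fact
  interpret group_hom G K h by unfold_locales (rule h)
  have hx: "(\<lambda>i. h (x i)) \<in> A \<rightarrow> carrier K" using x by (auto simp: Pi_iff)
  show ?thesis using x
    by (induction A rule: infinite_finite_induct) (auto simp: Pi_iff)
qed

context track_category
begin

section \<open>Representatives in the homotopy category\<close>

abbreviation cls where "cls \<equiv> ho_class A"

lemma Track_sym: "Track A f g \<noteq> {} \<Longrightarrow> Track A g f \<noteq> {}"
  using vinv_Track by blast

lemma Track_trans: "\<lbrakk>Track A f g \<noteq> {}; Track A g h \<noteq> {}\<rbrakk> \<Longrightarrow> Track A f h \<noteq> {}"
  using VComp_Track by blast

lemma cls_eq_iff:
  assumes "f \<in> Arr A" "g \<in> Arr A"
  shows "cls f = cls g \<longleftrightarrow> Track A f g \<noteq> {}"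
proof
  assume "cls f = cls g"
  moreover have "g \<in> cls g" using assms(2) VId_Track[OF assms(2)] by (auto simp: ho_class_def)
  ultimately have "g \<in> cls f" by simp
  then show "Track A f g \<noteq> {}" by (simp add: ho_class_def)
next
  assume "Track A f g \<noteq> {}"
  then show "cls f = cls g"
    unfolding ho_class_def using Track_sym Track_trans by blast
qed

lemma cls_Hom_eq_iff:
  "\<lbrakk>f \<in> Hom A X Y; g \<in> Hom A X' Y'\<rbrakk> \<Longrightarrow> cls f = cls g \<longleftrightarrow> Track A f g \<noteq> {}"
  by (intro cls_eq_iff) (auto simp: Hom_def)

lemma Track_cls_eq: "\<lbrakk>\<eta> \<in> Track A f g; f \<in> Hom A X Y\<rbrakk> \<Longrightarrow> cls f = cls g"
  using cls_Hom_eq_iff Track_Hom by blast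

lemma cls_mem: "\<lbrakk>g \<in> cls f; f \<in> Hom A X Y\<rbrakk> \<Longrightarrow> g \<in> Hom A X Y"
  using Track_Hom by (auto simp: ho_class_def)

lemma cls_self: "f \<in> Hom A X Y \<Longrightarrow> f \<in> cls f"
  using VId_Hom by (auto simp: ho_class_def Hom_def)

lemma cls_Hom:
  assumes "f \<in> Hom A X Y"
  shows "cls f \<in> Hom (ho A) X Y"
proof -
  have "Dom A ` cls f = {X}" "Cod A ` cls f = {Y}"
    using cls_mem[OF _ assms] cls_self[OF assms] assms by (auto simp: Hom_def)
  then show ?thesis using assms by (simp add: Hom_def ho_def)
qed

lemma ho_Hom_cases:
  assumes "u \<in> Hom (ho A) X Y"
  obtains f where "f \<in> Hom A X Y" "u = cls f"
proof -
  obtain f where f: "f \<in> Arr A" "u = cls f" using assms by (auto simp: Hom_def ho_def)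
  then have "f \<in> Hom A (Dom A f) (Cod A f)" by (simp add: Hom_def)
  from cls_Hom[OF this] f assms have "f \<in> Hom A X Y" by (auto simp: Hom_def)
  with f that show thesis by blast
qed

text \<open>Horizontal composition of tracks connects the composites of all representatives, so the
  union in \<open>ho\<close> is the union of copies of a single class.\<close>

lemma ho_Comp:
  assumes f: "f \<in> Hom A X Y" and g: "g \<in> Hom A Y Z"
  shows "cls g \<cdot>\<^bsub>ho A\<^esub> cls f = cls (g \<cdot> f)"
proof -
  have "cls (g' \<cdot> f') = cls (g \<cdot> f)" if f': "f' \<in> cls f" and g': "g' \<in> cls g" for f' g'
  proof -
    obtain \<eta> \<theta> where "\<eta> \<in> Track A f f'" "\<theta> \<in> Track A g g'"
      using f' g' by (auto simp: ho_class_def)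
    from Track_cls_eq[OF HComp_Track[OF f g this] Comp_Hom[OF f g]] show ?thesis ..
  qed
  then have "(\<Union>g' \<in> cls g. \<Union>f' \<in> cls f. cls (g' \<cdot> f')) = cls (g \<cdot> f)"
    using cls_self[OF f] cls_self[OF g] by blast
  then show ?thesis by (simp add: ho_def)
qed

lemma ho_Ident: "Ident (ho A) X = cls (Ident A X)"
  by (simp add: ho_def)

lemma ho_Obj: "Obj (ho A) = Obj A"
  by (simp add: ho_def)

end

context additive_track_category
begin

section \<open>Additive structure and the action of \<open>D\<close> on tracks\<close>

sublocale ho: additive_category "ho A" H
  by (rule ho_additive)

lemma H_comm_group: "\<lbrakk>X \<in> Obj A; Y \<in> Obj A\<rbrakk> \<Longrightarrow> comm_group (H X Y)"
  using ho.hom_group by (simp add: ho_Obj)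

lemma H_group: "\<lbrakk>X \<in> Obj A; Y \<in> Obj A\<rbrakk> \<Longrightarrow> group (H X Y)"
  using H_comm_group by (simp add: comm_group_def)

lemma H_carrier: "\<lbrakk>X \<in> Obj A; Y \<in> Obj A\<rbrakk> \<Longrightarrow> carrier (H X Y) = Hom (ho A) X Y"
  using ho.hom_carrier by (simp add: ho_Obj)

lemma ho_post_hom:
  assumes v: "v \<in> Hom (ho A) Y Z" and X: "X \<in> Obj A"
  shows "(\<lambda>u. v \<cdot>\<^bsub>ho A\<^esub> u) \<in> hom (H X Y) (H X Z)"
proof -
  have "Y \<in> Obj A" "Z \<in> Obj A" using ho.Hom_Obj[OF v] by (simp_all add: ho_Obj)
  then show ?thesis
    using v X by (intro homI) (simp_all add: H_carrier ho.Comp_Hom[OF _ v]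
        ho.Comp_add_right[OF _ _ v])
qed

lemma ho_pre_hom:
  assumes u: "u \<in> Hom (ho A) X Y" and Z: "Z \<in> Obj A"
  shows "(\<lambda>v. v \<cdot>\<^bsub>ho A\<^esub> u) \<in> hom (H Y Z) (H X Z)"
proof -
  have "X \<in> Obj A" "Y \<in> Obj A" using ho.Hom_Obj[OF u] by (simp_all add: ho_Obj)
  then show ?thesis
    using u Z by (intro homI) (simp_all add: H_carrier ho.Comp_Hom[OF u] ho.Comp_add_left[OF u])
qed

text \<open>The neutral element of \<open>H X (Zero A)\<close> can only be represented by
  \<open>x\<close>, since there is one map into the strict zero object; postcomposition with
  \<open>y\<close> preserves neutral elements.\<close>

lemma cls_through_zero:
  assumes x: "x \<in> Hom A X (Zero A)" and y: "y \<in> Hom A (Zero A) Y"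
  shows "cls (y \<cdot> x) = \<one>\<^bsub>H X Y\<^esub>"
proof -
  have o: "X \<in> Obj A" "Y \<in> Obj A" "Zero A \<in> Obj A" using x y Hom_Obj by blast+
  interpret K: group_hom "H X (Zero A)" "H X Y" "\<lambda>u. cls y \<cdot>\<^bsub>ho A\<^esub> u"
    by (simp add: group_hom_def group_hom_axioms_def H_group o ho_post_hom cls_Hom[OF y])
  have "\<one>\<^bsub>H X (Zero A)\<^esub> \<in> Hom (ho A) X (Zero A)"
    using K.G.one_closed o by (simp add: H_carrier)
  then obtain x' where "x' \<in> Hom A X (Zero A)" "\<one>\<^bsub>H X (Zero A)\<^esub> = cls x'" by (rule ho_Hom_cases)
  moreover have "x' = x" using calculation(1) x strict_zero o unfolding strict_zero_def by blast
  ultimately show ?thesis using K.hom_one ho_Comp[OF x y] by simp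
qed

text \<open>The induced map \<open>g_*\<close> on \<open>D\<close>, unrelated to the operation on
  words of the same name.\<close>

definition push :: "'o \<Rightarrow> 'a \<Rightarrow> 'd \<Rightarrow> 'd" where
  "push X g = Dm (Ident (ho A) X) (cls g)"

lemma Ident_ho_Hom: "X \<in> Obj A \<Longrightarrow> Ident (ho A) X \<in> Hom (ho A) X X"
  by (rule ho.Ident_Hom) (simp add: ho_Obj)

lemma push_hom: "\<lbrakk>X \<in> Obj A; g \<in> Hom A Y Z\<rbrakk> \<Longrightarrow> push X g \<in> hom (D X Y) (D X Z)"
  unfolding push_def by (rule Dm_hom[OF Ident_ho_Hom cls_Hom])

lemma push_Comp:
  assumes "X \<in> Obj A" "g \<in> Hom A Y Z" "h \<in> Hom A Z W" "b \<in> carrier (D X Y)"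
  shows "push X (h \<cdot> g) b = push X h (push X g b)"
  using Dm_Comp[OF Ident_ho_Hom[OF assms(1)] Ident_ho_Hom[OF assms(1)] cls_Hom[OF assms(2)]
      cls_Hom[OF assms(3)] assms(4)]
  by (simp add: push_def ho.Ident_left[OF Ident_ho_Hom[OF assms(1)]] ho_Comp[OF assms(2,3)])

lemma D_group': "\<lbrakk>X \<in> Obj A; Y \<in> Obj A\<rbrakk> \<Longrightarrow> group (D X Y)"
  using D_group by (simp add: comm_group_def)

lemma Dm_right_hom:
  assumes "X \<in> Obj A" "Y \<in> Obj A" "Z \<in> Obj A" "b \<in> carrier (D X Y)"
  shows "(\<lambda>v. Dm (Ident (ho A) X) v b) \<in> hom (H Y Z) (D X Z)"
proof (rule homI)
  fix v assume "v \<in> carrier (H Y Z)"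
  then have "v \<in> Hom (ho A) Y Z" using assms by (simp add: H_carrier)
  from hom_in_carrier[OF Dm_hom[OF Ident_ho_Hom[OF assms(1)] this] assms(4)]
  show "Dm (Ident (ho A) X) v b \<in> carrier (D X Z)" .
qed (use assms in \<open>simp add: H_carrier Dm_add_right\<close>)

text \<open>The automorphism \<open>vinv t \<box> t'\<close> of the source has the form
  \<open>\<sigma> f b\<close>. So \<open>D X Y\<close> acts transitively on parallel tracks;
  freeness of the action is \<open>\<sigma>_fixes_iff\<close>.\<close>

lemma track_torsor:
  assumes t: "t \<in> Track A f g" and t': "t' \<in> Track A f g" and f: "f \<in> Hom A X Y"
  obtains b where "b \<in> carrier (D X Y)" "t' = t \<box> \<sigma> f b"
proof -
  have "vinv t \<box> t' \<in> carrier (track_group A f)"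
    using VComp_Track[OF t' vinv_Track[OF t]] by (simp add: track_group_def)
  also have "carrier (track_group A f) = \<sigma> f ` carrier (D X Y)"
    using \<sigma>_iso[OF f] by (simp add: iso_def bij_betw_def)
  finally obtain b where b: "b \<in> carrier (D X Y)" "vinv t \<box> t' = \<sigma> f b" by blast
  have "t \<box> \<sigma> f b = t'"
    unfolding b(2)[symmetric] VComp_assoc[OF t' vinv_Track[OF t] t, symmetric] vinv_right[OF t]
    by (rule VId_left[OF t'])
  with b(1) that show thesis by blast
qed

lemma \<sigma>_Track:
  assumes "f \<in> Hom A X Y" "b \<in> carrier (D X Y)"
  shows "\<sigma> f b \<in> Track A f f"
  using \<sigma>_iso[OF assms(1)] assms(2) by (auto simp: iso_def hom_def track_group_def)

lemma \<sigma>_fixes_iff: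
  assumes t: "t \<in> Track A f g" and f: "f \<in> Hom A X Y" and b: "b \<in> carrier (D X Y)"
  shows "t \<box> \<sigma> f b = t \<longleftrightarrow> b = \<one>\<^bsub>D X Y\<^esub>"
proof -
  have XY: "X \<in> Obj A" "Y \<in> Obj A" using f Hom_Obj by blast+
  interpret T: group "track_group A f"
  proof (rule groupI)
    fix x assume "x \<in> carrier (track_group A f)"
    then show "\<exists>y\<in>carrier (track_group A f). y \<otimes>\<^bsub>track_group A f\<^esub> x = \<one>\<^bsub>track_group A f\<^esub>"
      using VComp_inverse[of x f f] by (auto simp: track_group_def)
  qed (auto simp: track_group_def intro: VComp_Track VId_Hom[OF f] VComp_assoc VId_left)
  interpret \<sigma>: group_hom "D X Y" "track_group A f" "\<sigma> f"
    using \<sigma>_iso[OF f] by (simp add: group_hom_def group_hom_axioms_def D_group' XY T.is_group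
        iso_def)
  have one: "\<sigma> f \<one>\<^bsub>D X Y\<^esub> = VId A f" using \<sigma>.hom_one by (simp add: track_group_def)
  have "t \<box> \<sigma> f b = t \<longleftrightarrow> \<sigma> f b = VId A f"
    using VComp_left_cancel[OF t \<sigma>_Track[OF f b] VId_Hom[OF f]] VId_right[OF t] by auto
  also have "\<dots> \<longleftrightarrow> b = \<one>\<^bsub>D X Y\<^esub>"
    unfolding one[symmetric]
    using \<sigma>_iso[OF f] b \<sigma>.G.one_closed by (intro inj_on_eq_iff) (auto simp: iso_def bij_betw_def)
  finally show ?thesis .
qed

end

text \<open>A predicate, so that the arrows below the lifted projections of an extension can be used
  directly as the projections of the theory.\<close>

definition nil_proj :: "enat \<Rightarrow> nat \<Rightarrow> nat \<Rightarrow> nil_arrow \<Rightarrow> bool" where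
  "nil_proj n q j \<rho> \<longleftrightarrow> \<rho> \<in> Hom (nil_cat n) q 1 \<and>
     (\<forall>i \<in> {1..q}. nil_app \<rho> (nil_gen n q i) = (if i = j then nil_gen n 1 1 else \<one>\<^bsub>nil_group n 1\<^esub>))"

lemma nil_proj_exists: "\<exists>\<rho>. nil_proj n q j \<rho>"
proof -
  have "(if i = j then nil_gen n 1 1 else \<one>\<^bsub>nil_group n 1\<^esub>) \<in> carrier (nil_group n 1)" for i
    using nil_gen_carrier[of 1 1 n] monoid.one_closed[OF group.is_monoid[OF group_nil_group]]
        by simp
  from nil_Hom_exists[of q "\<lambda>i. if i = j then nil_gen n 1 1 else \<one>\<^bsub>nil_group n 1\<^esub>", OF this]
  show ?thesis unfolding nil_proj_def by blast
qed

locale additive_nil_pseudofunctor = additive_track_category A H D Dm \<sigma> + nil_pseudofunctor n A \<phi>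
  for n :: enat
    and A :: "('o, 'a, 't, 'm) trackcat_scheme" (structure)
    and H :: "'o \<Rightarrow> 'o \<Rightarrow> 'a set monoid"
    and D :: "'o \<Rightarrow> 'o \<Rightarrow> 'd monoid"
    and Dm :: "'a set \<Rightarrow> 'a set \<Rightarrow> 'd \<Rightarrow> 'd"
    and \<sigma> :: "'a \<Rightarrow> 'd \<Rightarrow> 't"
    and \<phi> :: "(nat, nil_arrow, 'o, 'a, 't) psfunctor"
begin

section \<open>Biproduct decompositions in the homotopy category\<close>

abbreviation \<Phi> where "\<Phi> g \<equiv> cls (PArr \<phi> g)"

lemma \<Phi>_Hom: "g \<in> Hom (nil_cat n) p q \<Longrightarrow> \<Phi> g \<in> Hom (ho A) (PObj \<phi> p) (PObj \<phi> q)"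
  by (rule cls_Hom[OF PArr_Hom])

lemma \<Phi>_Comp:
  assumes f: "f \<in> Hom (nil_cat n) p q" and g: "g \<in> Hom (nil_cat n) q r"
  shows "\<Phi> (g \<cdot>\<^bsub>nil_cat n\<^esub> f) = \<Phi> g \<cdot>\<^bsub>ho A\<^esub> \<Phi> f"
  unfolding ho_Comp[OF PArr_Hom[OF f] PArr_Hom[OF g]]
  by (rule Track_cls_eq[OF PComp_Track[OF f g] Comp_Hom[OF PArr_Hom[OF f] PArr_Hom[OF g]],
      symmetric])

lemma \<Phi>_Ident: "\<Phi> (Ident (nil_cat n) p) = Ident (ho A) (PObj \<phi> p)"
  by (simp add: PArr_Ident nil_cat_simps(1) ho_Ident)

text \<open>Arrows are determined on generators, so \<open>w\<close> factors through
  \<open>0\<close>, which \<phi> sends to the strict zero object.\<close>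

lemma \<Phi>_zero:
  assumes w: "w \<in> Hom (nil_cat n) p q"
    and "\<And>i. i \<in> {1..p} \<Longrightarrow> nil_app w (nil_gen n p i) = \<one>\<^bsub>nil_group n q\<^esub>"
  shows "\<Phi> w = \<one>\<^bsub>H (PObj \<phi> p) (PObj \<phi> q)\<^esub>"
proof -
  obtain x where x: "x \<in> Hom (nil_cat n) p 0"
    using nil_Hom_exists[of p "\<lambda>_. \<one>\<^bsub>nil_group n 0\<^esub>" n 0]
        monoid.one_closed[OF group.is_monoid[OF group_nil_group]]
    by blast
  obtain y where y: "y \<in> Hom (nil_cat n) 0 q"
    using nil_Hom_exists[of 0 "\<lambda>_. undefined" n q] by auto
  note yx = C.Comp_Hom[OF x y]
  have "w = y \<cdot>\<^bsub>nil_cat n\<^esub> x"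
  proof (rule nil_Hom_eqI[OF w yx])
    fix i assume i: "i \<in> {1..p}"
    note c = nil_gen_carrier[OF i, of n]
    have "nil_app y (nil_app x (nil_gen n p i)) = \<one>\<^bsub>nil_group n q\<^esub>"
      by (rule nil_app_0[OF y nil_app_closed[OF x c]])
    then show "nil_app w (nil_gen n p i) = nil_app (y \<cdot>\<^bsub>nil_cat n\<^esub> x) (nil_gen n p i)"
      using assms(2)[OF i] nil_app_Comp[OF x y c] by simp
  qed
  moreover have Z: "PObj \<phi> 0 = Zero A" using PObj_Zero by (simp add: nil_cat_simps)
  ultimately show ?thesis
    using cls_through_zero[of "PArr \<phi> x" "PObj \<phi> p" "PArr \<phi> y" "PObj \<phi> q"] PArr_Hom[OF x]
        PArr_Hom[OF y]
      \<Phi>_Comp[OF x y] ho_Comp[OF PArr_Hom[OF x] PArr_Hom[OF y]] by simp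
qed

text \<open>Equality in \<open>ho A\<close> on each summand is witnessed by tracks, and the strict
  coproduct property glues these into one track between the representatives. Coproducts thus survive
  the passage to homotopy classes.\<close>

lemma ho_copower_eqI:
  assumes u: "u \<in> Hom (ho A) (PObj \<phi> q) Z" and v: "v \<in> Hom (ho A) (PObj \<phi> q) Z"
    and eq: "\<And>i. i \<in> {1..q} \<Longrightarrow> u \<cdot>\<^bsub>ho A\<^esub> \<Phi> (nil_in n q i) = v \<cdot>\<^bsub>ho A\<^esub> \<Phi> (nil_in n q i)"
  shows "u = v"
proof -
  obtain f where f: "f \<in> Hom A (PObj \<phi> q) Z" "u = cls f" using u by (rule ho_Hom_cases)
  obtain g where g: "g \<in> Hom A (PObj \<phi> q) Z" "v = cls g" using v by (rule ho_Hom_cases)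
  have "\<exists>\<eta>. \<eta> \<in> Track A (f \<cdot> e q i) (g \<cdot> e q i)" if i: "i \<in> {1..q}" for i
    using eq[OF i] cls_Hom_eq_iff[OF Comp_Hom[OF e_Hom[OF i] f(1)] Comp_Hom[OF e_Hom[OF i] g(1)]]
    by (auto simp: f(2) g(2) ho_Comp[OF e_Hom[OF i] f(1)] ho_Comp[OF e_Hom[OF i] g(1)])
  then obtain t where t: "\<And>i. i \<in> {1..q} \<Longrightarrow> t i \<in> Track A (f \<cdot> e q i) (g \<cdot> e q i)" by metis
  have tH: "t i \<in> HTrack A (PObj \<phi> 1) Z" if "i \<in> {1..q}" for i
    by (rule HTrackI[OF t[OF that] Comp_Hom[OF e_Hom[OF that] f(1)]])
  have "Z \<in> Obj A" using f(1) Hom_Obj by blast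
  from copower_HTrack_exists[OF this, of q t] tH
  obtain \<eta> where \<eta>: "\<eta> \<in> HTrack A (PObj \<phi> q) Z" "\<And>i. i \<in> {1..q} \<Longrightarrow> pre A (e q i) \<eta> = t i" by blast
  note T = HTrack_Src_Tgt[OF \<eta>(1)]
  have *: "Src A \<eta> \<cdot> e q i = f \<cdot> e q i \<and> Tgt A \<eta> \<cdot> e q i = g \<cdot> e q i" if i: "i \<in> {1..q}" for i
    using Track_unique[OF pre_Track[OF T(3,1) e_Hom[OF i]]] t[OF i] \<eta>(2)[OF i] by simp
  have "Src A \<eta> = f" by (rule copower_Hom_eqI[OF T(1) f(1)]) (use * in blast)
  moreover have "Tgt A \<eta> = g" by (rule copower_Hom_eqI[OF T(2) g(1)]) (use * in blast)
  ultimately show ?thesis using Track_cls_eq[OF T(3,1)] by (simp add: f(2) g(2))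
qed

lemma \<Phi>_proj_in:
  assumes \<rho>: "nil_proj n q j \<rho>" and i: "i \<in> {1..q}"
  shows "\<Phi> \<rho> \<cdot>\<^bsub>ho A\<^esub> \<Phi> (nil_in n q i) =
    (if i = j then Ident (ho A) (PObj \<phi> 1) else \<one>\<^bsub>H (PObj \<phi> 1) (PObj \<phi> 1)\<^esub>)"
proof -
  have \<rho>H: "\<rho> \<in> Hom (nil_cat n) q 1" using \<rho> by (simp add: nil_proj_def)
  note c = C.Comp_Hom[OF nil_in_Hom[OF i] \<rho>H]
  have app: "nil_app (\<rho> \<cdot>\<^bsub>nil_cat n\<^esub> nil_in n q i) (nil_gen n 1 1) =
      (if i = j then nil_gen n 1 1 else \<one>\<^bsub>nil_group n 1\<^esub>)"
    unfolding nil_app_in[OF \<rho>H i] using \<rho> i by (simp add: nil_proj_def)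
  show ?thesis
  proof (cases "i = j")
    case True
    have I: "Ident (nil_cat n) 1 \<in> Hom (nil_cat n) 1 1" by (simp add: C.Ident_Hom nil_cat_simps(1))
    have "\<rho> \<cdot>\<^bsub>nil_cat n\<^esub> nil_in n q i = Ident (nil_cat n) 1"
      by (rule nil_Hom_1_eqI[OF c I]) (use app True nil_gen_carrier[of 1 1 n] in \<open>simp add:
          nil_app_Ident\<close>)
    then show ?thesis using True \<Phi>_Comp[OF nil_in_Hom[OF i] \<rho>H] by (simp add: \<Phi>_Ident)
  next
    case False
    have "\<Phi> (\<rho> \<cdot>\<^bsub>nil_cat n\<^esub> nil_in n q i) = \<one>\<^bsub>H (PObj \<phi> 1) (PObj \<phi> 1)\<^esub>"
      by (rule \<Phi>_zero[OF c]) (use app False in auto)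
    then show ?thesis using False \<Phi>_Comp[OF nil_in_Hom[OF i] \<rho>H] by simp
  qed
qed

text \<open>The biproduct identity, with sums written as products in \<open>H\<close>. After
  precomposition with the \<open>i\<close>-th inclusion only the \<open>i\<close>-th term
  remains.\<close>

lemma \<Phi>_Ident_decomposition:
  assumes \<rho>: "\<And>j. j \<in> {1..q} \<Longrightarrow> nil_proj n q j (\<rho> j)"
  shows "Ident (ho A) (PObj \<phi> q) =
    (\<Otimes>\<^bsub>H (PObj \<phi> q) (PObj \<phi> q)\<^esub>j\<in>{1..q}. \<Phi> (nil_in n q j) \<cdot>\<^bsub>ho A\<^esub> \<Phi> (\<rho> j))"
proof -
  let ?X = "PObj \<phi> q" and ?Y = "PObj \<phi> 1"
  interpret XX: comm_group "H ?X ?X" by (simp add: H_comm_group)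
  interpret YX: comm_group "H ?Y ?X" by (simp add: H_comm_group)
  let ?x = "\<lambda>j. \<Phi> (nil_in n q j) \<cdot>\<^bsub>ho A\<^esub> \<Phi> (\<rho> j)"
  have \<rho>H: "\<Phi> (\<rho> j) \<in> Hom (ho A) ?X ?Y" if "j \<in> {1..q}" for j
    using \<rho>[OF that] by (auto simp: nil_proj_def intro: \<Phi>_Hom)
  have eH: "\<Phi> (nil_in n q j) \<in> Hom (ho A) ?Y ?X" if "j \<in> {1..q}" for j
    by (rule \<Phi>_Hom[OF nil_in_Hom[OF that]])
  have x: "?x \<in> {1..q} \<rightarrow> carrier (H ?X ?X)"
    using ho.Comp_Hom[OF \<rho>H eH] by (simp add: H_carrier)
  have "(\<Otimes>\<^bsub>H ?X ?X\<^esub>j\<in>{1..q}. ?x j) \<in> Hom (ho A) ?X ?X"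
    using XX.finprod_closed[OF x] by (simp add: H_carrier)
  then show ?thesis
  proof (rule ho_copower_eqI[OF Ident_ho_Hom[OF PObj]])
    fix i assume i: "i \<in> {1..q}"
    have *: "?x j \<cdot>\<^bsub>ho A\<^esub> \<Phi> (nil_in n q i) = (if i = j then \<Phi> (nil_in n q j) else \<one>\<^bsub>H ?Y ?X\<^esub>)"
      if j: "j \<in> {1..q}" for j
      using ho.Comp_assoc[OF eH[OF i] \<rho>H[OF j] eH[OF j]] \<Phi>_proj_in[OF \<rho>[OF j] i]
        group_hom.hom_one[of "H ?Y ?Y" "H ?Y ?X" "\<lambda>u. \<Phi> (nil_in n q j) \<cdot>\<^bsub>ho A\<^esub> u"]
        ho_post_hom[OF eH[OF j] PObj[of 1]] ho.Ident_right[OF eH[OF j]]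
      by (auto simp: group_hom_def group_hom_axioms_def H_group)
    have "(\<Otimes>\<^bsub>H ?X ?X\<^esub>j\<in>{1..q}. ?x j) \<cdot>\<^bsub>ho A\<^esub> \<Phi> (nil_in n q i) =
        (\<Otimes>\<^bsub>H ?Y ?X\<^esub>j\<in>{1..q}. ?x j \<cdot>\<^bsub>ho A\<^esub> \<Phi> (nil_in n q i))"
      by (rule hom_finprod[OF XX.comm_group_axioms YX.comm_group_axioms
          ho_pre_hom[OF eH[OF i] PObj] x])
    also have "\<dots> = (\<Otimes>\<^bsub>H ?Y ?X\<^esub>j\<in>{1..q}. if i = j then \<Phi> (nil_in n q j) else \<one>\<^bsub>H ?Y ?X\<^esub>)"
      using eH YX.one_closed[unfolded H_carrier[OF PObj PObj]]
      by (intro YX.finprod_cong') (auto simp: * H_carrier)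
    also have "\<dots> = \<Phi> (nil_in n q i)"
      using eH by (intro YX.finprod_singleton[OF i]) (auto simp: H_carrier)
    finally show "Ident (ho A) ?X \<cdot>\<^bsub>ho A\<^esub> \<Phi> (nil_in n q i) =
        (\<Otimes>\<^bsub>H ?X ?X\<^esub>j\<in>{1..q}. ?x j) \<cdot>\<^bsub>ho A\<^esub> \<Phi> (nil_in n q i)"
      by (simp add: ho.Ident_left[OF eH[OF i]])
  qed
qed

text \<open>Let \<mu> be the comultiplication. Both its projections are identities, so the biproduct
  identity for \<open>2\<close> makes its class the sum of the two inclusions. The arrow
  \<open>w''\<close> is \<mu> followed by the arrow with components \<open>w\<close> and
  \<open>w'\<close>, and composition in \<open>ho A\<close> is additive.\<close>

lemma \<Phi>_mult:
  assumes w: "w \<in> Hom (nil_cat n) 1 q" and w': "w' \<in> Hom (nil_cat n) 1 q"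
    and w'': "w'' \<in> Hom (nil_cat n) 1 q"
    and eq: "nil_app w'' (nil_gen n 1 1) =
      nil_app w (nil_gen n 1 1) \<otimes>\<^bsub>nil_group n q\<^esub> nil_app w' (nil_gen n 1 1)"
  shows "\<Phi> w'' = \<Phi> w \<otimes>\<^bsub>H (PObj \<phi> 1) (PObj \<phi> q)\<^esub> \<Phi> w'"
proof -
  let ?X = "PObj \<phi> 2" and ?Y = "PObj \<phi> 1"
  have i: "(1::nat) \<in> {1..2}" "(2::nat) \<in> {1..2}" by auto
  note g = nil_gen_carrier[OF i(1), of n] nil_gen_carrier[OF i(2), of n] nil_gen_carrier[of 1 1 n]
  note I = nil_in_Hom[OF i(1), of n] nil_in_Hom[OF i(2), of n]
  interpret G1: group "nil_group n 1" by (rule group_nil_group)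
  interpret G2: group "nil_group n 2" by (rule group_nil_group)
  interpret XX: comm_group "H ?X ?X" by (simp add: H_comm_group)
  interpret YX: comm_group "H ?Y ?X" by (simp add: H_comm_group)
  obtain \<mu> where \<mu>: "\<mu> \<in> Hom (nil_cat n) 1 2"
    "nil_app \<mu> (nil_gen n 1 1) = nil_gen n 2 1 \<otimes>\<^bsub>nil_group n 2\<^esub> nil_gen n 2 2"
    using nil_Hom_1_exists g by blast
  obtain \<rho> where \<rho>: "\<And>j. nil_proj n 2 j (\<rho> j)" using nil_proj_exists by metis
  then have \<rho>H: "\<rho> j \<in> Hom (nil_cat n) 2 1" for j by (simp add: nil_proj_def)
  have \<rho>\<mu>: "\<rho> j \<cdot>\<^bsub>nil_cat n\<^esub> \<mu> = Ident (nil_cat n) 1" if "j \<in> {1..2}" for j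
  proof (rule nil_Hom_1_eqI[OF C.Comp_Hom[OF \<mu>(1) \<rho>H]])
    have "j = 1 \<or> j = 2" using that by auto
    then show "nil_app (\<rho> j \<cdot>\<^bsub>nil_cat n\<^esub> \<mu>) (nil_gen n 1 1)
        = nil_app (Ident (nil_cat n) 1) (nil_gen n 1 1)"
      using \<rho>[of j] i g nil_app_Comp[OF \<mu>(1) \<rho>H g(3)] hom_mult[OF nil_app_hom[OF \<rho>H] g(1,2)]
      by (auto simp: nil_proj_def \<mu>(2) nil_app_Ident)
  qed (simp add: C.Ident_Hom nil_cat_simps(1))
  have eH: "\<Phi> (nil_in n 2 j) \<in> Hom (ho A) ?Y ?X" if "j \<in> {1..2}" for j
    by (rule \<Phi>_Hom[OF nil_in_Hom[OF that]])
  have "\<Phi> \<mu> = Ident (ho A) ?X \<cdot>\<^bsub>ho A\<^esub> \<Phi> \<mu>" by (simp add: ho.Ident_left[OF \<Phi>_Hom[OF \<mu>(1)]])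
  also have "\<dots> = (\<Otimes>\<^bsub>H ?X ?X\<^esub>j\<in>{1..2}. \<Phi> (nil_in n 2 j) \<cdot>\<^bsub>ho A\<^esub> \<Phi> (\<rho> j)) \<cdot>\<^bsub>ho A\<^esub> \<Phi> \<mu>"
    using \<Phi>_Ident_decomposition[of 2 \<rho>] \<rho> by simp
  also have "\<dots> = (\<Otimes>\<^bsub>H ?Y ?X\<^esub>j\<in>{1..2}. \<Phi> (nil_in n 2 j) \<cdot>\<^bsub>ho A\<^esub> \<Phi> (\<rho> j) \<cdot>\<^bsub>ho A\<^esub> \<Phi> \<mu>)"
    using ho.Comp_Hom[OF \<Phi>_Hom[OF \<rho>H] eH]
    by (intro hom_finprod[OF XX.comm_group_axioms YX.comm_group_axioms
        ho_pre_hom[OF \<Phi>_Hom[OF \<mu>(1)] PObj]])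
      (simp add: H_carrier)
  also have "\<dots> = (\<Otimes>\<^bsub>H ?Y ?X\<^esub>j\<in>{1..2}. \<Phi> (nil_in n 2 j))"
  proof (rule YX.finprod_cong')
    fix j :: nat assume j: "j \<in> {1..2}"
    show "\<Phi> (nil_in n 2 j) \<cdot>\<^bsub>ho A\<^esub> \<Phi> (\<rho> j) \<cdot>\<^bsub>ho A\<^esub> \<Phi> \<mu> = \<Phi> (nil_in n 2 j)"
    proof -
      have "\<Phi> (\<rho> j) \<cdot>\<^bsub>ho A\<^esub> \<Phi> \<mu> = Ident (ho A) ?Y"
        using \<Phi>_Comp[OF \<mu>(1) \<rho>H[of j]] \<rho>\<mu>[OF j] by (simp add: \<Phi>_Ident)
      then show ?thesis
        using ho.Comp_assoc[OF \<Phi>_Hom[OF \<mu>(1)] \<Phi>_Hom[OF \<rho>H[of j]] eH[OF j]]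
            ho.Ident_right[OF eH[OF j]]
        by simp
    qed
  qed (use eH in \<open>simp_all add: H_carrier\<close>)
  also have "{1..2::nat} = {1, 2}" by auto
  also have "(\<Otimes>\<^bsub>H ?Y ?X\<^esub>j\<in>{1, 2}. \<Phi> (nil_in n 2 j)) = \<Phi> (nil_in n 2 1) \<otimes>\<^bsub>H ?Y ?X\<^esub> \<Phi> (nil_in n 2 2)"
    using eH[OF i(1)] eH[OF i(2)] by (simp add: H_carrier)
  finally have \<Phi>\<mu>: "\<Phi> \<mu> = \<Phi> (nil_in n 2 1) \<otimes>\<^bsub>H ?Y ?X\<^esub> \<Phi> (nil_in n 2 2)" .
  have "\<exists>m \<in> Hom (nil_cat n) 2 q. \<forall>i\<in>{1..2}. m \<cdot>\<^bsub>nil_cat n\<^esub> nil_in n 2 i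
      = (if i = 1 then w else w')"
    by (rule nil_Hom_in_exists) (simp add: w w')
  then obtain m where m: "m \<in> Hom (nil_cat n) 2 q" "m \<cdot>\<^bsub>nil_cat n\<^esub> nil_in n 2 1 = w"
    "m \<cdot>\<^bsub>nil_cat n\<^esub> nil_in n 2 2 = w'" using i by fastforce
  have "w'' = m \<cdot>\<^bsub>nil_cat n\<^esub> \<mu>"
    by (rule nil_Hom_1_eqI[OF w'' C.Comp_Hom[OF \<mu>(1) m(1)]])
      (use eq nil_app_Comp[OF \<mu>(1) m(1) g(3)] hom_mult[OF nil_app_hom[OF m(1)] g(1,2)]
        nil_app_in[OF m(1) i(1)] nil_app_in[OF m(1) i(2)] in \<open>simp add: \<mu>(2) m(2,3)\<close>)
  then have "\<Phi> w'' = \<Phi> m \<cdot>\<^bsub>ho A\<^esub> (\<Phi> (nil_in n 2 1) \<otimes>\<^bsub>H ?Y ?X\<^esub> \<Phi> (nil_in n 2 2))"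
    using \<Phi>_Comp[OF \<mu>(1) m(1)] by (simp add: \<Phi>\<mu>)
  also have "\<dots> = \<Phi> w \<otimes>\<^bsub>H ?Y (PObj \<phi> q)\<^esub> \<Phi> w'"
    using ho.Comp_add_right[OF eH[OF i(1)] eH[OF i(2)] \<Phi>_Hom[OF m(1)]]
      \<Phi>_Comp[OF I(1) m(1)] \<Phi>_Comp[OF I(2) m(1)] by (simp add: m(2,3))
  finally show ?thesis .
qed

text \<open>Biadditivity turns the biproduct identity into a formula that recovers \<open>b\<close>
  from its images under the projections.\<close>

lemma D_proj_eqI:
  assumes X: "X \<in> Obj A" and b: "b \<in> carrier (D X (PObj \<phi> q))"
    and \<rho>: "\<And>j. j \<in> {1..q} \<Longrightarrow> nil_proj n q j (\<rho> j)"
    and one: "\<And>j. j \<in> {1..q} \<Longrightarrow> push X (PArr \<phi> (\<rho> j)) b = \<one>\<^bsub>D X (PObj \<phi> 1)\<^esub>"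
  shows "b = \<one>\<^bsub>D X (PObj \<phi> q)\<^esub>"
proof -
  let ?Q = "PObj \<phi> q"
  interpret QQ: comm_group "H ?Q ?Q" by (simp add: H_comm_group)
  interpret DQ: comm_group "D X ?Q" by (simp add: D_group X)
  have \<rho>H: "\<rho> j \<in> Hom (nil_cat n) q 1" if "j \<in> {1..q}" for j
    using \<rho>[OF that] by (simp add: nil_proj_def)
  have x: "(\<lambda>j. \<Phi> (nil_in n q j) \<cdot>\<^bsub>ho A\<^esub> \<Phi> (\<rho> j)) \<in> {1..q} \<rightarrow> carrier (H ?Q ?Q)"
    using ho.Comp_Hom[OF \<Phi>_Hom[OF \<rho>H] \<Phi>_Hom[OF nil_in_Hom]] by (simp add: H_carrier)
  have dec: "Ident (ho A) ?Q = (\<Otimes>\<^bsub>H ?Q ?Q\<^esub>j\<in>{1..q}. \<Phi> (nil_in n q j) \<cdot>\<^bsub>ho A\<^esub> \<Phi> (\<rho> j))"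
    by (rule \<Phi>_Ident_decomposition) (rule \<rho>)
  have "b = Dm (Ident (ho A) X) (Ident (ho A) ?Q) b"
    using Dm_Ident[OF X PObj b] by simp
  also have "\<dots> = (\<Otimes>\<^bsub>D X ?Q\<^esub>j\<in>{1..q}. Dm (Ident (ho A) X) (\<Phi> (nil_in n q j) \<cdot>\<^bsub>ho A\<^esub> \<Phi> (\<rho> j)) b)"
    unfolding dec
    by (rule hom_finprod[OF QQ.comm_group_axioms DQ.comm_group_axioms
        Dm_right_hom[OF X PObj PObj b] x])
  also have "\<dots> = (\<Otimes>\<^bsub>D X ?Q\<^esub>j\<in>{1..q}. \<one>\<^bsub>D X ?Q\<^esub>)"
  proof (rule DQ.finprod_cong')
    fix j assume j: "j \<in> {1..q}"
    note H = PArr_Hom[OF \<rho>H[OF j]] e_Hom[OF j]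
    have "Dm (Ident (ho A) X) (\<Phi> (nil_in n q j) \<cdot>\<^bsub>ho A\<^esub> \<Phi> (\<rho> j)) b
        = push X (e q j) (push X (PArr \<phi> (\<rho> j)) b)"
      using push_Comp[OF X H b] by (simp add: push_def ho_Comp[OF H])
    also have "\<dots> = \<one>\<^bsub>D X ?Q\<^esub>"
      using one[OF j] group_hom.hom_one[of "D X (PObj \<phi> 1)" "D X ?Q" "push X (e q j)"]
          push_hom[OF X H(2)]
      by (simp add: group_hom_def group_hom_axioms_def D_group' X)
    finally show "Dm (Ident (ho A) X) (\<Phi> (nil_in n q j) \<cdot>\<^bsub>ho A\<^esub> \<Phi> (\<rho> j)) b = \<one>\<^bsub>D X ?Q\<^esub>" .
  qed auto
  also have "\<dots> = \<one>\<^bsub>D X ?Q\<^esub>" by simp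
  finally show ?thesis .
qed

text \<open>The sum of the images of the \<open>b i\<close> under the inclusions works, since
  composing an inclusion with a projection gives the identity or zero.\<close>

lemma D_proj_exists:
  assumes X: "X \<in> Obj A" and b: "\<And>j. j \<in> {1..q} \<Longrightarrow> b j \<in> carrier (D X (PObj \<phi> 1))"
    and \<rho>: "\<And>j. j \<in> {1..q} \<Longrightarrow> nil_proj n q j (\<rho> j)"
  shows "\<exists>c \<in> carrier (D X (PObj \<phi> q)). \<forall>j \<in> {1..q}. push X (PArr \<phi> (\<rho> j)) c = b j"
proof -
  let ?Q = "PObj \<phi> q" and ?Y = "PObj \<phi> 1"
  interpret DQ: comm_group "D X ?Q" by (simp add: D_group X)
  interpret DY: comm_group "D X ?Y" by (simp add: D_group X)
  have \<rho>H: "\<rho> j \<in> Hom (nil_cat n) q 1" if "j \<in> {1..q}" for j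
    using \<rho>[OF that] by (simp add: nil_proj_def)
  define c where "c = (\<Otimes>\<^bsub>D X ?Q\<^esub>i\<in>{1..q}. push X (e q i) (b i))"
  have x: "(\<lambda>i. push X (e q i) (b i)) \<in> {1..q} \<rightarrow> carrier (D X ?Q)"
    using hom_in_carrier[OF push_hom[OF X e_Hom] b] by auto
  have "c \<in> carrier (D X ?Q)" unfolding c_def by (rule DQ.finprod_closed[OF x])
  moreover have "push X (PArr \<phi> (\<rho> j)) c = b j" if j: "j \<in> {1..q}" for j
  proof -
    note Hj = PArr_Hom[OF \<rho>H[OF j]]
    have "push X (PArr \<phi> (\<rho> j)) c = (\<Otimes>\<^bsub>D X ?Y\<^esub>i\<in>{1..q}. push X (PArr \<phi> (\<rho> j))
        (push X (e q i) (b i)))"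
      unfolding c_def by (rule hom_finprod[OF DQ.comm_group_axioms DY.comm_group_axioms
          push_hom[OF X Hj] x])
    also have "\<dots> = (\<Otimes>\<^bsub>D X ?Y\<^esub>i\<in>{1..q}. if j = i then b i else \<one>\<^bsub>D X ?Y\<^esub>)"
    proof (rule DY.finprod_cong')
      fix i assume i: "i \<in> {1..q}"
      have "push X (PArr \<phi> (\<rho> j)) (push X (e q i) (b i)) =
          Dm (Ident (ho A) X) (\<Phi> (\<rho> j) \<cdot>\<^bsub>ho A\<^esub> \<Phi> (nil_in n q i)) (b i)"
        using push_Comp[OF X e_Hom[OF i] Hj b[OF i]]
            by (simp add: push_def ho_Comp[OF e_Hom[OF i] Hj])
      also have "\<dots> = (if j = i then b i else \<one>\<^bsub>D X ?Y\<^esub>)"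
        using \<Phi>_proj_in[OF \<rho>[OF j] i] Dm_Ident[OF X PObj b[OF i]]
          group_hom.hom_one[of "H ?Y ?Y" "D X ?Y" "\<lambda>v. Dm (Ident (ho A) X) v (b i)"]
          Dm_right_hom[OF X PObj PObj b[OF i]]
        by (auto simp: group_hom_def group_hom_axioms_def D_group' H_group X)
      finally show "push X (PArr \<phi> (\<rho> j)) (push X (e q i) (b i))
          = (if j = i then b i else \<one>\<^bsub>D X ?Y\<^esub>)" .
    qed (use b in auto)
    also have "\<dots> = b j" using b by (intro DY.finprod_singleton[OF j]) auto
    finally show ?thesis .
  qed
  ultimately show ?thesis by blast
qed

end

section \<open>Extending a map to a pseudo natural transformation\<close>

locale additive_lifting = additive_track_category A H D Dm \<sigma> + lifting n A \<phi> \<psi> f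
  for n :: enat
    and A :: "('o, 'a, 't, 'm) trackcat_scheme" (structure)
    and H :: "'o \<Rightarrow> 'o \<Rightarrow> 'a set monoid"
    and D :: "'o \<Rightarrow> 'o \<Rightarrow> 'd monoid"
    and Dm :: "'a set \<Rightarrow> 'a set \<Rightarrow> 'd \<Rightarrow> 'd"
    and \<sigma> :: "'a \<Rightarrow> 'd \<Rightarrow> 't"
    and \<phi> :: "(nat, nil_arrow, 'o, 'a, 't) psfunctor"
    and \<psi> :: "(nat, nil_arrow, 'o, 'a, 't) psfunctor"
    and f :: 'a +
  assumes n: "n \<ge> 1"
begin

section \<open>The category of lifts as an extension\<close>

sublocale \<phi>A: additive_nil_pseudofunctor n A H D Dm \<sigma> \<phi> ..

sublocale \<psi>A: additive_nil_pseudofunctor n A H D Dm \<sigma> \<psi> ..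

text \<open>By \<open>\<Phi>_mult\<close> both sides of the naturality square, read in
  \<open>ho A\<close> as functions of an element of \<open>nil_group n q\<close>, are homomorphisms
  into the group \<open>?K\<close>. On generators they agree even strictly by \<open>a_e\<close>.
  Equality of the classes is existence of a track.\<close>

lemma lifts_surj:
  assumes w: "w \<in> Hom N 1 q"
  shows "\<exists>u \<in> Hom lifts 1 q. fst u = w"
proof -
  let ?K = "H (PObj \<phi> 1) (PObj \<psi> q)" and ?G = "nil_group n q"
  have g1: "nil_gen n 1 1 \<in> carrier (nil_group n 1)" by (rule nil_gen_carrier) simp
  interpret Gq: group ?G by (rule group_nil_group)
  interpret K: group ?K by (simp add: H_group)
  have "\<exists>w. w \<in> Hom N 1 q \<and> nil_app w (nil_gen n 1 1) = g" if "g \<in> carrier ?G" for g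
    using nil_Hom_1_exists[OF that] by blast
  then obtain W where W: "\<And>g. g \<in> carrier ?G \<Longrightarrow> W g \<in> Hom N 1 q"
    "\<And>g. g \<in> carrier ?G \<Longrightarrow> nil_app (W g) (nil_gen n 1 1) = g" by metis
  have W_app: "W (nil_app w (nil_gen n 1 1)) = w" if "w \<in> Hom N 1 q" for w
    using nil_app_closed[OF that g1] that W by (intro nil_Hom_1_eqI[of _ n q]) auto
  have W_gen: "W (nil_gen n q i) = nil_in n q i" if "i \<in> {1..q}" for i
    using W_app[OF nil_in_Hom[OF that]] by (simp only: nil_in_gen[OF that])
  have W_mult: "\<phi>A.\<Phi> (W (g \<otimes>\<^bsub>?G\<^esub> h)) = \<phi>A.\<Phi> (W g) \<otimes>\<^bsub>H (PObj \<phi> 1) (PObj \<phi> q)\<^esub> \<phi>A.\<Phi> (W h)"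
    "\<psi>A.\<Phi> (W (g \<otimes>\<^bsub>?G\<^esub> h)) = \<psi>A.\<Phi> (W g) \<otimes>\<^bsub>H (PObj \<psi> 1) (PObj \<psi> q)\<^esub> \<psi>A.\<Phi> (W h)"
    if "g \<in> carrier ?G" "h \<in> carrier ?G" for g h
    using that W by (intro \<phi>A.\<Phi>_mult \<psi>A.\<Phi>_mult; simp)+
  note aq = cls_Hom[OF a_Hom[of q]] and cf = cls_Hom[OF f]
  have homF: "(\<lambda>g. cls (a q) \<cdot>\<^bsub>ho A\<^esub> \<phi>A.\<Phi> (W g)) \<in> hom ?G ?K"
    by (rule homI)
      (simp_all add: H_carrier ho.Comp_Hom[OF \<phi>A.\<Phi>_Hom[OF W(1)] aq] W_mult
        ho.Comp_add_right[OF \<phi>A.\<Phi>_Hom[OF W(1)] \<phi>A.\<Phi>_Hom[OF W(1)] aq])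
  have homG: "(\<lambda>g. \<psi>A.\<Phi> (W g) \<cdot>\<^bsub>ho A\<^esub> cls f) \<in> hom ?G ?K"
    by (rule homI)
      (simp_all add: H_carrier ho.Comp_Hom[OF cf \<psi>A.\<Phi>_Hom[OF W(1)]] W_mult
        ho.Comp_add_left[OF cf \<psi>A.\<Phi>_Hom[OF W(1)] \<psi>A.\<Phi>_Hom[OF W(1)]])
  have "cls (a q) \<cdot>\<^bsub>ho A\<^esub> \<phi>A.\<Phi> (W g) = \<psi>A.\<Phi> (W g) \<cdot>\<^bsub>ho A\<^esub> cls f" if "g \<in> carrier ?G" for g
  proof (rule hom_nil_group_eqI[OF K.is_group homF homG _ that])
    fix i assume i: "i \<in> {1..q}"
    show "cls (a q) \<cdot>\<^bsub>ho A\<^esub> \<phi>A.\<Phi> (W (nil_gen n q i)) = \<psi>A.\<Phi> (W (nil_gen n q i)) \<cdot>\<^bsub>ho A\<^esub> cls f"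
      unfolding W_gen[OF i] ho_Comp[OF \<phi>.e_Hom[OF i] a_Hom] ho_Comp[OF f \<psi>.e_Hom[OF i]] a_e[OF i] ..
  qed
  from this[OF nil_app_closed[OF w g1]]
  have "cls (a q \<cdot> F w) = cls (G w \<cdot> f)"
    unfolding W_app[OF w] ho_Comp[OF \<phi>.PArr_Hom[OF w] a_Hom] ho_Comp[OF f \<psi>.PArr_Hom[OF w]] .
  then obtain t where "t \<in> Track A (a q \<cdot> F w) (G w \<cdot> f)"
    using cls_Hom_eq_iff[OF Comp_Hom[OF \<phi>.PArr_Hom[OF w] a_Hom] Comp_Hom[OF f \<psi>.PArr_Hom[OF w]]]
        by blast
  then have "(w, t) \<in> Hom lifts 1 q" using w by (simp add: lifts_Hom_iff a_1)
  then show ?thesis by (intro bexI[of _ "(w, t)"]) simp_all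
qed

sublocale ext: pre_extension n lifts fst inc
proof (intro pre_extension.intro pre_extension_axioms.intro)
  show "category lifts" by (rule category_lifts)
  show "u = v" if "u \<in> Hom lifts q r" "v \<in> Hom lifts q r"
    "\<And>i. i \<in> {1..q} \<Longrightarrow> u \<cdot>\<^bsub>lifts\<^esub> inc q i = v \<cdot>\<^bsub>lifts\<^esub> inc q i" for u v q r
    using that by (rule lifts_eqI)
  show "\<exists>u \<in> Hom lifts q r. \<forall>i \<in> {1..q}. u \<cdot>\<^bsub>lifts\<^esub> inc q i = t i"
    if "\<And>i. i \<in> {1..q} \<Longrightarrow> t i \<in> Hom lifts 1 r" for t q r
    using that by (rule lifts_exists)
  show "\<exists>v \<in> Hom lifts p p. v \<cdot>\<^bsub>lifts\<^esub> u = Ident lifts p"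
    if "u \<in> Hom lifts p p" "fst u = Ident N p" for u p
    using that by (rule lifts_Ident_iso)
  show "fst (inc q i) = nil_in n q i" for q i by (simp add: inc_def)
qed (simp_all only: n lifts_Hom_fst inc_Hom inc_1 lifts_surj lifts_simps fst_conv)

text \<open>\<open>\<sigma>_post\<close> moves the automorphism through whiskering with
  \<open>G g\<close>, replacing \<open>b\<close> by its \<open>push\<close>;
  \<open>\<sigma>_natural\<close> slides it past the track over \<open>g\<close> and past the
  comparison track. Composition of lifts is thus equivariant.\<close>

lemma lift_comp_act:
  assumes h: "h \<in> Hom N p q" and g: "g \<in> Hom N q r"
    and t: "t \<in> Track A (a q \<cdot> F h) (G h \<cdot> a p)"
    and s: "s \<in> Track A (a r \<cdot> F g) (G g \<cdot> a q)"
    and b: "b \<in> carrier (D (PObj \<phi> p) (PObj \<psi> q))"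
  shows "lift_comp g s h (t \<box> \<sigma> (a q \<cdot> F h) b) =
    lift_comp g s h t \<box> \<sigma> (a r \<cdot> F (g \<cdot>\<^bsub>N\<^esub> h)) (push (PObj \<phi> p) (G g) b)"
proof -
  note H = \<phi>.PArr_Hom[OF h] \<phi>.PArr_Hom[OF g] \<psi>.PArr_Hom[OF h] \<psi>.PArr_Hom[OF g]
  note gh = \<phi>.PArr_Hom[OF \<phi>.C.Comp_Hom[OF h g]]
  note ah = Comp_Hom[OF H(1) a_Hom] and agh = Comp_Hom[OF gh a_Hom]
    and aggh = Comp_Hom[OF Comp_Hom[OF H(1,2)] a_Hom]
  let ?b = "push (PObj \<phi> p) (G g) b"
  have b': "?b \<in> carrier (D (PObj \<phi> p) (PObj \<psi> r))"
    by (rule hom_in_carrier[OF push_hom[OF \<phi>.PObj H(4)] b])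
  note \<sigma>b = \<sigma>_Track[OF ah b]
  note pieces = lift_comp_pieces[OF h g t s] and K = lift_comp_Track[OF h g t s]
  let ?P = "post A (a r) (PComp \<phi> g h)" and ?Q = "pre A (a p) (PComp \<psi> g h)"
    and ?S = "post A (G g) t" and ?T = "pre A (F h) s" and ?K = "lift_comp g s h t"
  let ?\<sigma>1 = "\<sigma> (G g \<cdot> (a q \<cdot> F h)) ?b" and ?\<sigma>2 = "\<sigma> (a r \<cdot> (F g \<cdot> F h)) ?b"
    and ?\<sigma>3 = "\<sigma> (a r \<cdot> F (g \<cdot>\<^bsub>N\<^esub> h)) ?b"
  have \<sigma>T: "?\<sigma>1 \<in> Track A (G g \<cdot> (a q \<cdot> F h)) (G g \<cdot> (a q \<cdot> F h))"
    "?\<sigma>2 \<in> Track A (a r \<cdot> (F g \<cdot> F h)) (a r \<cdot> (F g \<cdot> F h))"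
    "?\<sigma>3 \<in> Track A (a r \<cdot> F (g \<cdot>\<^bsub>N\<^esub> h)) (a r \<cdot> F (g \<cdot>\<^bsub>N\<^esub> h))"
    using b' Comp_Hom[OF ah H(4)] aggh agh by (auto intro: \<sigma>_Track)
  note T = Track_simps[OF pieces(1)] Track_simps[OF pieces(2)] Track_simps[OF pieces(3)]
    Track_simps[OF pieces(4)] Track_simps[OF K] Track_simps[OF \<sigma>T(1)] Track_simps[OF \<sigma>T(2)]
    Track_simps[OF \<sigma>T(3)] VComp_simps VComp_assoc_Trk
  have S: "post A (G g) (t \<box> \<sigma> (a q \<cdot> F h) b) = ?S \<box> ?\<sigma>1"
    unfolding post_VComp[OF \<sigma>b t ah H(4)] \<sigma>_post[OF ah H(4) b] push_def ..
  have 1: "?\<sigma>1 \<box> ?T = ?T \<box> ?\<sigma>2" by (rule \<sigma>_natural[OF aggh pieces(4) b'])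
  have 2: "?\<sigma>3 \<box> ?P = ?P \<box> ?\<sigma>2" by (rule \<sigma>_natural[OF aggh pieces(1) b'])
  show ?thesis
  proof (rule lift_comp_eqI[OF h g VComp_Track[OF \<sigma>b t] s VComp_Track[OF \<sigma>T(3) K]])
    have "?K \<box> ?\<sigma>3 \<box> ?P = ?K \<box> (?\<sigma>3 \<box> ?P)" by (simp add: T)
    also have "\<dots> = (?K \<box> ?P) \<box> ?\<sigma>2" unfolding 2 by (simp add: T)
    also have "\<dots> = ?Q \<box> (?S \<box> (?T \<box> ?\<sigma>2))" unfolding lift_comp_eq[OF h g t s] by (simp add: T)
    also have "\<dots> = ?Q \<box> (?S \<box> ?\<sigma>1 \<box> ?T)" unfolding 1[symmetric] by (simp add: T)
    finally show "?K \<box> ?\<sigma>3 \<box> ?P = ?Q \<box> (post A (G g) (t \<box> \<sigma> (a q \<cdot> F h) b) \<box> ?T)"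
      unfolding S .
  qed
qed

lemma nil_proj_proj: "nil_proj n q j (fst (ext.proj q j))"
  unfolding nil_proj_def using lifts_Hom_fst[OF ext.proj_Hom] ext.app_proj by blast

lemma proj_comp_act:
  assumes t: "(w, t) \<in> Hom lifts 1 q" and b: "b \<in> carrier (D (PObj \<phi> 1) (PObj \<psi> q))"
  shows "ext.proj q j \<cdot>\<^bsub>lifts\<^esub> (w, t \<box> \<sigma> (a q \<cdot> F w) b) =
    (fst (ext.proj q j) \<cdot>\<^bsub>N\<^esub> w, snd (ext.proj q j \<cdot>\<^bsub>lifts\<^esub> (w, t)) \<box>
      \<sigma> (a 1 \<cdot> F (fst (ext.proj q j) \<cdot>\<^bsub>N\<^esub> w)) (push (PObj \<phi> 1) (G (fst (ext.proj q j))) b))"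
proof -
  obtain g s where gs: "ext.proj q j = (g, s)" by (cases "ext.proj q j")
  have "(g, s) \<in> Hom lifts q 1" using ext.proj_Hom[of q j] gs by simp
  then have "g \<in> Hom N q 1" "s \<in> Track A (a 1 \<cdot> F g) (G g \<cdot> a q)"
    by (simp_all add: lifts_Hom_iff)
  with t lift_comp_act[OF _ this(1) _ this(2) b] show ?thesis by (simp add: gs lifts_Hom_iff)
qed

text \<open>The lifts of \<open>w\<close> form a torsor under
  \<open>D (PObj \<phi> 1) (PObj \<psi> q)\<close>, and by \<open>proj_comp_act\<close> a projection
  acts on the torsors as the induced map on \<open>D\<close>. The two axioms reduce to
  \<open>D_proj_eqI\<close> and \<open>D_proj_exists\<close>.\<close>

sublocale ext: nil_extension n lifts fst inc
proof
  fix u v q assume u: "u \<in> Hom lifts 1 q" and v: "v \<in> Hom lifts 1 q" and "fst u = fst v"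
    and eq: "\<And>j. j \<in> {1..q} \<Longrightarrow> ext.proj q j \<cdot>\<^bsub>lifts\<^esub> u = ext.proj q j \<cdot>\<^bsub>lifts\<^esub> v"
  then obtain w t t' where uv: "u = (w, t)" "v = (w, t')" by (cases u; cases v) auto
  have t: "t \<in> Track A (a q \<cdot> F w) (G w \<cdot> a 1)"
    and t': "t' \<in> Track A (a q \<cdot> F w) (G w \<cdot> a 1)" and w: "w \<in> Hom N 1 q"
    using u v by (simp_all add: uv lifts_Hom_iff)
  note aw = Comp_Hom[OF \<phi>.PArr_Hom[OF w] a_Hom]
  obtain b where b: "b \<in> carrier (D (PObj \<phi> 1) (PObj \<psi> q))" "t' = t \<box> \<sigma> (a q \<cdot> F w) b"
    by (rule track_torsor[OF t t' aw])
  have "b = \<one>\<^bsub>D (PObj \<phi> 1) (PObj \<psi> q)\<^esub>"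
  proof (rule \<psi>A.D_proj_eqI[OF \<phi>.PObj b(1)])
    fix j assume j: "j \<in> {1..q}"
    show "nil_proj n q j (fst (ext.proj q j))" by (rule nil_proj_proj)
    let ?c = "push (PObj \<phi> 1) (G (fst (ext.proj q j))) b"
    have pu: "ext.proj q j \<cdot>\<^bsub>lifts\<^esub> u \<in> Hom lifts 1 1" by (rule ext.Comp_Hom[OF u ext.proj_Hom])
    have pw: "fst (ext.proj q j) \<cdot>\<^bsub>N\<^esub> w \<in> Hom N 1 1" using lifts_Hom_fst[OF pu] by (simp add: uv)
    have "snd (ext.proj q j \<cdot>\<^bsub>lifts\<^esub> v) =
        snd (ext.proj q j \<cdot>\<^bsub>lifts\<^esub> u) \<box> \<sigma> (a 1 \<cdot> F (fst (ext.proj q j) \<cdot>\<^bsub>N\<^esub> w)) ?c"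
      unfolding uv b(2) by (subst proj_comp_act[OF u[unfolded uv] b(1)]) simp
    then have "snd (ext.proj q j \<cdot>\<^bsub>lifts\<^esub> u) \<box> \<sigma> (a 1 \<cdot> F (fst (ext.proj q j) \<cdot>\<^bsub>N\<^esub> w)) ?c =
        snd (ext.proj q j \<cdot>\<^bsub>lifts\<^esub> u)"
      using eq[OF j] by (simp only:)
    moreover have "snd (ext.proj q j \<cdot>\<^bsub>lifts\<^esub> u) \<in> Track A (a 1 \<cdot> F (fst (ext.proj q j) \<cdot>\<^bsub>N\<^esub> w))
        (G (fst (ext.proj q j) \<cdot>\<^bsub>N\<^esub> w) \<cdot> a 1)"
      using pu by (cases "ext.proj q j \<cdot>\<^bsub>lifts\<^esub> u")
          (auto simp: lifts_Hom_iff uv dest: arg_cong[of _ _ fst])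
    moreover have "?c \<in> carrier (D (PObj \<phi> 1) (PObj \<psi> 1))"
      by (rule hom_in_carrier[OF push_hom[OF \<phi>.PObj \<psi>.PArr_Hom[OF lifts_Hom_fst[OF ext.proj_Hom]]]
          b(1)])
    ultimately show "?c = \<one>\<^bsub>D (PObj \<phi> 1) (PObj \<psi> 1)\<^esub>"
      using \<sigma>_fixes_iff Comp_Hom[OF \<phi>.PArr_Hom[OF pw] a_Hom] by blast
  qed
  then have "t' = t" using \<sigma>_fixes_iff[OF t aw b(1)] b(2) by simp
  then show "u = v" by (simp add: uv)
next
  fix w q t assume w: "w \<in> Hom N 1 q" and t: "\<And>j. j \<in> {1..q} \<Longrightarrow> t j \<in> Hom lifts 1 1"
    and fst_t: "\<And>j. j \<in> {1..q} \<Longrightarrow> fst (t j) = fst (ext.proj q j) \<cdot>\<^bsub>N\<^esub> w"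
  \<comment> \<open>An arbitrary lift of \<open>w\<close>. Its projections differ from the
    prescribed ones by elements \<open>b j\<close>, and the single element \<open>c\<close> with
    these images corrects all of them at once.\<close>
  obtain s where s: "(w, s) \<in> Hom lifts 1 q" using lifts_surj[OF w] by (metis prod.collapse)
  let ?g = "\<lambda>j. a 1 \<cdot> F (fst (ext.proj q j) \<cdot>\<^bsub>N\<^esub> w)"
  have gH: "?g j \<in> Hom A (PObj \<phi> 1) (PObj \<psi> 1)" for j
    by (rule Comp_Hom[OF \<phi>.PArr_Hom[OF \<phi>.C.Comp_Hom[OF w lifts_Hom_fst[OF ext.proj_Hom]]] a_Hom])
  have "\<exists>b. b \<in> carrier (D (PObj \<phi> 1) (PObj \<psi> 1)) \<and>
      snd (t j) = snd (ext.proj q j \<cdot>\<^bsub>lifts\<^esub> (w, s)) \<box> \<sigma> (?g j) b" if j: "j \<in> {1..q}" for j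
  proof -
    have 1: "snd u \<in> Track A (?g j) (G (fst (ext.proj q j) \<cdot>\<^bsub>N\<^esub> w) \<cdot> a 1)"
      if "u \<in> Hom lifts 1 1" "fst u = fst (ext.proj q j) \<cdot>\<^bsub>N\<^esub> w" for u
      using that by (cases u) (simp add: lifts_Hom_iff)
    show ?thesis
      by (rule track_torsor[OF 1[OF ext.Comp_Hom[OF s ext.proj_Hom]] 1[OF t[OF j] fst_t[OF j]]
          gH]) auto
  qed
  then obtain b where b: "\<And>j. j \<in> {1..q} \<Longrightarrow> b j \<in> carrier (D (PObj \<phi> 1) (PObj \<psi> 1))"
    "\<And>j. j \<in> {1..q} \<Longrightarrow> snd (t j) = snd (ext.proj q j \<cdot>\<^bsub>lifts\<^esub> (w, s)) \<box> \<sigma> (?g j) (b j)" by metis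
  have "\<exists>c \<in> carrier (D (PObj \<phi> 1) (PObj \<psi> q)).
      \<forall>j \<in> {1..q}. push (PObj \<phi> 1) (G (fst (ext.proj q j))) c = b j"
    by (rule \<psi>A.D_proj_exists[OF \<phi>.PObj]) (use b(1) nil_proj_proj in auto)
  then obtain c where c: "c \<in> carrier (D (PObj \<phi> 1) (PObj \<psi> q))"
    "\<And>j. j \<in> {1..q} \<Longrightarrow> push (PObj \<phi> 1) (G (fst (ext.proj q j))) c = b j" by blast
  let ?u = "(w, s \<box> \<sigma> (a q \<cdot> F w) c)"
  have "s \<in> Track A (a q \<cdot> F w) (G w \<cdot> a 1)" using s by (simp add: lifts_Hom_iff)
  from VComp_Track[OF \<sigma>_Track[OF Comp_Hom[OF \<phi>.PArr_Hom[OF w] a_Hom] c(1)] this]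
  have "?u \<in> Hom lifts 1 q" using w by (simp add: lifts_Hom_iff)
  moreover have "ext.proj q j \<cdot>\<^bsub>lifts\<^esub> ?u = t j" if j: "j \<in> {1..q}" for j
    unfolding proj_comp_act[OF s c(1)] c(2)[OF j]
    by (rule prod_eqI) (simp_all only: fst_conv snd_conv b(2)[OF j] fst_t[OF j])
  ultimately show "\<exists>u \<in> Hom lifts 1 q. fst u = w \<and> (\<forall>j \<in> {1..q}. ext.proj q j \<cdot>\<^bsub>lifts\<^esub> u = t j)"
    by (intro bexI[of _ ?u]) auto
qed

section \<open>From the section to a transformation\<close>

definition in1 where "in1 p q = (In1 N p q, VId A (a (p + q) \<cdot> F (In1 N p q)))"

definition in2 where "in2 p q = (In2 N p q, VId A (a (p + q) \<cdot> F (In2 N p q)))"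

lemma in_Hom: "in1 p q \<in> Hom lifts p (p + q)" "in2 p q \<in> Hom lifts q (p + q)"
  using VId_Hom[OF Comp_Hom[OF \<phi>.PArr_Hom[OF nil_In_Hom(1)] a_Hom[of "p + q"]]]
    VId_Hom[OF Comp_Hom[OF \<phi>.PArr_Hom[OF nil_In_Hom(2)] a_Hom[of "p + q"]]] nil_In_Hom[of n p q]
  by (simp_all add: in1_def in2_def lifts_Hom_iff a_In)

lemma comp_in:
  assumes u: "u \<in> Hom lifts (p + q) r"
  shows "u \<cdot>\<^bsub>lifts\<^esub> in1 p q = (fst u \<cdot>\<^bsub>N\<^esub> In1 N p q, pre A (F (In1 N p q)) (snd u))"
    and "u \<cdot>\<^bsub>lifts\<^esub> in2 p q = (fst u \<cdot>\<^bsub>N\<^esub> In2 N p q, pre A (F (In2 N p q)) (snd u))"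
proof -
  note g = lifts_Hom_fst[OF u]
  show "u \<cdot>\<^bsub>lifts\<^esub> in1 p q = (fst u \<cdot>\<^bsub>N\<^esub> In1 N p q, pre A (F (In1 N p q)) (snd u))"
    unfolding in1_def
    by (rule lifts_comp_trivial[OF nil_In_Hom(1) u \<phi>.PComp_In(1)[OF g] \<psi>.PComp_In(1)[OF g] a_In(1)])
  show "u \<cdot>\<^bsub>lifts\<^esub> in2 p q = (fst u \<cdot>\<^bsub>N\<^esub> In2 N p q, pre A (F (In2 N p q)) (snd u))"
    unfolding in2_def
    by (rule lifts_comp_trivial[OF nil_In_Hom(2) u \<phi>.PComp_In(2)[OF g] \<psi>.PComp_In(2)[OF g] a_In(2)])
qed

lemma in_inc:
  "i \<in> {1..p} \<Longrightarrow> in1 p q \<cdot>\<^bsub>lifts\<^esub> inc p i = inc (p + q) i"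
  "i \<in> {1..q} \<Longrightarrow> in2 p q \<cdot>\<^bsub>lifts\<^esub> inc q i = inc (p + q) (p + i)"
proof -
  note In = nil_In_Hom[of n p q]
  have *: "pre A (\<phi>.e s i) (VId A (a (p + q) \<cdot> F k)) = VId A (a (p + q) \<cdot> F (k \<cdot>\<^bsub>N\<^esub> nil_in n s i))"
    if k: "k \<in> Hom N s (p + q)" and i: "i \<in> {1..s}" for k s i
    unfolding pre_VId[OF \<phi>.e_Hom[OF i] Comp_Hom[OF \<phi>.PArr_Hom[OF k] a_Hom]]
      \<phi>.PArr_Comp_nil_in[OF i k] Comp_assoc[OF \<phi>.e_Hom[OF i] \<phi>.PArr_Hom[OF k] a_Hom] ..
  show "in1 p q \<cdot>\<^bsub>lifts\<^esub> inc p i = inc (p + q) i" if i: "i \<in> {1..p}"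
    using comp_inc[OF i in_Hom(1)] *[OF In(1) i] In1_nil_in[OF i] by (simp add: in1_def inc_def)
  show "in2 p q \<cdot>\<^bsub>lifts\<^esub> inc q i = inc (p + q) (p + i)" if i: "i \<in> {1..q}"
    using comp_inc[OF i in_Hom(2)] *[OF In(2) i] In2_nil_in[OF i] by (simp add: in2_def inc_def)
qed

text \<open>The section is trivial at the inclusions of \<open>1\<close>, and these detect lifts;
  hence it is trivial at all binary inclusions, which is what preservation of coproducts by
  \<open>\<Gamma>\<close> requires.\<close>

lemma section_In: "ext.nil_section (In1 N p q) = in1 p q" "ext.nil_section (In2 N p q) = in2 p q"
proof -
  show "ext.nil_section (In1 N p q) = in1 p q"
  proof (rule lifts_eqI[OF ext.nil_section_Hom[OF nil_In_Hom(1)] in_Hom(1)])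
    fix i assume i: "i \<in> {1..p}"
    then have i': "i \<in> {1..p + q}" by auto
    show "ext.nil_section (In1 N p q) \<cdot>\<^bsub>lifts\<^esub> inc p i = in1 p q \<cdot>\<^bsub>lifts\<^esub> inc p i"
      using ext.nil_section_Comp[OF nil_in_Hom[OF i] nil_In_Hom(1)] ext.nil_section_nil_in[OF i]
        ext.nil_section_nil_in[OF i'] in_inc(1)[OF i] In1_nil_in[OF i] by simp
  qed
  show "ext.nil_section (In2 N p q) = in2 p q"
  proof (rule lifts_eqI[OF ext.nil_section_Hom[OF nil_In_Hom(2)] in_Hom(2)])
    fix i assume i: "i \<in> {1..q}"
    then have i': "p + i \<in> {1..p + q}" by auto
    show "ext.nil_section (In2 N p q) \<cdot>\<^bsub>lifts\<^esub> inc q i = in2 p q \<cdot>\<^bsub>lifts\<^esub> inc q i"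
      using ext.nil_section_Comp[OF nil_in_Hom[OF i] nil_In_Hom(2)] ext.nil_section_nil_in[OF i]
        ext.nil_section_nil_in[OF i'] in_inc(2)[OF i] In2_nil_in[OF i] by simp
  qed
qed

definition \<Gamma> :: "(nat, nil_arrow, 'a, 't) pstrans" where
  "\<Gamma> = \<lparr>TObj = a, TArr = (\<lambda>g \<in> Arr N. snd (ext.nil_section g))\<rparr>"

lemma TObj_\<Gamma>: "TObj \<Gamma> = a"
  by (simp add: \<Gamma>_def)

lemma TArr_\<Gamma>:
  assumes "g \<in> Hom N p q"
  shows "ext.nil_section g = (g, TArr \<Gamma> g)"
  using ext.P_nil_section[OF assms] assms by (auto simp: \<Gamma>_def Hom_def prod_eq_iff)

lemma TArr_\<Gamma>_Track:
  assumes "g \<in> Hom N p q"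
  shows "TArr \<Gamma> g \<in> Track A (a q \<cdot> F g) (G g \<cdot> a p)"
  using ext.nil_section_Hom[OF assms] by (simp add: TArr_\<Gamma>[OF assms] lifts_Hom_iff)

lemma a_cop_comparison:
  "a (p + q) \<cdot> \<phi>.\<iota> p q = \<psi>.\<iota> p q \<cdot> cosum A (a p) (a q)"
proof -
  let ?C = "Cop A (PObj \<phi> p) (PObj \<phi> q)"
  note J = In1_Hom[OF \<phi>.PObj[of p] \<phi>.PObj[of q]] In2_Hom[OF \<phi>.PObj[of p] \<phi>.PObj[of q]]
  note J' = In1_Hom[OF \<psi>.PObj[of p] \<psi>.PObj[of q]] In2_Hom[OF \<psi>.PObj[of p] \<psi>.PObj[of q]]
  note c = copair[OF Comp_Hom[OF a_Hom[of p] J'(1)] Comp_Hom[OF a_Hom[of q] J'(2)]]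
  have cosum: "cosum A (a p) (a q) = copair A (In1 A (PObj \<psi> p) (PObj \<psi> q) \<cdot> a p)
      (In2 A (PObj \<psi> p) (PObj \<psi> q) \<cdot> a q)"
    by (simp add: cosum_def Arr_Hom(3)[OF a_Hom])
  show ?thesis
    unfolding cosum
  proof (rule Cop_Hom_eqI[OF Comp_Hom[OF \<phi>.cop_comparison_Hom a_Hom]
      Comp_Hom[OF c(1) \<psi>.cop_comparison_Hom] \<phi>.PObj \<phi>.PObj])
    let ?m = "copair A (In1 A (PObj \<psi> p) (PObj \<psi> q) \<cdot> a p) (In2 A (PObj \<psi> p) (PObj \<psi> q) \<cdot> a q)"
    show "a (p + q) \<cdot> \<phi>.\<iota> p q \<cdot> In1 A (PObj \<phi> p) (PObj \<phi> q)
        = \<psi>.\<iota> p q \<cdot> ?m \<cdot> In1 A (PObj \<phi> p) (PObj \<phi> q)"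
      unfolding Comp_assoc[OF J(1) \<phi>.cop_comparison_Hom a_Hom] \<phi>.cop_comparison_In1
        Comp_assoc[OF J(1) c(1) \<psi>.cop_comparison_Hom] c(2)
            Comp_assoc[OF a_Hom J'(1) \<psi>.cop_comparison_Hom, symmetric]
        \<psi>.cop_comparison_In1 by (rule a_In)
    show "a (p + q) \<cdot> \<phi>.\<iota> p q \<cdot> In2 A (PObj \<phi> p) (PObj \<phi> q)
        = \<psi>.\<iota> p q \<cdot> ?m \<cdot> In2 A (PObj \<phi> p) (PObj \<phi> q)"
      unfolding Comp_assoc[OF J(2) \<phi>.cop_comparison_Hom a_Hom] \<phi>.cop_comparison_In2
        Comp_assoc[OF J(2) c(1) \<psi>.cop_comparison_Hom] c(3)
            Comp_assoc[OF a_Hom J'(2) \<psi>.cop_comparison_Hom, symmetric]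
        \<psi>.cop_comparison_In2 by (rule a_In)
  qed
qed

lemma cop_pseudo_transformation_\<Gamma>: "cop_pseudo_transformation N A \<phi> \<psi> \<Gamma>"
proof
  show "TObj \<Gamma> \<in> extensional (Obj N)" by (simp add: nil_cat_simps(1))
  show "TArr \<Gamma> \<in> extensional (Arr N)" by (simp add: \<Gamma>_def)
  show "TObj \<Gamma> p \<in> Hom A (PObj \<phi> p) (PObj \<psi> p)" for p by (simp add: TObj_\<Gamma> a_Hom)
  show "TArr \<Gamma> g \<in> Track A (TObj \<Gamma> q \<cdot> F g) (G g \<cdot> TObj \<Gamma> p)" if "g \<in> Hom N p q" for g p q
    using TArr_\<Gamma>_Track[OF that] by (simp add: TObj_\<Gamma>)
next
  fix h g p q r assume h: "h \<in> Hom N p q" and g: "g \<in> Hom N q r"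
  note s = TArr_\<Gamma>_Track[OF h] and t = TArr_\<Gamma>_Track[OF g]
  have "TArr \<Gamma> (g \<cdot>\<^bsub>N\<^esub> h) = lift_comp g (TArr \<Gamma> g) h (TArr \<Gamma> h)"
    using ext.nil_section_Comp[OF h g] TArr_\<Gamma>[OF h] TArr_\<Gamma>[OF g] TArr_\<Gamma>[OF \<phi>.C.Comp_Hom[OF h g]]
        by simp
  then show "TArr \<Gamma> (g \<cdot>\<^bsub>N\<^esub> h) \<box> post A (TObj \<Gamma> r) (PComp \<phi> g h) =
      pre A (TObj \<Gamma> p) (PComp \<psi> g h) \<box> post A (G g) (TArr \<Gamma> h) \<box> pre A (F h) (TArr \<Gamma> g)"
    using lift_comp_eq[OF h g s t] VComp_assoc[OF lift_comp_pieces(4)[OF h g s t]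
        lift_comp_pieces(3)[OF h g s t]
        lift_comp_pieces(2)[OF h g s t]] by (simp add: TObj_\<Gamma>)
next
  fix p
  have "TArr \<Gamma> (Ident N p) = VId A (a p)"
    using TArr_\<Gamma>[OF Ident_N_Hom[of p]] ext.nil_section_Ident[of p] by simp
  then show "pre A (TObj \<Gamma> p) (PUnit \<psi> p) \<box> TArr \<Gamma> (Ident N p) = post A (TObj \<Gamma> p) (PUnit \<phi> p)"
    using pre_VId[OF a_Hom[of p] Ident_Hom[OF \<psi>.PObj]] post_VId[OF Ident_Hom[OF \<phi>.PObj] a_Hom[of p]]
    by (simp add: TObj_\<Gamma> \<phi>.PUnit_trivial \<psi>.PUnit_trivial nil_cat_simps(1) Ident_left[OF a_Hom]
        Ident_right[OF a_Hom] VId_left[OF VId_Hom[OF a_Hom]])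
next
  fix p q
  show "TObj \<Gamma> (Cop N p q) \<cdot> \<phi>.\<iota> p q = \<psi>.\<iota> p q \<cdot> cosum A (TObj \<Gamma> p) (TObj \<Gamma> q)"
    by (simp add: TObj_\<Gamma> nil_cat_simps(7) a_cop_comparison)
next
  fix g h p q r assume g: "g \<in> Hom N p r" and h: "h \<in> Hom N q r"
  note m = nil_copair[OF g h]
  let ?m = "copair N g h"
  note M = lifts_HTrack[OF ext.nil_section_Hom[OF m(1)], unfolded TArr_\<Gamma>[OF m(1)] snd_conv]
  note J = In1_Hom[OF \<phi>.PObj[of p] \<phi>.PObj[of q]] In2_Hom[OF \<phi>.PObj[of p] \<phi>.PObj[of q]]
  have TH: "TArr \<Gamma> k \<in> HTrack A (PObj \<phi> s) (PObj \<psi> r)" if "k \<in> Hom N s r" for k s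
    by (rule HTrackI[OF TArr_\<Gamma>_Track[OF that] Comp_Hom[OF \<phi>.PArr_Hom[OF that] a_Hom]])
  \<comment> \<open>Whiskering with \<open>F (In1 N p q)\<close> is composition with
    \<open>in1 p q\<close> among lifts, and \<open>in1 p q\<close> is the value of the section
    there, so functoriality identifies the component.\<close>
  have 1: "pre A (F (In1 N p q)) (TArr \<Gamma> ?m) = TArr \<Gamma> g"
    using ext.nil_section_Comp[OF nil_In_Hom(1) m(1)] comp_in(1)[OF ext.nil_section_Hom[OF m(1)]]
    by (simp add: section_In m(2) TArr_\<Gamma>[OF m(1)] TArr_\<Gamma>[OF g])
  have 2: "pre A (F (In2 N p q)) (TArr \<Gamma> ?m) = TArr \<Gamma> h"
    using ext.nil_section_Comp[OF nil_In_Hom(2) m(1)] comp_in(2)[OF ext.nil_section_Hom[OF m(1)]]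
    by (simp add: section_In m(3) TArr_\<Gamma>[OF m(1)] TArr_\<Gamma>[OF h])
  show "pre A (\<phi>.\<iota> p q) (TArr \<Gamma> ?m) = tcopair A (TArr \<Gamma> g) (TArr \<Gamma> h)"
  proof (rule tcopair_eqI[OF TH[OF g] TH[OF h] pre_HTrack[OF M \<phi>.cop_comparison_Hom]])
    show "pre A (In1 A (PObj \<phi> p) (PObj \<phi> q)) (pre A (\<phi>.\<iota> p q) (TArr \<Gamma> ?m)) = TArr \<Gamma> g"
      unfolding pre_pre[OF M \<phi>.cop_comparison_Hom J(1)] \<phi>.cop_comparison_In1 by (rule 1)
    show "pre A (In2 A (PObj \<phi> p) (PObj \<phi> q)) (pre A (\<phi>.\<iota> p q) (TArr \<Gamma> ?m)) = TArr \<Gamma> h"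
      unfolding pre_pre[OF M \<phi>.cop_comparison_Hom J(2)] \<phi>.cop_comparison_In2 by (rule 2)
  qed
qed

section \<open>Uniqueness of the transformation\<close>

context
  fixes \<alpha> :: "(nat, nil_arrow, 'a, 't) pstrans"
  assumes \<alpha>: "cop_pseudo_transformation N A \<phi> \<psi> \<alpha>" and \<alpha>_1: "TObj \<alpha> 1 = f"
begin

interpretation \<alpha>: cop_pseudo_transformation N A \<phi> \<psi> \<alpha> by (rule \<alpha>)

lemma TObj_\<alpha>_Hom: "TObj \<alpha> p \<in> Hom A (PObj \<phi> p) (PObj \<psi> p)"
  by (rule \<alpha>.TObj_Hom) (simp add: nil_cat_simps)

text \<open>Restricting \<open>TObj_Cop\<close> along the two inclusions of the strict coproduct
  turns a condition on comparison maps into equations that permit induction on the number of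
  summands.\<close>

lemma TObj_\<alpha>_In:
  "TObj \<alpha> (p + q) \<cdot> F (In1 N p q) = G (In1 N p q) \<cdot> TObj \<alpha> p"
  "TObj \<alpha> (p + q) \<cdot> F (In2 N p q) = G (In2 N p q) \<cdot> TObj \<alpha> q"
proof -
  note J = In1_Hom[OF \<phi>.PObj[of p] \<phi>.PObj[of q]] In2_Hom[OF \<phi>.PObj[of p] \<phi>.PObj[of q]]
  note J' = In1_Hom[OF \<psi>.PObj[of p] \<psi>.PObj[of q]] In2_Hom[OF \<psi>.PObj[of p] \<psi>.PObj[of q]]
  note c = copair[OF Comp_Hom[OF TObj_\<alpha>_Hom[of p] J'(1)] Comp_Hom[OF TObj_\<alpha>_Hom[of q] J'(2)]]
  let ?m = "copair A (In1 A (PObj \<psi> p) (PObj \<psi> q) \<cdot> TObj \<alpha> p)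
      (In2 A (PObj \<psi> p) (PObj \<psi> q) \<cdot> TObj \<alpha> q)"
  have eq: "TObj \<alpha> (p + q) \<cdot> \<phi>.\<iota> p q = \<psi>.\<iota> p q \<cdot> ?m"
    using \<alpha>.TObj_Cop[of p q] by (simp add: nil_cat_simps(1,7) cosum_def Arr_Hom(3)[OF TObj_\<alpha>_Hom])
  show "TObj \<alpha> (p + q) \<cdot> F (In1 N p q) = G (In1 N p q) \<cdot> TObj \<alpha> p"
    unfolding \<phi>.cop_comparison_In1[symmetric] \<psi>.cop_comparison_In1[symmetric]
      Comp_assoc[OF J(1) \<phi>.cop_comparison_Hom TObj_\<alpha>_Hom, symmetric] eq
      Comp_assoc[OF J(1) c(1) \<psi>.cop_comparison_Hom] c(2)
      Comp_assoc[OF TObj_\<alpha>_Hom J'(1) \<psi>.cop_comparison_Hom] ..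
  show "TObj \<alpha> (p + q) \<cdot> F (In2 N p q) = G (In2 N p q) \<cdot> TObj \<alpha> q"
    unfolding \<phi>.cop_comparison_In2[symmetric] \<psi>.cop_comparison_In2[symmetric]
      Comp_assoc[OF J(2) \<phi>.cop_comparison_Hom TObj_\<alpha>_Hom, symmetric] eq
      Comp_assoc[OF J(2) c(1) \<psi>.cop_comparison_Hom] c(3)
      Comp_assoc[OF TObj_\<alpha>_Hom J'(2) \<psi>.cop_comparison_Hom] ..
qed

lemma TObj_\<alpha>_e: "i \<in> {1..p} \<Longrightarrow> TObj \<alpha> p \<cdot> \<phi>.e p i = \<psi>.e p i \<cdot> f"
proof (induction p arbitrary: i)
  case (Suc p)
  note In = nil_In_Hom[of n p 1]
  have "TObj \<alpha> (p + 1) \<cdot> \<phi>.e (p + 1) i = \<psi>.e (p + 1) i \<cdot> f"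
  proof (cases "i = p + 1")
    case True
    then show ?thesis using TObj_\<alpha>_In(2)[of p 1] \<alpha>_1 by (simp add: \<phi>.e_Suc(2) \<psi>.e_Suc(2))
  next
    case False
    then have i: "i \<in> {1..p}" using Suc.prems by auto
    note H = \<phi>.e_Hom[OF i] \<phi>.PArr_Hom[OF In(1)] \<psi>.e_Hom[OF i] \<psi>.PArr_Hom[OF In(1)]
    show ?thesis
      unfolding \<phi>.e_Suc(1)[OF i] \<psi>.e_Suc(1)[OF i] Comp_assoc[OF H(1,2) TObj_\<alpha>_Hom, symmetric]
        TObj_\<alpha>_In Comp_assoc[OF H(1) TObj_\<alpha>_Hom H(4)] Suc.IH[OF i] Comp_assoc[OF f H(3,4)] ..
  qed
  then show ?case by simp
qed simp

lemma TObj_\<alpha>: "TObj \<alpha> = a"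
  using a_eqI[OF TObj_\<alpha>_Hom TObj_\<alpha>_e] by (rule ext)

lemma TArr_\<alpha>_Track: "g \<in> Hom N p q \<Longrightarrow> TArr \<alpha> g \<in> Track A (a q \<cdot> F g) (G g \<cdot> a p)"
  using \<alpha>.TArr_Track by (simp add: TObj_\<alpha>)

lemma TArr_\<alpha>_Hom: "g \<in> Hom N p q \<Longrightarrow> (g, TArr \<alpha> g) \<in> Hom lifts p q"
  by (simp add: lifts_Hom_iff TArr_\<alpha>_Track)

lemma TArr_\<alpha>_Comp:
  assumes h: "h \<in> Hom N p q" and g: "g \<in> Hom N q r"
  shows "(g \<cdot>\<^bsub>N\<^esub> h, TArr \<alpha> (g \<cdot>\<^bsub>N\<^esub> h)) = (g, TArr \<alpha> g) \<cdot>\<^bsub>lifts\<^esub> (h, TArr \<alpha> h)"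
proof -
  note s = TArr_\<alpha>_Track[OF h] and t = TArr_\<alpha>_Track[OF g]
  have "lift_comp g (TArr \<alpha> g) h (TArr \<alpha> h) = TArr \<alpha> (g \<cdot>\<^bsub>N\<^esub> h)"
    using \<alpha>.TArr_Comp[OF h g] VComp_assoc[OF lift_comp_pieces(4)[OF h g s t]
        lift_comp_pieces(3)[OF h g s t]
        lift_comp_pieces(2)[OF h g s t]]
    by (intro lift_comp_eqI[OF h g s t TArr_\<alpha>_Track[OF \<phi>.C.Comp_Hom[OF h g]]]) (simp add: TObj_\<alpha>)
  then show ?thesis by simp
qed

lemma TArr_\<alpha>_Ident: "TArr \<alpha> (Ident N p) = VId A (a p)"
proof -
  have T: "TArr \<alpha> (Ident N p) \<in> Track A (a p) (a p)"
    using TArr_\<alpha>_Track[OF Ident_N_Hom[of p]]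
    by (simp add: PArr_Ident_N Ident_left[OF a_Hom] Ident_right[OF a_Hom])
  then show ?thesis
    using \<alpha>.TArr_Ident[of p] pre_VId[OF a_Hom[of p] Ident_Hom[OF \<psi>.PObj]]
      post_VId[OF Ident_Hom[OF \<phi>.PObj] a_Hom[of p]] VId_left[OF T]
    by (simp add: TObj_\<alpha> \<phi>.PUnit_trivial \<psi>.PUnit_trivial nil_cat_simps(1) Ident_left[OF a_Hom]
        Ident_right[OF a_Hom])
qed

text \<open>As in \<open>PComp_In\<close>, the copair of the inclusions is the identity. There
  \<alpha> is trivial by its unit axiom, so its two components are trivial as well.\<close>

lemma TArr_\<alpha>_In: "(In1 N p q, TArr \<alpha> (In1 N p q)) = in1 p q" "(In2 N p q, TArr \<alpha> (In2 N p q))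
    = in2 p q"
proof -
  note In = nil_In_Hom[of n p q]
  note J = In1_Hom[OF \<phi>.PObj[of p] \<phi>.PObj[of q]] In2_Hom[OF \<phi>.PObj[of p] \<phi>.PObj[of q]]
  have "copair N (In1 N p q) (In2 N p q) = Ident N (p + q)"
    by (rule nil_copair_eqI[OF In Ident_N_Hom])
        (simp_all add: \<phi>.C.Ident_left[OF In(1)] \<phi>.C.Ident_left[OF In(2)])
  then have eq: "pre A (\<phi>.\<iota> p q) (VId A (a (p + q)))
      = tcopair A (TArr \<alpha> (In1 N p q)) (TArr \<alpha> (In2 N p q))"
    using \<alpha>.TArr_copair[OF In] by (simp add: TArr_\<alpha>_Ident)
  note T = lifts_HTrack[OF TArr_\<alpha>_Hom[OF In(1)], unfolded snd_conv]
    lifts_HTrack[OF TArr_\<alpha>_Hom[OF In(2)], unfolded snd_conv]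
  note V = VId_HTrack[OF a_Hom[of "p + q"]]
  have "TArr \<alpha> (In1 N p q) = VId A (a (p + q) \<cdot> F (In1 N p q))"
    using tcopair_In1[OF T] pre_pre[OF V \<phi>.cop_comparison_Hom J(1)]
      pre_VId[OF \<phi>.PArr_Hom[OF In(1)] a_Hom] by (simp add: eq \<phi>.cop_comparison_In1)
  then show "(In1 N p q, TArr \<alpha> (In1 N p q)) = in1 p q" by (simp add: in1_def)
  have "TArr \<alpha> (In2 N p q) = VId A (a (p + q) \<cdot> F (In2 N p q))"
    using tcopair_In2[OF T] pre_pre[OF V \<phi>.cop_comparison_Hom J(2)]
      pre_VId[OF \<phi>.PArr_Hom[OF In(2)] a_Hom] by (simp add: eq \<phi>.cop_comparison_In2)
  then show "(In2 N p q, TArr \<alpha> (In2 N p q)) = in2 p q" by (simp add: in2_def)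
qed

lemma TArr_\<alpha>_nil_in: "i \<in> {1..q} \<Longrightarrow> (nil_in n q i, TArr \<alpha> (nil_in n q i)) = inc q i"
proof (induction q arbitrary: i)
  case (Suc q)
  note In = nil_In_Hom[of n q 1]
  have "(nil_in n (q + 1) i, TArr \<alpha> (nil_in n (q + 1) i)) = inc (q + 1) i"
  proof (cases "i = q + 1")
    case True
    have "in2 q 1 = inc (q + 1) (q + 1)"
      using in_inc(2)[of 1 1 q] ext.Ident_right[OF in_Hom(2)] by (simp add: inc_1)
    then show ?thesis using TArr_\<alpha>_In(2)[of q 1] by (simp add: True nil_in_Suc(2))
  next
    case False
    then have i: "i \<in> {1..q}" using Suc.prems by auto
    show ?thesis
      using TArr_\<alpha>_Comp[OF nil_in_Hom[OF i] In(1)]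
      unfolding nil_in_Suc(1)[OF i] TArr_\<alpha>_In Suc.IH[OF i] in_inc(1)[OF i] .
  qed
  then show ?case by simp
qed simp

text \<open>The composition axiom and triviality at the inclusions make the tracks of \<alpha> a
  section of the category of lifts, and there is only one.\<close>

lemma \<alpha>_eq_\<Gamma>: "\<alpha> = \<Gamma>"
proof -
  have S: "ext.is_section (\<lambda>g. (g, TArr \<alpha> g))"
    unfolding ext.is_section_def using TArr_\<alpha>_Hom TArr_\<alpha>_Comp TArr_\<alpha>_nil_in by simp
  have "TArr \<alpha> = TArr \<Gamma>"
  proof (rule extensionalityI[OF \<alpha>.TArr_extensional])
    show "TArr \<Gamma> \<in> extensional (Arr N)" by (simp add: \<Gamma>_def)
    fix g assume "g \<in> Arr N"
    then have g: "g \<in> Hom N (Dom N g) (Cod N g)" by (simp add: Hom_def)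
    show "TArr \<alpha> g = TArr \<Gamma> g"
      using ext.is_section_unique[OF S g] TArr_\<Gamma>[OF g] by simp
  qed
  then show ?thesis by (cases \<alpha>; cases \<Gamma>) (use TObj_\<alpha> TObj_\<Gamma> in simp)
qed

end

end

theorem theorem2p11:
  fixes n :: enat
    and A :: "('o, 'a, 't) trackcat"
    and H :: "'o \<Rightarrow> 'o \<Rightarrow> 'a set monoid"
    and D :: "'o \<Rightarrow> 'o \<Rightarrow> 'd monoid"
    and Dm :: "'a set \<Rightarrow> 'a set \<Rightarrow> 'd \<Rightarrow> 'd"
    and \<sigma> :: "'a \<Rightarrow> 'd \<Rightarrow> 't"
    and R :: "'o \<Rightarrow> (nat, nil_arrow, 'o, 'a, 't) psfunctor"
    and F\<^sub>X F\<^sub>Y :: "(nat, nil_arrow, 'o, 'a, 't) psfunctor"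
    and X Y :: 'o and f :: 'a
  assumes "n \<ge> 1"
    and "additive_track_category A H D Dm \<sigma>"
    and "strict_coproducts A"
    and "weak_nil_ringoid n A R"
    and "X \<in> Obj A" and "Y \<in> Obj A"
    and "weak_nil_cogroup n A X F\<^sub>X" and "weak_nil_cogroup n A Y F\<^sub>Y"
    and "f \<in> Hom A X Y"
  shows "\<exists>!\<Gamma>. \<Gamma> \<in> Pseudo_Hom (nil_cat n) A F\<^sub>X F\<^sub>Y \<and> TObj \<Gamma> 1 = f"
proof -
  interpret additive_track_category A H D Dm \<sigma> by fact
  interpret F: cop_pseudofunctor "nil_cat n" A F\<^sub>X
    using assms(7) by (simp add: weak_nil_cogroup_def Pseudo_Obj_def)
  interpret G: cop_pseudofunctor "nil_cat n" A F\<^sub>Y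
    using assms(8) by (simp add: weak_nil_cogroup_def Pseudo_Obj_def)
  interpret S: strict_track_category A by unfold_locales (rule assms(3), rule strict_zero)
  have f: "f \<in> Hom A (PObj F\<^sub>X 1) (PObj F\<^sub>Y 1)"
    using assms(7-9) by (simp add: weak_nil_cogroup_def)
  interpret L: additive_lifting n A H D Dm \<sigma> F\<^sub>X F\<^sub>Y f
    by unfold_locales (rule f, rule assms(1))
  have P: "\<Gamma> \<in> Pseudo_Hom (nil_cat n) A F\<^sub>X F\<^sub>Y
      \<longleftrightarrow> cop_pseudo_transformation (nil_cat n) A F\<^sub>X F\<^sub>Y \<Gamma>" for \<Gamma>
    using assms(7,8) by (simp add: Pseudo_Hom_def weak_nil_cogroup_def)
  show ?thesis
  proof (rule ex1I[of _ L.\<Gamma>])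
    show "L.\<Gamma> \<in> Pseudo_Hom (nil_cat n) A F\<^sub>X F\<^sub>Y \<and> TObj L.\<Gamma> 1 = f"
      using L.cop_pseudo_transformation_\<Gamma> by (simp add: P L.TObj_\<Gamma> L.a_1)
    fix \<alpha> assume "\<alpha> \<in> Pseudo_Hom (nil_cat n) A F\<^sub>X F\<^sub>Y \<and> TObj \<alpha> 1 = f"
    then show "\<alpha> = L.\<Gamma>" using L.\<alpha>_eq_\<Gamma>[of \<alpha>] by (simp add: P)
  qed
qed

end
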